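(* Let $(M^n,g)$ be a simply connected Riemannian manifold and let $\lambda\in\mathbb{R}$. Define $B\in\mathrm{Hom}(TM,F)$, $F=\Lambda^2T^*M\otimes TM$, by $$B(x)=A^W(x)-\frac{1}{n-1}(\mathrm{tr}A^W)(x)\wedge g$$ for all $x\in TM$, where $A^W=\mathrm{Rm}+\mathrm{Ric}\wedge g$, and suppose that $B$ is (pointwise) injective. Define $D\in\mathrm{Hom}(TM,F)$ by $D=B\circ\check B^{-1}$, and set $$K=-\langle d\mathrm{Ric},D(\cdot)\rangle_F^\sharp .$$ Then $(M^n,g)$ admits a static potential with cosmological constant $\lambda$ if and only if the scalar curvature satisfies $R=(n-1)\lambda$ and the $(0,2)$-tensor $$G=\mathrm{Ric}-\nabla K-K\otimes K-\lambda g$$ vanishes.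
   Context: $n\ge2$. Conventions: $\mathrm{Rm}(x,y)w=-\nabla_x\nabla_yw+\nabla_y\nabla_xw+\nabla_{[x,y]}w$, $\mathrm{Rm}(x,y,w,z)=\langle \mathrm{Rm}(x,y)w,z\rangle$, so $\mathrm{Ric}(y,z)=\sum_i\mathrm{Rm}(e_i,y,e_i,z)$ for an orthonormal basis $\{e_i\}$. For symmetric 2-tensors, $h\wedge k$ is the Kulkarni–Nomizu product $(h\wedge k)(x,y,w,z)=h(x,w)k(y,z)+h(y,z)k(x,w)-h(x,z)k(y,w)-h(y,w)k(x,z)$. $A^W$ is viewed in $\mathrm{Hom}(TM,F)$ by $A^W(x)=A^W(\cdot,\cdot,x,\cdot)$; $(\mathrm{tr}A^W)(y,z)=\sum_iA^W(e_i,y,e_i,z)$ and $(\mathrm{tr}A^W)(x)$ is the one-form $(\mathrm{tr}A^W)(x,\cdot)$. For a one-form $\alpha$, $(\alpha\wedge g)(x,y,z)=\alpha(x)g(y,z)-\alpha(y)g(x,z)$, regarded as a section of $F$ via $g$. $d\mathrm{Ric}(x,y,z)=\nabla_x\mathrm{Ric}(y,z)-\nabla_y\mathrm{Ric}(x,z)$, also regarded as a section of $F$. For $A,B\in\mathrm{Hom}(TM,F)$ define $A\vee B\in\mathrm{End}(TM)$ by $\langle(A\vee B)(x),y\rangle=\langle A(x),B(y)\rangle_F$, where $\langle\cdot,\cdot\rangle_F$ is the metric on $F$ induced by $g$, and $\check B=B\vee B$, which is invertible when $B$ is injective. $\sharp:T^*M\to TM$ is the musical isomorphism; in $G$, $K$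 is identified with its dual one-form. A static potential with cosmological constant $\lambda$ on $(M^n,g)$ is a nonnegative function $v\in C^\infty(M)$, not identically zero, such that $0=v\,\mathrm{Ric}-\nabla^2v+\Delta v\,g$ and $R=(n-1)\lambda$. *)

theory Defs
  imports "HOL-Analysis.Analysis"
begin

section \<open>Smooth manifolds and Riemannian metrics\<close>

text \<open>\<open>Ck_on k S f\<close>: \<open>f\<close> is of class \<open>C^k\<close> on the open set \<open>S\<close>.\<close>

primrec Ck_on :: "nat \<Rightarrow> 'a::real_normed_vector set \<Rightarrow> ('a \<Rightarrow> 'b::real_normed_vector) \<Rightarrow> bool" where
  "Ck_on 0 S f \<longleftrightarrow> continuous_on S f"
| "Ck_on (Suc k) S f \<longleftrightarrow> (\<forall>p\<in>S. f differentiable (at p)) \<and>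
     (\<forall>x. Ck_on k S (\<lambda>p. frechet_derivative f (at p) x))"

definition smooth_on :: "'a::real_normed_vector set \<Rightarrow> ('a \<Rightarrow> 'b::real_normed_vector) \<Rightarrow> bool" where
  "smooth_on S f \<longleftrightarrow> (\<forall>k. Ck_on k S f)"

text \<open>The manifold \<open>M\<close> is the whole type \<open>'m\<close>, its dimension is \<open>CARD('n)\<close>. A chart is a pair
  of a domain and a coordinate map, whose values outside the domain are irrelevant.\<close>

type_synonym ('m, 'n) chart = "'m set \<times> ('m \<Rightarrow> real^'n)"

definition chart_image :: "('m, 'n) chart \<Rightarrow> (real^'n) set" where
  "chart_image c = snd c ` fst c"

definition chart_inv :: "('m, 'n) chart \<Rightarrow> real^'n \<Rightarrow> 'm" where
  "chart_inv c = inv_into (fst c) (snd c)"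

definition transition :: "('m, 'n) chart \<Rightarrow> ('m, 'n) chart \<Rightarrow> real^'n \<Rightarrow> real^'n" where
  "transition c d = snd d \<circ> chart_inv c"

definition smooth_atlas ::
  "('m::{t2_space,second_countable_topology}, 'n::finite) chart set \<Rightarrow> bool" where
  "smooth_atlas A \<longleftrightarrow>
     (\<Union>c\<in>A. fst c) = UNIV \<and>
     (\<forall>c\<in>A. open (fst c) \<and> open (chart_image c) \<and>
        homeomorphism (fst c) (chart_image c) (snd c) (chart_inv c)) \<and>
     (\<forall>c\<in>A. \<forall>d\<in>A. smooth_on (snd c ` (fst c \<inter> fst d)) (transition c d))"

definition smooth_function ::
  "('m::{t2_space,second_countable_topology}, 'n::finite) chart set \<Rightarrow> ('m \<Rightarrow> real) \<Rightarrow> bool" where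
  "smooth_function A f \<longleftrightarrow> (\<forall>c\<in>A. smooth_on (chart_image c) (f \<circ> chart_inv c))"

text \<open>Tensor fields on \<open>M\<close> are represented by their expressions in the charts of the atlas. In a
  chart, a tangent vector at a point is a vector of \<open>real^'n\<close>, and a covariant 2-tensor field is
  a map sending a point of the chart image to a bilinear form on \<open>real^'n\<close>.\<close>

type_synonym 'n bform = "real^'n \<Rightarrow> real^'n \<Rightarrow> real"
type_synonym 'n metric = "real^'n \<Rightarrow> 'n bform"

text \<open>A Riemannian metric on \<open>M\<close>: \<open>g c p\<close> is the inner product of the tangent space at the point
  with coordinates \<open>p\<close> in the chart \<open>c\<close>; the last clause says that the chart expressions are
  related by the coordinate changes, i.e. come from one tensor field on \<open>M\<close>.\<close>

definition riemannian_metric ::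
  "('m::{t2_space,second_countable_topology}, 'n::finite) chart set
     \<Rightarrow> (('m, 'n) chart \<Rightarrow> 'n metric) \<Rightarrow> bool" where
  "riemannian_metric A g \<longleftrightarrow>
     (\<forall>c\<in>A. \<forall>p\<in>chart_image c.
        bilinear (g c p) \<and> (\<forall>x y. g c p x y = g c p y x) \<and> (\<forall>x. x \<noteq> 0 \<longrightarrow> g c p x x > 0)) \<and>
     (\<forall>c\<in>A. \<forall>x y. smooth_on (chart_image c) (\<lambda>p. g c p x y)) \<and>
     (\<forall>c\<in>A. \<forall>d\<in>A. \<forall>p\<in>snd c ` (fst c \<inter> fst d). \<forall>x y.
        g c p x y = g d (transition c d p)
          (frechet_derivative (transition c d) (at p) x)
          (frechet_derivative (transition c d) (at p) y))"

definition riemannian_manifold ::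
  "('m::{t2_space,second_countable_topology}, 'n::finite) chart set
     \<Rightarrow> (('m, 'n) chart \<Rightarrow> 'n metric) \<Rightarrow> bool" where
  "riemannian_manifold A g \<longleftrightarrow> smooth_atlas A \<and> riemannian_metric A g"


section \<open>Linear algebra of one tangent space\<close>

text \<open>In this section \<open>b\<close> is the inner product of a tangent space.\<close>

definition orthonormal_basis :: "'n::finite bform \<Rightarrow> ('n \<Rightarrow> real^'n) \<Rightarrow> bool" where
  "orthonormal_basis b e \<longleftrightarrow> (\<forall>i j. b (e i) (e j) = (if i = j then 1 else 0))"

text \<open>An arbitrarily chosen orthonormal basis; it is only used in traces and in the metric of
  \<open>F\<close>, which do not depend on the choice.\<close>

definition onb :: "'n::finite bform \<Rightarrow> 'n \<Rightarrow> real^'n" where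
  "onb b = (SOME e. orthonormal_basis b e)"

definition trace2 :: "'n::finite bform \<Rightarrow> 'n bform \<Rightarrow> real" where
  "trace2 b T = (\<Sum>i\<in>UNIV. T (onb b i) (onb b i))"

definition sharp :: "'n::finite bform \<Rightarrow> (real^'n \<Rightarrow> real) \<Rightarrow> real^'n" where
  "sharp b \<alpha> = (THE v. \<forall>y. b v y = \<alpha> y)"

definition flat :: "'n::finite bform \<Rightarrow> real^'n \<Rightarrow> real^'n \<Rightarrow> real" where
  "flat b v = (\<lambda>y. b v y)"

text \<open>Elements of the fibres of \<open>F = \<Lambda>\<^sup>2T\<^sup>*M \<otimes> TM\<close> are written as trilinear forms, skew in
  the first two arguments; the metric identifies the \<open>TM\<close> factor with the third argument.\<close>

type_synonym 'n tform = "real^'n \<Rightarrow> real^'n \<Rightarrow> real^'n \<Rightarrow> real"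

text \<open>The induced metric on \<open>F\<close>. The other common normalization, summing over \<open>i < j\<close> only, is half
  of this one; the factor cancels in \<open>D\<close> paired with a section of \<open>F\<close>.\<close>

definition inner_F :: "'n::finite bform \<Rightarrow> 'n tform \<Rightarrow> 'n tform \<Rightarrow> real" where
  "inner_F b S T = (\<Sum>i\<in>UNIV. \<Sum>j\<in>UNIV. \<Sum>k\<in>UNIV.
     S (onb b i) (onb b j) (onb b k) * T (onb b i) (onb b j) (onb b k))"

definition vee :: "'n::finite bform \<Rightarrow> (real^'n \<Rightarrow> 'n tform) \<Rightarrow> (real^'n \<Rightarrow> 'n tform)
    \<Rightarrow> real^'n \<Rightarrow> real^'n" where
  "vee b A B = (\<lambda>x. sharp b (\<lambda>y. inner_F b (A x) (B y)))"

definition kulkarni_nomizu :: "'n::finite bform \<Rightarrow> 'n bform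
    \<Rightarrow> real^'n \<Rightarrow> real^'n \<Rightarrow> real^'n \<Rightarrow> real^'n \<Rightarrow> real" where
  "kulkarni_nomizu h k x y w z = h x w * k y z + h y z * k x w - h x z * k y w - h y w * k x z"

definition wedge_metric :: "(real^'n \<Rightarrow> real) \<Rightarrow> 'n::finite bform \<Rightarrow> 'n tform" where
  "wedge_metric \<alpha> b x y z = \<alpha> x * b y z - \<alpha> y * b x z"


section \<open>Levi-Civita connection and curvature in a chart\<close>

text \<open>Here \<open>h\<close> is the metric in a chart. All derivatives are taken at points of the (open) chart image
  and so depend only on the values there.\<close>

definition ddir :: "(real^'n::finite \<Rightarrow> 'b::real_normed_vector) \<Rightarrow> real^'n \<Rightarrow> real^'n \<Rightarrow> 'b" where
  "ddir f p x = frechet_derivative f (at p) x"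

text \<open>The Levi-Civita connection of the chart is \<open>\<nabla>\<^sub>X Y = DY(X) + \<Gamma>(X, Y)\<close>, where \<open>\<Gamma>\<close> is the unique
  bilinear field which is symmetric (no torsion) and for which the metric is parallel.\<close>

definition christoffel :: "'n::finite metric \<Rightarrow> real^'n \<Rightarrow> real^'n \<Rightarrow> real^'n \<Rightarrow> real^'n" where
  "christoffel h p = (THE \<Gamma>. bilinear \<Gamma> \<and> (\<forall>x y. \<Gamma> x y = \<Gamma> y x) \<and>
     (\<forall>x y z. ddir (\<lambda>q. h q y z) p x = h p (\<Gamma> x y) z + h p y (\<Gamma> x z)))"

definition nabla :: "'n::finite metric \<Rightarrow> (real^'n \<Rightarrow> real^'n) \<Rightarrow> (real^'n \<Rightarrow> real^'n)
    \<Rightarrow> real^'n \<Rightarrow> real^'n" where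
  "nabla h X Y = (\<lambda>p. ddir Y p (X p) + christoffel h p (X p) (Y p))"

definition lie_bracket :: "(real^'n::finite \<Rightarrow> real^'n) \<Rightarrow> (real^'n \<Rightarrow> real^'n)
    \<Rightarrow> real^'n \<Rightarrow> real^'n" where
  "lie_bracket X Y = (\<lambda>p. ddir Y p (X p) - ddir X p (Y p))"

definition curv :: "'n::finite metric \<Rightarrow> (real^'n \<Rightarrow> real^'n) \<Rightarrow> (real^'n \<Rightarrow> real^'n)
    \<Rightarrow> (real^'n \<Rightarrow> real^'n) \<Rightarrow> real^'n \<Rightarrow> real^'n" where
  "curv h X Y W = (\<lambda>p. - nabla h X (nabla h Y W) p + nabla h Y (nabla h X W) p
     + nabla h (lie_bracket X Y) W p)"

text \<open>Tensors at a point are evaluated on tangent vectors by extending these to vector fields with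
  constant components in the chart; being tensorial, the result does not depend on the
  extension.\<close>

definition Rm :: "'n::finite metric \<Rightarrow> real^'n
    \<Rightarrow> real^'n \<Rightarrow> real^'n \<Rightarrow> real^'n \<Rightarrow> real^'n \<Rightarrow> real" where
  "Rm h p x y w z = h p (curv h (\<lambda>_. x) (\<lambda>_. y) (\<lambda>_. w) p) z"

definition Ric :: "'n::finite metric \<Rightarrow> 'n metric" where
  "Ric h p y z = trace2 (h p) (\<lambda>u v. Rm h p u y v z)"

definition scal :: "'n::finite metric \<Rightarrow> real^'n \<Rightarrow> real" where
  "scal h p = trace2 (h p) (Ric h p)"

text \<open>Covariant derivatives \<open>(\<nabla>\<^sub>x \<alpha>)(y)\<close> of a one-form and \<open>(\<nabla>\<^sub>x T)(y, z)\<close> of a covariant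
  2-tensor.\<close>

definition nabla_form :: "'n::finite metric \<Rightarrow> (real^'n \<Rightarrow> real^'n \<Rightarrow> real)
    \<Rightarrow> real^'n \<Rightarrow> real^'n \<Rightarrow> real^'n \<Rightarrow> real" where
  "nabla_form h \<alpha> p x y = ddir (\<lambda>q. \<alpha> q y) p x - \<alpha> p (nabla h (\<lambda>_. x) (\<lambda>_. y) p)"

definition nabla_tensor2 :: "'n::finite metric \<Rightarrow> (real^'n \<Rightarrow> 'n bform)
    \<Rightarrow> real^'n \<Rightarrow> real^'n \<Rightarrow> real^'n \<Rightarrow> real^'n \<Rightarrow> real" where
  "nabla_tensor2 h T p x y z = ddir (\<lambda>q. T q y z) p x
     - T p (nabla h (\<lambda>_. x) (\<lambda>_. y) p) z - T p y (nabla h (\<lambda>_. x) (\<lambda>_. z) p)"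

definition hessian :: "'n::finite metric \<Rightarrow> (real^'n \<Rightarrow> real) \<Rightarrow> real^'n \<Rightarrow> 'n bform" where
  "hessian h u = nabla_form h (ddir u)"

definition laplacian :: "'n::finite metric \<Rightarrow> (real^'n \<Rightarrow> real) \<Rightarrow> real^'n \<Rightarrow> real" where
  "laplacian h u p = trace2 (h p) (hessian h u p)"

definition dRic :: "'n::finite metric \<Rightarrow> real^'n \<Rightarrow> 'n tform" where
  "dRic h p x y z = nabla_tensor2 h (Ric h) p x y z - nabla_tensor2 h (Ric h) p y x z"


section \<open>Static potentials and the tensors \<open>A\<^sup>W\<close>, \<open>B\<close>, \<open>D\<close>, \<open>K\<close>, \<open>G\<close>\<close>

definition static_potential ::
  "('m::{t2_space,second_countable_topology}, 'n::finite) chart set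
     \<Rightarrow> (('m, 'n) chart \<Rightarrow> 'n metric) \<Rightarrow> real \<Rightarrow> ('m \<Rightarrow> real) \<Rightarrow> bool" where
  "static_potential A g lam v \<longleftrightarrow>
     smooth_function A v \<and> (\<forall>m. v m \<ge> 0) \<and> (\<exists>m. v m \<noteq> 0) \<and>
     (\<forall>c\<in>A. \<forall>p\<in>chart_image c.
        (\<forall>x y. 0 = v (chart_inv c p) * Ric (g c) p x y - hessian (g c) (v \<circ> chart_inv c) p x y
                  + laplacian (g c) (v \<circ> chart_inv c) p * g c p x y) \<and>
        scal (g c) p = (real CARD('n) - 1) * lam)"

definition AW :: "'n::finite metric \<Rightarrow> real^'n
    \<Rightarrow> real^'n \<Rightarrow> real^'n \<Rightarrow> real^'n \<Rightarrow> real^'n \<Rightarrow> real" where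
  "AW h p x y w z = Rm h p x y w z + kulkarni_nomizu (Ric h p) (h p) x y w z"

definition AW_hom :: "'n::finite metric \<Rightarrow> real^'n \<Rightarrow> real^'n \<Rightarrow> 'n tform" where
  "AW_hom h p x = (\<lambda>y z w. AW h p y z x w)"

definition tr_AW :: "'n::finite metric \<Rightarrow> 'n metric" where
  "tr_AW h p y z = trace2 (h p) (\<lambda>u v. AW h p u y v z)"

definition B_hom :: "'n::finite metric \<Rightarrow> real^'n \<Rightarrow> real^'n \<Rightarrow> 'n tform" where
  "B_hom h p x = (\<lambda>y z w. AW_hom h p x y z w
     - 1 / (real CARD('n) - 1) * wedge_metric (tr_AW h p x) (h p) y z w)"

definition B_check :: "'n::finite metric \<Rightarrow> real^'n \<Rightarrow> real^'n \<Rightarrow> real^'n" where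
  "B_check h p = vee (h p) (B_hom h p) (B_hom h p)"

definition D_hom :: "'n::finite metric \<Rightarrow> real^'n \<Rightarrow> real^'n \<Rightarrow> 'n tform" where
  "D_hom h p = B_hom h p \<circ> inv (B_check h p)"

definition K_field :: "'n::finite metric \<Rightarrow> real^'n \<Rightarrow> real^'n" where
  "K_field h p = - sharp (h p) (\<lambda>x. inner_F (h p) (dRic h p) (D_hom h p x))"

definition K_form :: "'n::finite metric \<Rightarrow> real^'n \<Rightarrow> real^'n \<Rightarrow> real" where
  "K_form h p = flat (h p) (K_field h p)"

definition G_tensor :: "'n::finite metric \<Rightarrow> real \<Rightarrow> 'n metric" where
  "G_tensor h lam p x y = Ric h p x y - nabla_form h (K_form h) p x y
     - K_form h p x * K_form h p y - lam * h p x y"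

end

theory Submission
  imports Defs
begin

text \<open>A static potential satisfies \<open>\<nabla>\<^sup>2v = v (Ric - \<lambda>g)\<close>, the trace of the static equation giving
  \<open>\<Delta>v = -\<lambda>v\<close>. This is a linear system for \<open>(v, dv)\<close> along curves, and \<open>dv = 0\<close> where the nonnegative
  \<open>v\<close> vanishes, so \<open>v\<close> is positive. Skew differentiation and the Ricci identity give
  \<open>v dRic = -B(\<nabla>v)\<close>, hence \<open>K = \<nabla> log v\<close>, and \<open>G = 0\<close> is the equation for \<open>\<nabla>\<^sup>2v\<close> again.

  Conversely \<open>G = 0\<close> makes \<open>K\<close> a closed form, \<open>Ric\<close> being symmetric, and \<open>v = exp f\<close> with \<open>df = K\<close> is
  a static potential. That local primitives in different charts differ by constants does not need
  the naturality of \<open>B\<close>, \<open>D\<close> and \<open>K\<close>: the exponential of a primitive for one chart, pulled back to the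
  other chart, solves the Hessian equation there, and a positive solution determines \<open>K\<close> by the
  first part. So only the naturality of \<open>\<nabla>\<^sup>2\<close> and \<open>Ric\<close> is used.\<close>

section \<open>Calculus of smooth functions\<close>

text \<open>The form of B is read off from the Ricci identity. With w the gradient of v it gives
  \<open>v dRic(x,y,z) = - Rm(x,y,w,z) - dv(x) (Ric - \<lambda>g)(y,z) + dv(y) (Ric -
  \<lambda>g)(x,z)\<close>. Half of the product of Ric and g in A^W supplies the terms with Ric(y,z)
  and Ric(x,z); the other half has to be removed and the terms with \<lambda> inserted. As tr A^W =
  (n - 1) Ric + R g and R = (n - 1) \<lambda>, dividing the trace by n - 1 gives Ric + \<lambda>g,
  which does both at once.

  Two obstacles shape the rest. K is built from traces in an arbitrarily chosen basis, from
  descriptions and from the inverse of an endomorphism, so its smoothness is not visible; each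
  ingredient is exhibited as the solution of a linear system with smooth coefficients, to which
  Cramer's rule applies. And the homotopies given by simple connectedness are merely continuous, so
  K cannot be integrated over them; instead, local primitives are continued along continuous maps,
  as in the theory of coverings.\<close>

abbreviation fd where "fd f p \<equiv> frechet_derivative f (at p)"

lemma ddir_eq_fd: "ddir f p = fd f p"
  by (simp add: ddir_def fun_eq_iff)

lemma fd_eq:
  assumes "(f has_derivative f') (at p)"
  shows "fd f p = f'"
  using frechet_derivative_at[OF assms] by simp

lemma fd_works:
  assumes "f differentiable (at p)"
  shows "(f has_derivative fd f p) (at p)"
  using assms frechet_derivative_works by blast

text \<open>\<open>frechet_derivative\<close> is a choice among all derivatives, and functions that
  agree near p have the same derivatives there, so the chosen values agree even where no derivative
  exists.\<close>

lemma fd_cong: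
  assumes "open S" "p \<in> S" "\<And>q. q \<in> S \<Longrightarrow> f q = g q"
  shows "fd f p = fd g p"
proof -
  have "(f has_derivative F) (at p) \<longleftrightarrow> (g has_derivative F) (at p)" for F
    using has_derivative_transform_within_open[OF _ assms(1,2)] assms(3) by metis
  then show ?thesis by (simp add: frechet_derivative_def fun_eq_iff)
qed

lemma linear_fd: "f differentiable (at p) \<Longrightarrow> linear (fd f p)"
  using fd_works has_derivative_linear by blast

section \<open>Closure properties of the classes \<open>Ck_on\<close>\<close>

lemma Ck_on_subset: "Ck_on k S f \<Longrightarrow> T \<subseteq> S \<Longrightarrow> Ck_on k T f"
  by (induction k arbitrary: f) (auto intro: continuous_on_subset)

lemma Ck_on_cong:
  assumes "open S" "\<And>p. p \<in> S \<Longrightarrow> f p = g p" "Ck_on k S f"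
  shows "Ck_on k S g"
  using assms(2,3)
proof (induction k arbitrary: f g)
  case 0
  then show ?case by (simp cong: continuous_on_cong)
next
  case (Suc k)
  have d: "g differentiable (at p)" if "p \<in> S" for p
    using Suc.prems that has_derivative_transform_within_open[OF _ assms(1) that]
    by (metis Ck_on.simps(2) differentiable_def)
  have eq: "fd f p x = fd g p x" if "p \<in> S" for p x
    using fd_cong[OF assms(1) that Suc.prems(1)] by simp
  have "Ck_on k S (\<lambda>p. fd g p x)" for x
    by (rule Suc.IH[OF eq]) (use Suc.prems(2) in simp_all)
  with d show ?case by simp
qed

text \<open>Lets the induction steps below work with a derivative given by a formula, such as a
  product rule, instead of the one chosen by \<open>frechet_derivative\<close>.\<close>

lemma Ck_on_SucI:
  assumes "open S" "\<And>p. p \<in> S \<Longrightarrow> (f has_derivative f' p) (at p)"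
    and "\<And>x. Ck_on k S (\<lambda>p. f' p x)"
  shows "Ck_on (Suc k) S f"
proof -
  have "Ck_on k S (\<lambda>p. frechet_derivative f (at p) x)" for x
    by (rule Ck_on_cong[OF assms(1) _ assms(3)[of x]]) (use frechet_derivative_at[OF assms(2)] in metis)
  then show ?thesis using assms(2) unfolding Ck_on.simps differentiable_def by blast
qed

lemma Ck_on_SucD:
  assumes "Ck_on (Suc k) S f"
  shows "p \<in> S \<Longrightarrow> (f has_derivative fd f p) (at p)" "Ck_on k S (\<lambda>p. fd f p x)"
  using assms fd_works by auto

lemma Ck_on_Suc_imp: "Ck_on (Suc k) S f \<Longrightarrow> Ck_on k S f"
proof (induction k arbitrary: f)
  case 0
  then show ?case
    by (auto intro: differentiable_imp_continuous_within continuous_at_imp_continuous_on)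
qed auto

lemma Ck_on_const: "Ck_on k S (\<lambda>_. c)"
  by (induction k arbitrary: c) auto

lemma Ck_on_bounded_linear:
  assumes S: "open S" and L: "bounded_linear L"
  shows "Ck_on k S f \<Longrightarrow> Ck_on k S (\<lambda>p. L (f p))"
proof (induction k arbitrary: f)
  case 0
  then show ?case using bounded_linear.continuous_on[OF L] by simp
next
  case (Suc k)
  show ?case
    using bounded_linear.has_derivative[OF L Ck_on_SucD(1)[OF Suc.prems]] Suc.IH[OF Ck_on_SucD(2)[OF Suc.prems]]
    by (rule Ck_on_SucI[OF S])
qed

lemma Ck_on_linear:
  fixes L :: "'a::euclidean_space \<Rightarrow> 'b::real_normed_vector"
  assumes S: "open S" and L: "linear L"
  shows "Ck_on k S L"
proof (cases k)
  case 0
  then show ?thesis using L by (simp add: linear_continuous_on linear_conv_bounded_linear)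
next
  case (Suc m)
  then show ?thesis
    using Ck_on_SucI[OF S, of L "\<lambda>_. L"] L
    by (simp add: Ck_on_const bounded_linear_imp_has_derivative linear_conv_bounded_linear)
qed

lemma Ck_on_add:
  assumes S: "open S"
  shows "Ck_on k S f \<Longrightarrow> Ck_on k S g \<Longrightarrow> Ck_on k S (\<lambda>p. f p + g p)"
proof (induction k arbitrary: f g)
  case 0
  then show ?case by (simp add: continuous_on_add)
next
  case (Suc k)
  show ?case
    using has_derivative_add[OF Ck_on_SucD(1)[OF Suc.prems(1)] Ck_on_SucD(1)[OF Suc.prems(2)]]
      Suc.IH[OF Ck_on_SucD(2)[OF Suc.prems(1)] Ck_on_SucD(2)[OF Suc.prems(2)]]
    by (rule Ck_on_SucI[OF S])
qed

lemma Ck_on_sum: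
  assumes S: "open S" and "\<And>i. i \<in> I \<Longrightarrow> Ck_on k S (f i)"
  shows "Ck_on k S (\<lambda>p. \<Sum>i\<in>I. f i p)"
  using assms(2)
  by (induction I rule: infinite_finite_induct) (simp_all add: Ck_on_const Ck_on_add[OF S])

lemma Ck_on_bounded_bilinear:
  assumes S: "open S" and B: "bounded_bilinear B"
  shows "Ck_on k S f \<Longrightarrow> Ck_on k S g \<Longrightarrow> Ck_on k S (\<lambda>p. B (f p) (g p))"
proof (induction k arbitrary: f g)
  case 0
  then show ?case using bounded_bilinear.continuous_on[OF B] by simp
next
  case (Suc k)
  show ?case
    using bounded_bilinear.FDERIV[OF B Ck_on_SucD(1)[OF Suc.prems(1)] Ck_on_SucD(1)[OF Suc.prems(2)]]
    by (rule Ck_on_SucI[OF S])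
       (assumption+, rule Ck_on_add[OF S Suc.IH[OF Ck_on_Suc_imp[OF Suc.prems(1)] Ck_on_SucD(2)[OF Suc.prems(2)]]
             Suc.IH[OF Ck_on_SucD(2)[OF Suc.prems(1)] Ck_on_Suc_imp[OF Suc.prems(2)]]])
qed

lemmas Ck_on_mult = Ck_on_bounded_bilinear[OF _ bounded_bilinear_mult]
lemmas Ck_on_scaleR = Ck_on_bounded_bilinear[OF _ bounded_bilinear_scaleR]

lemma Ck_on_prod:
  fixes f :: "'i \<Rightarrow> 'a::real_normed_vector \<Rightarrow> real"
  assumes S: "open S" and "\<And>i. i \<in> I \<Longrightarrow> Ck_on k S (f i)"
  shows "Ck_on k S (\<lambda>p. \<Prod>i\<in>I. f i p)"
  using assms(2)
  by (induction I rule: infinite_finite_induct) (simp_all add: Ck_on_const Ck_on_mult[OF S])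

text \<open>The chain rule applies the derivative of f to a vector that moves with p, while
  \<open>Ck_on\<close> controls derivatives in fixed directions only. Expanding over
  \<open>Basis\<close> gives products of components of the derivative of g with functions
  \<open>fd f _ b\<close> composed with g, and the latter are covered by the induction
  hypothesis.\<close>

lemma Ck_on_compose:
  fixes f :: "'b::euclidean_space \<Rightarrow> 'c::real_normed_vector" and g :: "'a::real_normed_vector \<Rightarrow> 'b"
  assumes S: "open S" and gk: "\<And>k. Ck_on k S g" and gT: "g ` S \<subseteq> T"
  shows "Ck_on k T f \<Longrightarrow> Ck_on k S (\<lambda>p. f (g p))"
proof (induction k arbitrary: f)
  case 0
  then show ?case using gk[of 0] gT continuous_on_compose2[of T f S g] by simp
next
  case (Suc k)
  let ?D = "\<lambda>p x. \<Sum>b\<in>Basis. (fd g p x \<bullet> b) *\<^sub>R fd f (g p) b"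
  have d: "((\<lambda>p. f (g p)) has_derivative ?D p) (at p)" if "p \<in> S" for p
  proof -
    have f: "(f has_derivative fd f (g p)) (at (g p))"
      using Ck_on_SucD(1)[OF Suc.prems] gT that by blast
    have lin: "fd f (g p) y = (\<Sum>b\<in>Basis. (y \<bullet> b) *\<^sub>R fd f (g p) b)" for y
      using linear_sum[OF has_derivative_linear[OF f], of "\<lambda>b. (y \<bullet> b) *\<^sub>R b" Basis]
      by (simp add: linear_scale[OF has_derivative_linear[OF f]] euclidean_representation)
    have "((\<lambda>p. f (g p)) has_derivative (\<lambda>x. fd f (g p) (fd g p x))) (at p)"
      using Ck_on_SucD(1)[OF gk[of 1, simplified One_nat_def] that] f by (rule has_derivative_compose)
    then show ?thesis unfolding lin[of "fd g p _"] .
  qed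
  show ?case
    by (rule Ck_on_SucI[OF S d], assumption)
      (intro Ck_on_sum S Ck_on_scaleR Suc.IH Ck_on_bounded_linear[OF S bounded_linear_inner_left]
          Ck_on_SucD(2)[OF gk] Ck_on_SucD(2)[OF Suc.prems])
qed

lemma Ck_on_exp: "Ck_on k UNIV (exp :: real \<Rightarrow> real)"
proof (induction k)
  case (Suc k)
  have "(exp has_derivative (\<lambda>x. x * exp p)) (at p)" for p :: real
    using DERIV_exp[of p] unfolding has_field_derivative_def
    by (rule has_derivative_eq_rhs) (simp add: fun_eq_iff)
  then show ?case
    by (rule Ck_on_SucI[OF open_UNIV]) (intro Ck_on_mult Ck_on_const Suc open_UNIV)
qed (simp add: continuous_on_exp)

lemma Ck_on_inverse: "Ck_on k (- {0}) (inverse :: real \<Rightarrow> real)"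
proof (induction k)
  case 0
  show ?case by (auto intro!: continuous_intros)
next
  case (Suc k)
  have "(inverse has_derivative (\<lambda>x. - (inverse p * x * inverse p))) (at p)" if "p \<in> - {0}" for p :: real
    using that by (intro has_derivative_inverse') auto
  moreover have "Ck_on k (- {0}) (\<lambda>p::real. - (inverse p * x * inverse p))" for x
    by (intro Ck_on_bounded_linear[where L=uminus] Ck_on_mult Ck_on_const Suc open_Compl
        bounded_linear_minus bounded_linear_ident) auto
  ultimately show ?case by (rule Ck_on_SucI[rotated]) auto
qed

section \<open>Closure properties of smooth maps\<close>

lemma smooth_on_differentiable:
  "smooth_on S f \<Longrightarrow> p \<in> S \<Longrightarrow> f differentiable (at p)"
  unfolding smooth_on_def by (metis Ck_on.simps(2))

lemma smooth_on_has_derivative: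
  "smooth_on S f \<Longrightarrow> p \<in> S \<Longrightarrow> (f has_derivative fd f p) (at p)"
  by (simp add: fd_works smooth_on_differentiable)

lemma smooth_on_fd: "smooth_on S f \<Longrightarrow> smooth_on S (\<lambda>p. fd f p x)"
  unfolding smooth_on_def by (metis Ck_on_SucD(2))

lemma smooth_on_imp_continuous_on: "smooth_on S f \<Longrightarrow> continuous_on S f"
  unfolding smooth_on_def by (metis Ck_on.simps(1))

lemma smooth_on_cong: "open S \<Longrightarrow> (\<And>p. p \<in> S \<Longrightarrow> f p = g p) \<Longrightarrow> smooth_on S f \<Longrightarrow> smooth_on S g"
  unfolding smooth_on_def using Ck_on_cong by blast

lemma smooth_on_subset: "smooth_on S f \<Longrightarrow> T \<subseteq> S \<Longrightarrow> smooth_on T f"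
  unfolding smooth_on_def using Ck_on_subset by blast

lemma smooth_on_const: "smooth_on S (\<lambda>_. c)"
  by (simp add: smooth_on_def Ck_on_const)

lemma smooth_on_bounded_linear:
  "open S \<Longrightarrow> bounded_linear L \<Longrightarrow> smooth_on S f \<Longrightarrow> smooth_on S (\<lambda>p. L (f p))"
  by (simp add: smooth_on_def Ck_on_bounded_linear)

lemma smooth_on_minus: "open S \<Longrightarrow> smooth_on S f \<Longrightarrow> smooth_on S (\<lambda>p. - f p)"
  using smooth_on_bounded_linear[OF _ bounded_linear_minus[OF bounded_linear_ident]] by auto

lemma smooth_on_add:
  "open S \<Longrightarrow> smooth_on S f \<Longrightarrow> smooth_on S g \<Longrightarrow> smooth_on S (\<lambda>p. f p + g p)"
  by (simp add: smooth_on_def Ck_on_add)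

lemma smooth_on_diff:
  "open S \<Longrightarrow> smooth_on S f \<Longrightarrow> smooth_on S g \<Longrightarrow> smooth_on S (\<lambda>p. f p - g p)"
  using smooth_on_add[OF _ _ smooth_on_minus, of S f g] by simp

lemma smooth_on_sum:
  "open S \<Longrightarrow> (\<And>i. i \<in> I \<Longrightarrow> smooth_on S (f i)) \<Longrightarrow> smooth_on S (\<lambda>p. \<Sum>i\<in>I. f i p)"
  by (simp add: smooth_on_def Ck_on_sum)

lemma smooth_on_mult:
  fixes f g :: "'a::real_normed_vector \<Rightarrow> real"
  shows "open S \<Longrightarrow> smooth_on S f \<Longrightarrow> smooth_on S g \<Longrightarrow> smooth_on S (\<lambda>p. f p * g p)"
  by (simp add: smooth_on_def Ck_on_mult)

lemma smooth_on_scaleR: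
  "open S \<Longrightarrow> smooth_on S f \<Longrightarrow> smooth_on S g \<Longrightarrow> smooth_on S (\<lambda>p. f p *\<^sub>R g p)"
  by (simp add: smooth_on_def Ck_on_scaleR)

lemma smooth_on_prod:
  fixes f :: "'i \<Rightarrow> 'a::real_normed_vector \<Rightarrow> real"
  shows "open S \<Longrightarrow> (\<And>i. i \<in> I \<Longrightarrow> smooth_on S (f i)) \<Longrightarrow> smooth_on S (\<lambda>p. \<Prod>i\<in>I. f i p)"
  by (simp add: smooth_on_def Ck_on_prod)

lemma smooth_on_compose:
  fixes f :: "'b::euclidean_space \<Rightarrow> 'c::real_normed_vector" and g :: "'a::real_normed_vector \<Rightarrow> 'b"
  shows "open S \<Longrightarrow> smooth_on S g \<Longrightarrow> g ` S \<subseteq> T \<Longrightarrow> smooth_on T f \<Longrightarrow> smooth_on S (\<lambda>p. f (g p))"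
  unfolding smooth_on_def using Ck_on_compose by blast

lemma smooth_on_exp:
  fixes f :: "'a::real_normed_vector \<Rightarrow> real"
  shows "open S \<Longrightarrow> smooth_on S f \<Longrightarrow> smooth_on S (\<lambda>p. exp (f p))"
  using smooth_on_compose[of S f UNIV exp] by (simp add: smooth_on_def Ck_on_exp)

lemma smooth_on_divide:
  fixes f g :: "'a::real_normed_vector \<Rightarrow> real"
  assumes "open S" "smooth_on S f" "smooth_on S g" "\<And>p. p \<in> S \<Longrightarrow> g p \<noteq> 0"
  shows "smooth_on S (\<lambda>p. f p / g p)"
proof -
  have "smooth_on S (\<lambda>p. inverse (g p))"
  proof (rule smooth_on_compose[OF assms(1,3)])
    show "g ` S \<subseteq> - {0}" using assms(4) by auto
    show "smooth_on (- {0}) (inverse :: real \<Rightarrow> real)" by (simp add: smooth_on_def Ck_on_inverse)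
  qed
  then show ?thesis using assms by (simp add: divide_inverse smooth_on_mult)
qed

lemma smooth_on_vec_nth:
  fixes f :: "'a::real_normed_vector \<Rightarrow> real^'n::finite"
  shows "open S \<Longrightarrow> smooth_on S f \<Longrightarrow> smooth_on S (\<lambda>p. f p $ i)"
  using smooth_on_bounded_linear[OF _ bounded_linear_vec_nth] .

lemma smooth_on_vec:
  fixes f :: "'a::real_normed_vector \<Rightarrow> real^'n::finite"
  assumes "open S" "\<And>i. smooth_on S (\<lambda>p. f p $ i)"
  shows "smooth_on S f"
proof (rule smooth_on_cong[OF assms(1)])
  show "(\<Sum>i\<in>UNIV. f p $ i *\<^sub>R axis i 1) = f p" for p
    using basis_expansion[of "f p"] by (simp add: scalar_mult_eq_scaleR)
  show "smooth_on S (\<lambda>p. \<Sum>i\<in>UNIV. f p $ i *\<^sub>R axis i (1::real))"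
    by (intro smooth_on_sum smooth_on_scaleR smooth_on_const assms)
qed

lemma smooth_on_det:
  fixes M :: "'a::real_normed_vector \<Rightarrow> real^'n::finite^'n"
  assumes "open S" "\<And>i j. smooth_on S (\<lambda>p. M p $ i $ j)"
  shows "smooth_on S (\<lambda>p. det (M p))"
  unfolding det_def by (intro smooth_on_sum smooth_on_mult smooth_on_prod smooth_on_const assms)

section \<open>Linear systems and fields of linear maps in coordinates\<close>

lemma linear_axis_expansion:
  fixes f :: "real^'n::finite \<Rightarrow> 'b::real_vector"
  assumes "linear f"
  shows "f x = (\<Sum>j\<in>UNIV. x $ j *\<^sub>R f (axis j 1))"
proof -
  have "f (\<Sum>j\<in>UNIV. x $ j *\<^sub>R axis j 1) = (\<Sum>j\<in>UNIV. x $ j *\<^sub>R f (axis j 1))"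
    using linear_sum[OF assms, of "\<lambda>j. x $ j *\<^sub>R axis j 1" UNIV] linear_scale[OF assms] by simp
  then show ?thesis using basis_expansion[of x] by (simp add: scalar_mult_eq_scaleR)
qed

text \<open>By Cramer's rule the solution depends smoothly on the data.\<close>

lemma smooth_on_solve:
  fixes b :: "'a::real_normed_vector \<Rightarrow> real^'n::finite \<Rightarrow> real^'n \<Rightarrow> real"
  assumes "open S"
    and lin: "\<And>p y. p \<in> S \<Longrightarrow> linear (\<lambda>x. b p x y)"
    and nondeg: "\<And>p x. p \<in> S \<Longrightarrow> (\<And>y. b p x y = 0) \<Longrightarrow> x = 0"
    and lin2: "\<And>p x. p \<in> S \<Longrightarrow> linear (b p x)"
    and b: "\<And>x y. smooth_on S (\<lambda>p. b p x y)"
    and a: "\<And>y. smooth_on S (\<lambda>p. a p y)"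
    and u: "\<And>p y. p \<in> S \<Longrightarrow> b p (u p) y = a p y"
  shows "smooth_on S u"
proof (rule smooth_on_vec[OF assms(1)])
  fix k
  define M :: "'a \<Rightarrow> real^'n^'n" where "M p = (\<chi> i j. b p (axis j 1) (axis i 1))" for p
  define c :: "'a \<Rightarrow> real^'n" where "c p = (\<chi> i. a p (axis i 1))" for p
  have Mv: "(M p *v x) $ i = b p x (axis i 1)" if "p \<in> S" for p x i
  proof -
    have "b p x (axis i 1) = (\<Sum>j\<in>UNIV. x $ j *\<^sub>R b p (axis j 1) (axis i 1))"
      by (rule linear_axis_expansion[OF lin[OF that]])
    then show ?thesis by (simp add: M_def matrix_vector_mult_def mult.commute)
  qed
  have det: "det (M p) \<noteq> 0" if "p \<in> S" for p
  proof -
    have "x = 0" if "M p *v x = 0" for x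
    proof (rule nondeg[OF \<open>p \<in> S\<close>])
      fix y
      have "b p x y = (\<Sum>i\<in>UNIV. y $ i *\<^sub>R b p x (axis i 1))"
        by (rule linear_axis_expansion[OF lin2[OF \<open>p \<in> S\<close>]])
      also have "\<dots> = 0"
        using that Mv[OF \<open>p \<in> S\<close>, of x] by (intro sum.neutral) (simp add: vec_eq_iff)
      finally show "b p x y = 0" .
    qed
    then have "inj ((*v) (M p))"
      using linear_injective_0[OF matrix_vector_mul_linear[of "M p"]] by auto
    then have "det (matrix ((*v) (M p))) \<noteq> 0"
      using det_nz_iff_inj[OF matrix_vector_mul_linear[of "M p"]] by blast
    then show ?thesis by simp
  qed
  have "M p *v u p = c p" if "p \<in> S" for p
    using that by (simp add: vec_eq_iff Mv u c_def)
  then have eq: "det (\<chi> i j. if j = k then c p $ i else M p $ i $ j) / det (M p) = u p $ k" if "p \<in> S" for p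
    using cramer[OF det[OF that], of "u p" "c p"] that by simp
  have "smooth_on S (\<lambda>p. det (\<chi> i j. if j = k then c p $ i else M p $ i $ j) / det (M p))"
  proof (intro smooth_on_divide smooth_on_det assms(1) det)
    show M: "smooth_on S (\<lambda>p. M p $ i $ j)" for i j
      using b by (simp add: M_def)
    have "smooth_on S (\<lambda>p. c p $ i)" for i
      using a by (simp add: c_def)
    then show "smooth_on S (\<lambda>p. (\<chi> i j. if j = k then c p $ i else M p $ i $ j) $ i $ j)" for i j
      using M by (cases "j = k") simp_all
  qed
  then show "smooth_on S (\<lambda>p. u p $ k)"
    using smooth_on_cong[OF assms(1), where g = "\<lambda>p. u p $ k", OF eq] by simp
qed

text \<open>The product rule, where T is known to be differentiable on each fixed vector rather than
  as a map into a space of operators. In finite dimension the expansion along the axes makes up for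
  this.\<close>

lemma has_derivative_lin_field:
  fixes T :: "'a::real_normed_vector \<Rightarrow> real^'n::finite \<Rightarrow> 'b::real_normed_vector"
  assumes S: "open S" "p \<in> S" and lin: "\<And>q. q \<in> S \<Longrightarrow> linear (T q)"
    and T: "\<And>u. ((\<lambda>q. T q u) has_derivative T' u) (at p)"
    and U: "(U has_derivative U') (at p)"
  shows "((\<lambda>q. T q (U q)) has_derivative (\<lambda>x. T' (U p) x + T p (U' x))) (at p)"
proof -
  have ex: "T q u = (\<Sum>j\<in>UNIV. u $ j *\<^sub>R T q (axis j 1))" if "q \<in> S" for q u
    by (rule linear_axis_expansion[OF lin[OF that]])
  have "((\<lambda>q. \<Sum>j\<in>UNIV. U q $ j *\<^sub>R T q (axis j 1)) has_derivative
      (\<lambda>x. \<Sum>j\<in>UNIV. U p $ j *\<^sub>R T' (axis j 1) x + U' x $ j *\<^sub>R T p (axis j 1))) (at p)"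
    by (intro has_derivative_sum has_derivative_scaleR T bounded_linear.has_derivative[OF bounded_linear_vec_nth U])
  \<comment> \<open>Linearity of \<open>T'\<close> in the vector is obtained from uniqueness of
    derivatives: the same expansion is differentiated with the vector frozen at
    \<open>U p\<close>.\<close>
  moreover have "(\<Sum>j\<in>UNIV. U p $ j *\<^sub>R T' (axis j 1) x) = T' (U p) x" for x
  proof -
    have "((\<lambda>q. \<Sum>j\<in>UNIV. U p $ j *\<^sub>R T q (axis j 1)) has_derivative
        (\<lambda>x. \<Sum>j\<in>UNIV. U p $ j *\<^sub>R T' (axis j 1) x)) (at p)"
      by (intro has_derivative_sum has_derivative_scaleR_right T)
    then have "((\<lambda>q. T q (U p)) has_derivative (\<lambda>x. \<Sum>j\<in>UNIV. U p $ j *\<^sub>R T' (axis j 1) x)) (at p)"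
      by (rule has_derivative_transform_within_open[OF _ S]) (simp add: ex)
    then show ?thesis using has_derivative_unique[OF T] by metis
  qed
  ultimately have "((\<lambda>q. \<Sum>j\<in>UNIV. U q $ j *\<^sub>R T q (axis j 1)) has_derivative
      (\<lambda>x. T' (U p) x + T p (U' x))) (at p)"
    by (simp add: sum.distrib ex[OF S(2), of "U' _"])
  then show ?thesis
    by (rule has_derivative_transform_within_open[OF _ S]) (simp add: ex)
qed

lemma smooth_on_lin_field:
  fixes T :: "'a::real_normed_vector \<Rightarrow> real^'n::finite \<Rightarrow> 'b::real_normed_vector"
  assumes S: "open S" and lin: "\<And>q. q \<in> S \<Longrightarrow> linear (T q)"
    and T: "\<And>u. smooth_on S (\<lambda>q. T q u)" and U: "smooth_on S U"
  shows "smooth_on S (\<lambda>q. T q (U q))"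
proof (rule smooth_on_cong[OF S])
  show "(\<Sum>j\<in>UNIV. U q $ j *\<^sub>R T q (axis j 1)) = T q (U q)" if "q \<in> S" for q
    by (rule linear_axis_expansion[OF lin[OF that], symmetric])
  show "smooth_on S (\<lambda>q. \<Sum>j\<in>UNIV. U q $ j *\<^sub>R T q (axis j 1))"
    by (intro smooth_on_sum smooth_on_scaleR smooth_on_vec_nth S T U)
qed

lemma linear_fd_lin_field:
  fixes T :: "'a::real_normed_vector \<Rightarrow> real^'n::finite \<Rightarrow> 'b::real_normed_vector"
  assumes S: "open S" "p \<in> S" and lin: "\<And>q. q \<in> S \<Longrightarrow> linear (T q)"
    and T: "\<And>u. (\<lambda>q. T q u) differentiable (at p)"
  shows "linear (\<lambda>u. fd (\<lambda>q. T q u) p x)"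
proof (rule linearI)
  fix u v and r :: real
  have "((\<lambda>q. T q u + T q v) has_derivative (\<lambda>x. fd (\<lambda>q. T q u) p x + fd (\<lambda>q. T q v) p x)) (at p)"
    by (intro has_derivative_add fd_works T)
  then have "((\<lambda>q. T q (u + v)) has_derivative (\<lambda>x. fd (\<lambda>q. T q u) p x + fd (\<lambda>q. T q v) p x)) (at p)"
    by (rule has_derivative_transform_within_open[OF _ S]) (simp add: linear_add[OF lin])
  then show "fd (\<lambda>q. T q (u + v)) p x = fd (\<lambda>q. T q u) p x + fd (\<lambda>q. T q v) p x"
    by (simp add: fd_eq)
  have "((\<lambda>q. r *\<^sub>R T q u) has_derivative (\<lambda>x. r *\<^sub>R fd (\<lambda>q. T q u) p x)) (at p)"
    by (intro has_derivative_scaleR_right fd_works T)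
  then have "((\<lambda>q. T q (r *\<^sub>R u)) has_derivative (\<lambda>x. r *\<^sub>R fd (\<lambda>q. T q u) p x)) (at p)"
    by (rule has_derivative_transform_within_open[OF _ S]) (simp add: linear_scale[OF lin])
  then show "fd (\<lambda>q. T q (r *\<^sub>R u)) p x = r *\<^sub>R fd (\<lambda>q. T q u) p x"
    by (simp add: fd_eq)
qed

subsection \<open>Symmetry of second derivatives\<close>

lemma has_real_derivative_line:
  fixes f :: "'a::real_normed_vector \<Rightarrow> real"
  assumes "(f has_derivative f') (at (a + t *\<^sub>R x))"
  shows "((\<lambda>t. f (a + t *\<^sub>R x)) has_real_derivative f' x) (at t)"
proof -
  have "((\<lambda>t. a + t *\<^sub>R x) has_derivative (\<lambda>s. s *\<^sub>R x)) (at t)"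
    by (auto intro!: derivative_eq_intros)
  from has_derivative_compose[OF this assms]
  have "((\<lambda>t. f (a + t *\<^sub>R x)) has_derivative (\<lambda>s. s * f' x)) (at t)"
    by (simp add: linear_scale[OF has_derivative_linear[OF assms]])
  then show ?thesis unfolding has_field_derivative_def
    by (rule has_derivative_eq_rhs) (simp add: fun_eq_iff)
qed

text \<open>The mean value theorem is used twice: in t for the difference of f along two parallel
  segments in direction x, then in r for the derivative along y. The second difference on the left
  is symmetric in x and y, the order of derivatives on the right is not; this contrast is the
  purpose of the lemma.\<close>

lemma second_difference_mvt:
  fixes f :: "'a::real_normed_vector \<Rightarrow> real"
  assumes f: "smooth_on S f" and B: "ball p e \<subseteq> S" and s: "s > 0" "s * (norm x + norm y) < e"
  shows "\<exists>a\<in>ball p e. norm (a - p) \<le> s * (norm x + norm y) \<and>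
    f (p + s *\<^sub>R x + s *\<^sub>R y) - f (p + s *\<^sub>R x) - f (p + s *\<^sub>R y) + f p
      = s\<^sup>2 * fd (\<lambda>q. fd f q x) a y"
proof -
  have near: "norm (t *\<^sub>R x + r *\<^sub>R y) \<le> s * (norm x + norm y)" if "0 \<le> t" "t \<le> s" "0 \<le> r" "r \<le> s" for t r
  proof -
    have "norm (t *\<^sub>R x + r *\<^sub>R y) \<le> t * norm x + r * norm y"
      using norm_triangle_ineq[of "t *\<^sub>R x" "r *\<^sub>R y"] that by simp
    also have "\<dots> \<le> s * norm x + s * norm y"
      using that by (intro add_mono mult_right_mono) auto
    finally show ?thesis by (simp add: algebra_simps)
  qed
  have inS: "p + t *\<^sub>R x + r *\<^sub>R y \<in> ball p e" if "0 \<le> t" "t \<le> s" "0 \<le> r" "r \<le> s" for t r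
  proof -
    have "p - (p + t *\<^sub>R x + r *\<^sub>R y) = - (t *\<^sub>R x + r *\<^sub>R y)" by simp
    then have "dist p (p + t *\<^sub>R x + r *\<^sub>R y) = norm (t *\<^sub>R x + r *\<^sub>R y)"
      using norm_minus_cancel[of "t *\<^sub>R x + r *\<^sub>R y"] unfolding dist_norm by presburger
    then show ?thesis using near[OF that] s(2) by simp
  qed
  define g where "g t = f ((p + s *\<^sub>R y) + t *\<^sub>R x) - f (p + t *\<^sub>R x)" for t
  have "(g has_real_derivative (fd f (p + t *\<^sub>R x + s *\<^sub>R y) x - fd f (p + t *\<^sub>R x) x)) (at t)"
    if "0 \<le> t" "t \<le> s" for t
  proof -
    have eq: "p + t *\<^sub>R x + s *\<^sub>R y = p + s *\<^sub>R y + t *\<^sub>R x" by simp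
    have "p + s *\<^sub>R y + t *\<^sub>R x \<in> S" "p + t *\<^sub>R x \<in> S"
      using inS[of t s] inS[of t 0] that s B by (auto simp: eq)
    then show ?thesis
      unfolding g_def eq
      by (intro DERIV_diff has_real_derivative_line fd_works smooth_on_differentiable[OF f])
  qed
  then obtain t where t: "0 < t" "t < s"
    "g s - g 0 = s * (fd f (p + t *\<^sub>R x + s *\<^sub>R y) x - fd f (p + t *\<^sub>R x) x)"
    using MVT2[OF s(1), of g "\<lambda>t. fd f (p + t *\<^sub>R x + s *\<^sub>R y) x - fd f (p + t *\<^sub>R x) x"] by auto
  define k where "k r = fd f (p + t *\<^sub>R x + r *\<^sub>R y) x" for r
  have "(k has_real_derivative fd (\<lambda>q. fd f q x) (p + t *\<^sub>R x + r *\<^sub>R y) y) (at r)"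
    if "0 \<le> r" "r \<le> s" for r
    unfolding k_def
    by (rule has_real_derivative_line, rule fd_works, rule smooth_on_differentiable[OF smooth_on_fd[OF f]])
       (use inS[of t r] that t B in auto)
  then obtain r where r: "0 < r" "r < s"
    "k s - k 0 = s * fd (\<lambda>q. fd f q x) (p + t *\<^sub>R x + r *\<^sub>R y) y"
    using MVT2[OF s(1), of k "\<lambda>r. fd (\<lambda>q. fd f q x) (p + t *\<^sub>R x + r *\<^sub>R y) y"] by auto
  show ?thesis
  proof (intro bexI conjI)
    show "f (p + s *\<^sub>R x + s *\<^sub>R y) - f (p + s *\<^sub>R x) - f (p + s *\<^sub>R y) + f p
      = s\<^sup>2 * fd (\<lambda>q. fd f q x) (p + t *\<^sub>R x + r *\<^sub>R y) y"
      using t(3) r(3) by (simp add: g_def k_def power2_eq_square algebra_simps)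
    show "norm (p + t *\<^sub>R x + r *\<^sub>R y - p) \<le> s * (norm x + norm y)"
      using near[of t r] t r by simp
    show "p + t *\<^sub>R x + r *\<^sub>R y \<in> ball p e"
      using inS[of t r] t r by simp
  qed
qed

text \<open>The two mixed derivatives take a common value at two points close to p, while continuity
  keeps each within half of their supposed distance from its value at p.\<close>

lemma fd_fd_commute_real:
  fixes f :: "'a::real_normed_vector \<Rightarrow> real"
  assumes f: "smooth_on S f" and S: "open S" "p \<in> S"
  shows "fd (\<lambda>q. fd f q x) p y = fd (\<lambda>q. fd f q y) p x"
proof (rule ccontr)
  define F where "F x y q = fd (\<lambda>q. fd f q x) q y" for x y q
  assume "fd (\<lambda>q. fd f q x) p y \<noteq> fd (\<lambda>q. fd f q y) p x"
  then have pos: "dist (F x y p) (F y x p) > 0" (is "?d > 0") by (simp add: F_def)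
  have "isCont (F x y) p" for x y
    using smooth_on_imp_continuous_on[OF smooth_on_fd[OF smooth_on_fd[OF f]]] S
    unfolding F_def by (simp add: continuous_on_eq_continuous_at)
  then have "\<exists>e>0. \<forall>q. dist q p < e \<longrightarrow> dist (F x y q) (F x y p) < ?d / 2" for x y
    using pos unfolding continuous_at_eps_delta by (meson half_gt_zero)
  then obtain e1 e2 where e: "e1 > 0" "\<And>q. dist q p < e1 \<Longrightarrow> dist (F x y q) (F x y p) < ?d / 2"
    "e2 > 0" "\<And>q. dist q p < e2 \<Longrightarrow> dist (F y x q) (F y x p) < ?d / 2"
    by metis
  obtain e3 where e3: "e3 > 0" "ball p e3 \<subseteq> S" using S openE by blast
  define e where "e = min e1 (min e2 e3)"
  have e0: "e > 0" "ball p e \<subseteq> S" using e e3 by (auto simp: e_def)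
  \<comment> \<open>The summand 1 keeps the denominator positive when x and y are both 0.\<close>
  define s where "s = e / (2 * (norm x + norm y + 1))"
  have den: "norm x + norm y + 1 > 0" by (smt (verit) norm_ge_zero)
  then have s: "s > 0" "s * (norm x + norm y) < e" "s * (norm y + norm x) < e"
    using e0(1) by (auto simp: s_def field_simps add_pos_nonneg add_nonneg_pos intro!: add_less_le_mono)
  obtain a where a: "a \<in> ball p e" "f (p + s *\<^sub>R x + s *\<^sub>R y) - f (p + s *\<^sub>R x) - f (p + s *\<^sub>R y) + f p = s\<^sup>2 * F x y a"
    using second_difference_mvt[OF f e0(2) s(1,2)] unfolding F_def by auto
  obtain b where b: "b \<in> ball p e" "f (p + s *\<^sub>R y + s *\<^sub>R x) - f (p + s *\<^sub>R y) - f (p + s *\<^sub>R x) + f p = s\<^sup>2 * F y x b"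
    using second_difference_mvt[OF f e0(2) s(1,3)] unfolding F_def by auto
  have "s\<^sup>2 * F x y a = s\<^sup>2 * F y x b"
    unfolding a(2)[symmetric] b(2)[symmetric] by (simp add: add.commute add.left_commute)
  then have "F x y a = F y x b" using s(1) by simp
  moreover have "dist (F x y a) (F x y p) < ?d / 2"
    using a(1) by (intro e) (simp add: e_def dist_commute)
  moreover have "dist (F y x b) (F y x p) < ?d / 2"
    using b(1) by (intro e) (simp add: e_def dist_commute)
  ultimately show False using dist_triangle_half_r[of "F x y a" "F x y p" ?d "F y x p"] by simp
qed

lemma fd_fd_commute:
  fixes f :: "'a::real_normed_vector \<Rightarrow> real^'m::finite"
  assumes f: "smooth_on S f" and S: "open S" "p \<in> S"
  shows "fd (\<lambda>q. fd f q x) p y = fd (\<lambda>q. fd f q y) p x"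
proof -
  have nth: "fd (\<lambda>q. g q $ i) q x = fd g q x $ i" if "smooth_on S g" "q \<in> S" for g q x and i :: 'm
    using fd_eq[OF bounded_linear.has_derivative[OF bounded_linear_vec_nth fd_works[OF smooth_on_differentiable[OF that]]]]
    by simp
  have "fd (\<lambda>q. fd f q x) p y $ i = fd (\<lambda>q. fd (\<lambda>q. f q $ i) q x) p y" for i x y
    unfolding nth[OF smooth_on_fd[OF f] S(2), symmetric]
    using fd_cong[OF S, of "\<lambda>q. fd f q x $ i" "\<lambda>q. fd (\<lambda>q. f q $ i) q x"] nth[OF f] by simp
  then show ?thesis
    using fd_fd_commute_real[OF smooth_on_vec_nth[OF S(1) f] S] by (simp add: vec_eq_iff)
qed

section \<open>Linear algebra of an inner product\<close>

definition inner_form :: "'n::finite bform \<Rightarrow> bool" where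
  "inner_form b \<longleftrightarrow> bilinear b \<and> (\<forall>x y. b x y = b y x) \<and> (\<forall>x. x \<noteq> 0 \<longrightarrow> b x x > 0)"

lemma bilinear_sum_left: "bilinear b \<Longrightarrow> b (\<Sum>i\<in>I. f i) y = (\<Sum>i\<in>I. b (f i) y)"
  unfolding bilinear_def using linear_sum by blast

context
  fixes b :: "'n::finite bform"
  assumes b: "inner_form b"
begin

lemma inner_form_bilinear: "bilinear b"
  and inner_form_sym: "b x y = b y x"
  and inner_form_pos: "x \<noteq> 0 \<Longrightarrow> b x x > 0"
  using b by (auto simp: inner_form_def)

lemmas inner_form_simps =
  bilinear_ladd[OF inner_form_bilinear] bilinear_radd[OF inner_form_bilinear]
  bilinear_lsub[OF inner_form_bilinear] bilinear_rsub[OF inner_form_bilinear]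
  bilinear_lmul[OF inner_form_bilinear] bilinear_rmul[OF inner_form_bilinear]
  bilinear_lneg[OF inner_form_bilinear] bilinear_rneg[OF inner_form_bilinear]
  bilinear_lzero[OF inner_form_bilinear] bilinear_rzero[OF inner_form_bilinear]

lemma inner_form_nondeg: "(\<And>y. b x y = 0) \<Longrightarrow> x = 0"
  using inner_form_pos by force

lemma inner_form_eqI: "(\<And>y. b x y = b x' y) \<Longrightarrow> x = x'"
  using inner_form_nondeg[of "x - x'"] by (simp add: inner_form_simps)

section \<open>Orthonormal bases\<close>

lemma orthonormal_independent:
  assumes "finite E" "\<And>u v. u \<in> E \<Longrightarrow> v \<in> E \<Longrightarrow> b u v = (if u = v then 1 else 0)"
  shows "independent E"
  unfolding dependent_finite[OF assms(1)]
proof (clarify)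
  fix u v assume v: "v \<in> E" "u v \<noteq> 0" and 0: "(\<Sum>v\<in>E. u v *\<^sub>R v) = 0"
  have "0 = b (\<Sum>v\<in>E. u v *\<^sub>R v) v" by (simp add: 0 inner_form_simps)
  also have "\<dots> = (\<Sum>w\<in>E. if w = v then u v else 0)"
    unfolding bilinear_sum_left[OF inner_form_bilinear]
    by (rule sum.cong) (auto simp: inner_form_simps assms(2) v)
  finally show False using v assms(1) by simp
qed

text \<open>Gram-Schmidt: fewer than n vectors do not span, and the part of an outside vector
  orthogonal to them is normalized and added.\<close>

lemma ex_orthonormal_set:
  "k \<le> CARD('n) \<Longrightarrow> \<exists>E. finite E \<and> card E = k \<and> (\<forall>u\<in>E. \<forall>v\<in>E. b u v = (if u = v then 1 else 0))"
proof (induction k)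
  case 0
  show ?case by (intro exI[of _ "{}"]) auto
next
  case (Suc k)
  then obtain E where E: "finite E" "card E = k" "\<And>u v. u \<in> E \<Longrightarrow> v \<in> E \<Longrightarrow> b u v = (if u = v then 1 else 0)"
    by auto
  have "span E \<noteq> UNIV"
  proof
    assume "span E = UNIV"
    then have "dim E = CARD('n)" using dim_span[of E] dim_UNIV[where 'a="real^'n"] by simp
    then show False using dim_le_card'[OF E(1)] E(2) Suc.prems by simp
  qed
  then obtain x where x: "x \<notin> span E" by blast
  define w where "w = x - (\<Sum>u\<in>E. b x u *\<^sub>R u)"
  have wE: "w \<notin> span E"
  proof
    assume "w \<in> span E"
    moreover have "(\<Sum>u\<in>E. b x u *\<^sub>R u) \<in> span E"
      by (intro span_sum span_scale span_base)
    ultimately have "w + (\<Sum>u\<in>E. b x u *\<^sub>R u) \<in> span E" by (rule span_add)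
    then show False using x by (simp add: w_def)
  qed
  then have pos: "b w w > 0" using inner_form_pos span_zero by metis
  have wv: "b w v = 0" if "v \<in> E" for v
  proof -
    have "(\<Sum>u\<in>E. b (b x u *\<^sub>R u) v) = (\<Sum>u\<in>E. if u = v then b x v else 0)"
      by (rule sum.cong) (auto simp: inner_form_simps E(3) that)
    then show ?thesis
      using that E(1) by (simp add: w_def inner_form_simps bilinear_sum_left[OF inner_form_bilinear])
  qed
  define w' where "w' = (1 / sqrt (b w w)) *\<^sub>R w"
  have "b w' w' = 1"
    using pos by (simp add: w'_def inner_form_simps)
  moreover have wv': "b w' v = 0" if "v \<in> E" for v
    using wv[OF that] by (simp add: w'_def inner_form_simps)
  moreover have "b v w' = 0" if "v \<in> E" for v
    using wv'[OF that] inner_form_sym[of v w'] by simp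
  ultimately have w': "b w' w' = 1" "\<And>v. v \<in> E \<Longrightarrow> b w' v = 0" "\<And>v. v \<in> E \<Longrightarrow> b v w' = 0"
    by auto
  have "w' \<notin> E" using w'(1,2) by force
  then show ?case
    using E w' by (intro exI[of _ "insert w' E"]) auto
qed

lemma ex_orthonormal_basis: "\<exists>e. orthonormal_basis b e"
proof -
  obtain E where E: "finite E" "card E = CARD('n)" "\<And>u v. u \<in> E \<Longrightarrow> v \<in> E \<Longrightarrow> b u v = (if u = v then 1 else 0)"
    using ex_orthonormal_set[of "CARD('n)"] by auto
  then obtain e where e: "bij_betw e (UNIV :: 'n set) E"
    using finite_same_card_bij[of "UNIV :: 'n set" E] by auto
  have "e i \<in> E" "e i = e j \<longleftrightarrow> i = j" for i j
    using e by (auto simp: bij_betw_def inj_on_def)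
  then show ?thesis using E(3) by (intro exI[of _ e]) (simp add: orthonormal_basis_def)
qed

lemma onb: "orthonormal_basis b (onb b)"
  unfolding onb_def using ex_orthonormal_basis by (rule someI_ex)

lemma orthonormal_expansion:
  assumes e: "orthonormal_basis b e"
  shows "(\<Sum>i\<in>UNIV. b (e i) x *\<^sub>R e i) = x"
proof -
  have bee: "b (e i) (e j) = (if i = j then 1 else 0)" for i j
    using e by (simp add: orthonormal_basis_def)
  have inj: "inj e" by (rule injI) (metis bee zero_neq_one)
  have "independent (range e)"
    by (rule orthonormal_independent) (auto simp: bee inj_eq[OF inj])
  then have span: "span (range e) = UNIV"
    using card_ge_dim_independent[of "range e" UNIV] card_image[OF inj] by (auto simp: dim_UNIV)
  define w where "w = x - (\<Sum>i\<in>UNIV. b (e i) x *\<^sub>R e i)"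
  have we: "b w (e j) = 0" for j
  proof -
    have "(\<Sum>i\<in>UNIV. b (b (e i) x *\<^sub>R e i) (e j)) = (\<Sum>i\<in>UNIV. if i = j then b (e j) x else 0)"
      by (rule sum.cong) (auto simp: inner_form_simps bee)
    then show ?thesis
      by (simp add: w_def inner_form_simps bilinear_sum_left[OF inner_form_bilinear] inner_form_sym[of x])
  qed
  have "b w y = 0" for y
  proof -
    have "linear (b w)" using inner_form_bilinear by (simp add: bilinear_def)
    moreover have "y \<in> span (range e)" by (simp add: span)
    ultimately show ?thesis using we linear_eq_0_on_span[of "b w" "range e" y] by blast
  qed
  then have "w = 0" by (rule inner_form_nondeg)
  then show ?thesis by (simp add: w_def)
qed

lemma orthonormal_contract:
  assumes e: "orthonormal_basis b e" and "linear f"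
  shows "(\<Sum>i\<in>UNIV. b (e i) x *\<^sub>R f (e i)) = f x"
  using linear_sum[OF assms(2), of "\<lambda>i. b (e i) x *\<^sub>R e i" UNIV]
  by (simp add: orthonormal_expansion[OF e] linear_scale[OF assms(2)])

section \<open>Musical isomorphism and traces\<close>

lemma sharp:
  assumes "linear \<alpha>"
  shows "b (sharp b \<alpha>) y = \<alpha> y"
proof -
  let ?v = "\<Sum>i\<in>UNIV. \<alpha> (onb b i) *\<^sub>R onb b i"
  have v: "b ?v y = \<alpha> y" for y
    using orthonormal_contract[OF onb assms, of y]
    by (simp add: bilinear_sum_left[OF inner_form_bilinear] inner_form_simps mult.commute)
  have "sharp b \<alpha> = ?v"
    unfolding sharp_def
  proof (rule the_equality)
    fix v assume "\<forall>y. b v y = \<alpha> y"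
    then show "v = ?v" using v by (intro inner_form_eqI) simp
  qed (simp add: v)
  then show ?thesis by (simp add: v)
qed

lemma sharp_unique: "(\<And>y. b v y = \<alpha> y) \<Longrightarrow> sharp b \<alpha> = v"
  unfolding sharp_def by (rule the_equality) (auto intro: inner_form_eqI)

text \<open>The right side is contraction with the inverse metric in the coordinate basis,
  \<open>sharp b (\<lambda>y. y $ j)\<close> being the gradient of the j-th coordinate. It does not
  mention e; this gives independence of the basis and also an expression that can be differentiated
  in the base point.\<close>

lemma sum_orthonormal_basis:
  assumes e: "orthonormal_basis b e" and T: "bilinear T"
  shows "(\<Sum>i\<in>UNIV. T (e i) (e i)) = (\<Sum>j\<in>UNIV. T (sharp b (\<lambda>y. y $ j)) (axis j 1))"
proof -
  have lin: "linear (T x)" "linear (\<lambda>x. T x y)" for x y using T by (auto simp: bilinear_def)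
  have "sharp b (\<lambda>y. y $ j) = (\<Sum>i\<in>UNIV. (e i $ j) *\<^sub>R e i)" for j
  proof (rule sharp_unique)
    have "linear (\<lambda>y::real^'n. y $ j)" for j by (rule bounded_linear.linear[OF bounded_linear_vec_nth])
    from orthonormal_contract[OF e this]
    show "b (\<Sum>i\<in>UNIV. (e i $ j) *\<^sub>R e i) y = y $ j" for y
      by (simp add: bilinear_sum_left[OF inner_form_bilinear] inner_form_simps mult.commute)
  qed
  then have "(\<Sum>j\<in>UNIV. T (sharp b (\<lambda>y. y $ j)) (axis j 1))
      = (\<Sum>j\<in>UNIV. \<Sum>i\<in>UNIV. (e i $ j) *\<^sub>R T (e i) (axis j 1))"
    by (simp add: linear_sum[OF lin(2)] linear_scale[OF lin(2)])
  also have "\<dots> = (\<Sum>i\<in>UNIV. T (e i) (e i))"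
    by (subst sum.swap) (simp add: linear_axis_expansion[OF lin(1), symmetric])
  finally show ?thesis by simp
qed

lemma trace2_onb:
  assumes "orthonormal_basis b e" "bilinear T"
  shows "trace2 b T = (\<Sum>i\<in>UNIV. T (e i) (e i))"
  unfolding trace2_def using sum_orthonormal_basis[OF onb assms(2)] sum_orthonormal_basis[OF assms] by simp

lemma trace2_sharp:
  assumes "bilinear T"
  shows "trace2 b T = (\<Sum>j\<in>UNIV. T (sharp b (\<lambda>y. y $ j)) (axis j 1))"
  unfolding trace2_def using sum_orthonormal_basis[OF onb assms] .

lemma trace2_self: "trace2 b b = real CARD('n)"
  using onb by (simp add: trace2_def orthonormal_basis_def)

lemma trace2_contract:
  assumes "linear f"
  shows "trace2 b (\<lambda>u v. b u x * f v) = f x" "trace2 b (\<lambda>u v. f u * b x v) = f x"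
  using orthonormal_contract[OF onb assms] by (simp_all add: trace2_def inner_form_sym[of x] mult.commute)

end

section \<open>Linearity of traces and the fibre metric of F\<close>

lemma trace2_add: "trace2 b (\<lambda>u v. S u v + T u v) = trace2 b S + trace2 b T"
  by (simp add: trace2_def sum.distrib)

lemma trace2_diff: "trace2 b (\<lambda>u v. S u v - T u v) = trace2 b S - trace2 b T"
  by (simp add: trace2_def sum_subtractf)

lemma trace2_cmult: "trace2 b (\<lambda>u v. c * T u v) = c * trace2 b T"
  by (simp add: trace2_def sum_distrib_left)

lemma trace2_multc: "trace2 b (\<lambda>u v. T u v * c) = trace2 b T * c"
  by (simp add: trace2_def sum_distrib_right)

lemma linear_sum_fun: "(\<And>i. i \<in> I \<Longrightarrow> linear (f i)) \<Longrightarrow> linear (\<lambda>x. \<Sum>i\<in>I. f i x)"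
  by (rule linear_compose_sum) auto

lemma linear_mult_right: "linear f \<Longrightarrow> linear (\<lambda>x. f x * (c::real))"
  by (rule linearI) (simp_all add: linear_add linear_scale distrib_right)

lemma linear_mult_left: "linear f \<Longrightarrow> linear (\<lambda>x. (c::real) * f x)"
  by (rule linearI) (simp_all add: linear_add linear_scale distrib_left)

lemma linear_trace2: "(\<And>u v. linear (\<lambda>x. T x u v)) \<Longrightarrow> linear (\<lambda>x. trace2 b (T x))"
  unfolding trace2_def by (rule linear_sum_fun)

lemma linear_inner_F_left: "(\<And>u v w. linear (\<lambda>x. A x u v w)) \<Longrightarrow> linear (\<lambda>x. inner_F b (A x) T)"
  unfolding inner_F_def by (intro linear_sum_fun linear_mult_right)

lemma inner_F_commute: "inner_F b A T = inner_F b T A"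
  by (simp add: inner_F_def mult.commute)

lemma linear_inner_F_right: "(\<And>u v w. linear (\<lambda>x. A x u v w)) \<Longrightarrow> linear (\<lambda>x. inner_F b T (A x))"
  using linear_inner_F_left[of A b T] by (simp add: inner_F_commute)

definition trilinear :: "'n::finite tform \<Rightarrow> bool" where
  "trilinear A \<longleftrightarrow> (\<forall>x y. linear (A x y)) \<and> (\<forall>x z. linear (\<lambda>y. A x y z)) \<and> (\<forall>y z. linear (\<lambda>x. A x y z))"

text \<open>As an iterated trace, the metric of F inherits smooth dependence from a single trace
  applied three times.\<close>

lemma inner_F_eq_trace2:
  "inner_F b A T = trace2 b (\<lambda>u u'. trace2 b (\<lambda>v v'. trace2 b (\<lambda>w w'. A u v w * T u' v' w')))"
  by (simp add: inner_F_def trace2_def)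

lemma linear_eq_0_on_orthonormal:
  assumes "inner_form b" "orthonormal_basis b e" "linear f" "\<And>i. f (e i) = 0"
  shows "f x = 0"
  using orthonormal_contract[OF assms(1-3), of x] assms(4) by simp

text \<open>A vanishing sum of squares kills all components in the orthonormal basis, and linearity
  extends this to arbitrary arguments one slot at a time.\<close>

lemma inner_F_self_eq_0:
  assumes b: "inner_form b" and A: "trilinear A" and 0: "inner_F b A A = 0"
  shows "A x y z = 0"
proof -
  let ?e = "onb b"
  note lin0 = linear_eq_0_on_orthonormal[OF b onb[OF b]]
  have 1: "A (?e i) (?e j) (?e k) = 0" for i j k
    using 0 by (simp add: inner_F_def sum_nonneg_eq_0_iff sum_nonneg)
  have 2: "A (?e i) (?e j) z = 0" for i j z
    by (rule lin0[of "A (?e i) (?e j)"]) (use A 1 in \<open>simp_all add: trilinear_def\<close>)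
  have 3: "A (?e i) y z = 0" for i y z
    by (rule lin0[of "\<lambda>y. A (?e i) y z"]) (use A 2 in \<open>simp_all add: trilinear_def\<close>)
  show ?thesis
    by (rule lin0[of "\<lambda>x. A x y z"]) (use A 3 in \<open>simp_all add: trilinear_def\<close>)
qed

section \<open>Smooth dependence of these constructions on the point\<close>

lemma smooth_on_sharp:
  assumes "open S" "\<And>p. p \<in> S \<Longrightarrow> inner_form (h p)" "\<And>x y. smooth_on S (\<lambda>p. h p x y)"
    and "\<And>p. p \<in> S \<Longrightarrow> linear (a p)" "\<And>y. smooth_on S (\<lambda>p. a p y)"
  shows "smooth_on S (\<lambda>p. sharp (h p) (a p))"
proof (rule smooth_on_solve[OF assms(1), where b = h and a = a])
  fix p x y assume p: "p \<in> S"
  show "linear (\<lambda>x. h p x y)" "linear (h p x)"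
    using inner_form_bilinear[OF assms(2)[OF p]] by (auto simp: bilinear_def)
  show "h p (sharp (h p) (a p)) y = a p y"
    by (rule sharp[OF assms(2,4)[OF p]])
next
  show "x = 0" if "p \<in> S" "\<And>y. h p x y = 0" for p x
    using inner_form_nondeg[OF assms(2)[OF that(1)]] that(2) by blast
qed (use assms in auto)

text \<open>\<open>onb\<close> is chosen separately at each point and may jump, so the trace is
  first rewritten with the inverse metric.\<close>

lemma smooth_on_trace2:
  fixes h :: "real^'n \<Rightarrow> 'n::finite bform"
  assumes S: "open S" and h: "\<And>p. p \<in> S \<Longrightarrow> inner_form (h p)" "\<And>x y. smooth_on S (\<lambda>p. h p x y)"
    and T: "\<And>p. p \<in> S \<Longrightarrow> bilinear (T p)" "\<And>x y. smooth_on S (\<lambda>p. T p x y)"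
  shows "smooth_on S (\<lambda>p. trace2 (h p) (T p))"
proof (rule smooth_on_cong[OF S])
  show "(\<Sum>j\<in>UNIV. T p (sharp (h p) (\<lambda>y. y $ j)) (axis j 1)) = trace2 (h p) (T p)" if "p \<in> S" for p
    by (simp add: trace2_sharp[OF h(1) T(1)] that)
  have "smooth_on S (\<lambda>p. sharp (h p) (\<lambda>y. y $ j))" for j
    by (rule smooth_on_sharp[OF S h])
       (auto intro: smooth_on_const bounded_linear.linear[OF bounded_linear_vec_nth])
  then have "smooth_on S (\<lambda>p. T p (sharp (h p) (\<lambda>y. y $ j)) (axis j 1))" for j
    using T(1) by (intro smooth_on_lin_field[where T = "\<lambda>p u. T p u (axis j 1)", OF S _ T(2)])
       (simp_all add: bilinear_def)
  then show "smooth_on S (\<lambda>p. \<Sum>j\<in>UNIV. T p (sharp (h p) (\<lambda>y. y $ j)) (axis j 1))"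
    by (rule smooth_on_sum[OF S])
qed

lemma smooth_on_inner_F:
  fixes h :: "real^'n \<Rightarrow> 'n::finite bform"
  assumes S: "open S" and h: "\<And>p. p \<in> S \<Longrightarrow> inner_form (h p)" "\<And>x y. smooth_on S (\<lambda>p. h p x y)"
    and A: "\<And>p. p \<in> S \<Longrightarrow> trilinear (A p)" "\<And>x y z. smooth_on S (\<lambda>p. A p x y z)"
    and T: "\<And>p. p \<in> S \<Longrightarrow> trilinear (T p)" "\<And>x y z. smooth_on S (\<lambda>p. T p x y z)"
  shows "smooth_on S (\<lambda>p. inner_F (h p) (A p) (T p))"
  unfolding inner_F_eq_trace2
proof -
  have 3: "linear (A p x y)" "linear (T p x y)" if "p \<in> S" for p x y
    using A(1) T(1) that by (auto simp: trilinear_def)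
  have 2: "linear (\<lambda>y. A p x y z)" "linear (\<lambda>y. T p x y z)" if "p \<in> S" for p x z
    using A(1) T(1) that by (auto simp: trilinear_def)
  have 1: "linear (\<lambda>x. A p x y z)" "linear (\<lambda>x. T p x y z)" if "p \<in> S" for p y z
    using A(1) T(1) that by (auto simp: trilinear_def)
  have s3: "smooth_on S (\<lambda>p. trace2 (h p) (\<lambda>w w'. A p u v w * T p u' v' w'))" for u v u' v'
    by (rule smooth_on_trace2[OF S h])
       (simp_all add: bilinear_def linear_mult_left linear_mult_right 3 smooth_on_mult[OF S] A T)
  have s2: "smooth_on S (\<lambda>p. trace2 (h p) (\<lambda>v v'. trace2 (h p) (\<lambda>w w'. A p u v w * T p u' v' w')))" for u u'
    by (rule smooth_on_trace2[OF S h])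
       (simp_all add: bilinear_def linear_trace2 linear_mult_left linear_mult_right 2 s3)
  show "smooth_on S (\<lambda>p. trace2 (h p) (\<lambda>u u'. trace2 (h p) (\<lambda>v v'. trace2 (h p) (\<lambda>w w'. A p u v w * T p u' v' w'))))"
    by (rule smooth_on_trace2[OF S h])
       (simp_all add: bilinear_def linear_trace2 linear_mult_left linear_mult_right 1 s2)
qed

section \<open>Riemannian geometry in a chart\<close>

lemma fd_const: "fd (\<lambda>_. c) p = (\<lambda>_. 0)"
  by (rule fd_eq) simp

lemma fd_add:
  "f differentiable (at p) \<Longrightarrow> g differentiable (at p) \<Longrightarrow> fd (\<lambda>q. f q + g q) p x = fd f p x + fd g p x"
  using fd_eq[OF has_derivative_add[OF fd_works fd_works]] by metis

lemma fd_diff: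
  "f differentiable (at p) \<Longrightarrow> g differentiable (at p) \<Longrightarrow> fd (\<lambda>q. f q - g q) p x = fd f p x - fd g p x"
  using fd_eq[OF has_derivative_diff[OF fd_works fd_works]] by metis

lemma fd_mult:
  fixes f g :: "'a::real_normed_vector \<Rightarrow> real"
  shows "f differentiable (at p) \<Longrightarrow> g differentiable (at p) \<Longrightarrow> fd (\<lambda>q. f q * g q) p x = f p * fd g p x + fd f p x * g p"
  using fd_eq[OF has_derivative_mult[OF fd_works fd_works]] by metis

lemma fd_lin_field:
  fixes T :: "'a::real_normed_vector \<Rightarrow> real^'n::finite \<Rightarrow> 'b::real_normed_vector"
  assumes S: "open S" "p \<in> S" and lin: "\<And>q. q \<in> S \<Longrightarrow> linear (T q)"
    and T: "\<And>u. smooth_on S (\<lambda>q. T q u)" and U: "U differentiable (at p)"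
  shows "fd (\<lambda>q. T q (U q)) p x = fd (\<lambda>q. T q (U p)) p x + T p (fd U p x)"
  by (subst fd_eq[OF has_derivative_lin_field[OF S lin fd_works[OF smooth_on_differentiable[OF T S(2)]] fd_works[OF U]]])
     auto

text \<open>S is an arbitrary open set instead of the image of a chart, so that results can be
  restricted to overlaps of charts.\<close>

locale riemannian_chart =
  fixes S :: "(real^'n::finite) set" and h :: "'n metric"
  assumes open_S: "open S"
    and inner: "p \<in> S \<Longrightarrow> inner_form (h p)"
    and smooth: "smooth_on S (\<lambda>p. h p x y)"
begin

abbreviation "\<Gamma> \<equiv> christoffel h"

section \<open>The Levi-Civita connection\<close>

lemma metric_linear:
  assumes "p \<in> S"
  shows "linear (h p x)" "linear (\<lambda>x. h p x y)"
  using inner_form_bilinear[OF inner[OF assms]] by (auto simp: bilinear_def)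

lemma metric_sym: "p \<in> S \<Longrightarrow> h p x y = h p y x"
  using inner_form_sym inner by blast

lemma fd_metric_linear:
  assumes "p \<in> S"
  shows "linear (\<lambda>x. fd (\<lambda>q. h q y z) p x)" "linear (\<lambda>y. fd (\<lambda>q. h q y z) p x)"
    "linear (\<lambda>z. fd (\<lambda>q. h q y z) p x)"
  using assms smooth_on_differentiable[OF smooth]
  by (auto intro!: linear_fd linear_fd_lin_field[OF open_S, of p "\<lambda>q y. h q y z"]
      linear_fd_lin_field[OF open_S, of p "\<lambda>q z. h q y z"] metric_linear)

lemma fd_metric_sym: "p \<in> S \<Longrightarrow> fd (\<lambda>q. h q y z) p x = fd (\<lambda>q. h q z y) p x"
  using fd_cong[OF open_S, of p "\<lambda>q. h q y z" "\<lambda>q. h q z y"] metric_sym by metis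

text \<open>The Koszul formula for coordinate fields, whose brackets vanish: the value that symmetry
  and compatibility with the metric force on \<open>h p (\<Gamma> p x y) z\<close>.\<close>

definition koszul where
  "koszul p x y z = (fd (\<lambda>q. h q y z) p x + fd (\<lambda>q. h q x z) p y - fd (\<lambda>q. h q x y) p z) / 2"

lemma koszul_linear:
  assumes "p \<in> S"
  shows "linear (\<lambda>x. koszul p x y z)" "linear (\<lambda>y. koszul p x y z)" "linear (koszul p x y)"
  unfolding koszul_def divide_real_def
  by (intro linear_mult_right linear_compose_add linear_compose_sub fd_metric_linear[OF assms])+

lemma koszul_unique:
  assumes p: "p \<in> S" and sym: "\<And>x y. G x y = G y x"
    and comp: "\<And>x y z. fd (\<lambda>q. h q y z) p x = h p (G x y) z + h p y (G x z)"
  shows "h p (G x y) z = koszul p x y z"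
  unfolding koszul_def comp
  using sym[of y x] sym[of z x] sym[of z y] metric_sym[OF p, of x] metric_sym[OF p, of "G x z" y] metric_sym[OF p, of "G y z" x] by simp

text \<open>Resolves the description in \<open>christoffel\<close>: nondegeneracy of the metric
  turns the Koszul formula into a vector \<open>N x y\<close> that meets the defining conditions,
  and the formula leaves no second solution. Uniqueness is exported as well, since it later yields
  the transformation law.\<close>

lemma
  assumes p: "p \<in> S"
  shows bilinear_christoffel: "bilinear (\<Gamma> p)"
    and christoffel_sym: "\<Gamma> p x y = \<Gamma> p y x"
    and christoffel_compat: "fd (\<lambda>q. h q y z) p x = h p (\<Gamma> p x y) z + h p y (\<Gamma> p x z)"
    and christoffel_koszul: "h p (\<Gamma> p x y) z = koszul p x y z"
    and christoffel_unique: "bilinear G \<Longrightarrow> (\<And>x y. G x y = G y x) \<Longrightarrow>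
       (\<And>x y z. fd (\<lambda>q. h q y z) p x = h p (G x y) z + h p y (G x z)) \<Longrightarrow> \<Gamma> p = G"
proof -
  define P where "P G \<longleftrightarrow> bilinear G \<and> (\<forall>x y. G x y = G y x) \<and>
     (\<forall>x y z. fd (\<lambda>q. h q y z) p x = h p (G x y) z + h p y (G x z))" for G
  define N where "N x y = sharp (h p) (koszul p x y)" for x y
  note ip = inner[OF p]
  have N: "h p (N x y) z = koszul p x y z" for x y z
    unfolding N_def by (rule sharp[OF ip koszul_linear(3)[OF p]])
  note simps = inner_form_simps[OF ip] N linear_add[OF koszul_linear(1)[OF p]] linear_add[OF koszul_linear(2)[OF p]]
     linear_scale[OF koszul_linear(1)[OF p]] linear_scale[OF koszul_linear(2)[OF p]]
  have "P N"
    unfolding P_def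
  proof (intro conjI allI)
    show "bilinear N"
      unfolding bilinear_def
      by (intro allI conjI linearI inner_form_eqI[OF ip]) (simp_all add: simps)
    show "N x y = N y x" for x y
      by (rule inner_form_eqI[OF ip])
        (simp add: N koszul_def fd_metric_sym[OF p, of x y] add.commute)
    show "fd (\<lambda>q. h q y z) p x = h p (N x y) z + h p y (N x z)" for x y z
      by (simp add: metric_sym[OF p, of y] N koszul_def fd_metric_sym[OF p, of z y] fd_metric_sym[OF p, of z x]
           fd_metric_sym[OF p, of y x] field_simps)
  qed
  have uni: "G = N" if "P G" for G
  proof (intro ext inner_form_eqI[OF ip])
    show "h p (G x y) z = h p (N x y) z" for x y z
      using that unfolding N P_def by (intro koszul_unique[OF p]) auto
  qed
  have "\<Gamma> p = (THE G. P G)"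
    by (simp add: christoffel_def P_def ddir_eq_fd)
  also have "\<dots> = N" by (rule the_equality[of P, OF \<open>P N\<close> uni])
  finally have eq: "\<Gamma> p = N" .
  with \<open>P N\<close> show "bilinear (\<Gamma> p)" "\<Gamma> p x y = \<Gamma> p y x"
    "fd (\<lambda>q. h q y z) p x = h p (\<Gamma> p x y) z + h p y (\<Gamma> p x z)"
    "h p (\<Gamma> p x y) z = koszul p x y z"
    by (auto simp: P_def N)
  show "bilinear G \<Longrightarrow> (\<And>x y. G x y = G y x) \<Longrightarrow>
       (\<And>x y z. fd (\<lambda>q. h q y z) p x = h p (G x y) z + h p y (G x z)) \<Longrightarrow> \<Gamma> p = G"
    unfolding eq by (rule uni[symmetric]) (unfold P_def, blast)
qed

lemma christoffel_linear:
  assumes "p \<in> S"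
  shows "linear (\<Gamma> p x)" "linear (\<lambda>x. \<Gamma> p x y)"
  using bilinear_christoffel[OF assms] by (auto simp: bilinear_def)

lemma smooth_christoffel: "smooth_on S (\<lambda>p. \<Gamma> p x y)"
proof (rule smooth_on_solve[OF open_S, where b = h and a = "\<lambda>p. koszul p x y"])
  show "smooth_on S (\<lambda>p. koszul p x y z)" for z
    unfolding koszul_def
    by (intro smooth_on_divide smooth_on_add smooth_on_diff open_S smooth_on_fd smooth smooth_on_const) simp
  show "v = 0" if "p \<in> S" "\<And>y. h p v y = 0" for p v
    using inner_form_nondeg[OF inner[OF that(1)]] that(2) by blast
qed (simp_all add: metric_linear smooth christoffel_koszul)

lemma differentiable_christoffel: "p \<in> S \<Longrightarrow> (\<lambda>p. \<Gamma> p x y) differentiable (at p)"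
  using smooth_on_differentiable[OF smooth_christoffel] .

section \<open>Curvature and covariant derivatives in coordinates\<close>

lemma nabla_const: "nabla h (\<lambda>_. x) (\<lambda>_. y) p = \<Gamma> p x y"
  by (simp add: nabla_def ddir_eq_fd fd_const)

text \<open>The curvature on coordinate fields: these commute and have zero derivative in the chart,
  so only terms in \<open>\<Gamma>\<close> survive. The signs are those of the convention that
  starts with the negative of the second covariant derivative along x and y.\<close>

definition cv where
  "cv p x y w = fd (\<lambda>q. \<Gamma> q x w) p y - fd (\<lambda>q. \<Gamma> q y w) p x + \<Gamma> p y (\<Gamma> p x w) - \<Gamma> p x (\<Gamma> p y w)"

lemma Rm_eq: "p \<in> S \<Longrightarrow> Rm h p x y w z = h p (cv p x y w) z"
proof -
  assume p: "p \<in> S"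
  have "curv h (\<lambda>_. x) (\<lambda>_. y) (\<lambda>_. w) p = cv p x y w"
    unfolding curv_def lie_bracket_def cv_def
    by (simp add: nabla_def ddir_eq_fd fd_const linear_0[OF christoffel_linear(2)[OF p]])
  then show ?thesis by (simp add: Rm_def)
qed

lemma hessian_eq: "hessian h u p x y = fd (\<lambda>q. fd u q y) p x - fd u p (\<Gamma> p x y)"
  by (simp add: hessian_def nabla_form_def nabla_const ddir_eq_fd)

lemma nabla_form_eq: "nabla_form h a p x y = fd (\<lambda>q. a q y) p x - a p (\<Gamma> p x y)"
  by (simp add: nabla_form_def nabla_const ddir_eq_fd)

lemma nabla_tensor2_eq:
  "nabla_tensor2 h T p x y z = fd (\<lambda>q. T q y z) p x - T p (\<Gamma> p x y) z - T p y (\<Gamma> p x z)"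
  by (simp add: nabla_tensor2_def nabla_const ddir_eq_fd)

lemma cv_linear:
  assumes "p \<in> S"
  shows "linear (\<lambda>x. cv p x y w)" "linear (\<lambda>y. cv p x y w)" "linear (cv p x y)"
proof -
  have 1: "linear (\<lambda>x. fd (\<lambda>q. \<Gamma> q x w) p y)" "linear (\<lambda>w. fd (\<lambda>q. \<Gamma> q x w) p y)"
    "linear (\<lambda>y. fd (\<lambda>q. \<Gamma> q x w) p y)" for x y w
    using differentiable_christoffel assms
    by (auto intro!: linear_fd_lin_field[OF open_S, of p "\<lambda>q w. \<Gamma> q x w"]
       linear_fd_lin_field[OF open_S, of p "\<lambda>q x. \<Gamma> q x w"] christoffel_linear linear_fd)
  note c = christoffel_linear[OF assms]
  have 2: "linear (\<lambda>x. \<Gamma> p y (\<Gamma> p x w))" "linear (\<lambda>y. \<Gamma> p y (\<Gamma> p x w))" "linear (\<lambda>w. \<Gamma> p y (\<Gamma> p x w))" for x y w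
    using linear_compose[OF c(1) c(1)] linear_compose[OF c(2) c(1)] c by (auto simp: o_def)
  show "linear (\<lambda>x. cv p x y w)" "linear (\<lambda>y. cv p x y w)" "linear (cv p x y)"
    unfolding cv_def by (intro linear_compose_add linear_compose_sub 1 2)+
qed

lemma smooth_cv: "smooth_on S (\<lambda>p. cv p x y w)"
proof -
  have "smooth_on S (\<lambda>p. \<Gamma> p x (\<Gamma> p y w))" for x y
    by (rule smooth_on_lin_field[where T = "\<lambda>p u. \<Gamma> p x u",
          OF open_S christoffel_linear(1) smooth_christoffel smooth_christoffel])
  then show ?thesis
    unfolding cv_def
    by (intro smooth_on_add[OF open_S] smooth_on_diff[OF open_S] smooth_on_fd smooth_christoffel)
qed

text \<open>The second derivatives of the function \<open>h q w z\<close> commute. Written out by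
  metric compatibility, products such as \<open>h p (\<Gamma> p y w) (\<Gamma> p x z)\<close> are
  symmetric under exchange of x and y and cancel; the curvature terms remain.\<close>

lemma Rm_skew:
  assumes p: "p \<in> S"
  shows "Rm h p x y w z = - Rm h p x y z w"
proof -
  note ip = inner[OF p]
  \<comment> \<open>By compatibility, \<open>E y\<close> is the derivative of \<open>h q w z\<close>
    in direction y.\<close>
  define E where "E y q = h q (\<Gamma> q y w) z + h q w (\<Gamma> q y z)" for y q
  have E: "fd (E y) p x = h p (\<Gamma> p x (\<Gamma> p y w)) z + h p (\<Gamma> p y w) (\<Gamma> p x z) + h p (fd (\<lambda>q. \<Gamma> q y w) p x) z
     + h p (\<Gamma> p x w) (\<Gamma> p y z) + h p w (\<Gamma> p x (\<Gamma> p y z)) + h p w (fd (\<lambda>q. \<Gamma> q y z) p x)" for x y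
  proof -
    have s1: "smooth_on S (\<lambda>q. h q (\<Gamma> q y w) z)"
      by (rule smooth_on_lin_field[where T = "\<lambda>q u. h q u z", OF open_S metric_linear(2) smooth smooth_christoffel])
    have s2: "smooth_on S (\<lambda>q. h q w (\<Gamma> q y z))"
      by (rule smooth_on_lin_field[where T = "\<lambda>q u. h q w u", OF open_S metric_linear(1) smooth smooth_christoffel])
    have "fd (E y) p x = fd (\<lambda>q. h q (\<Gamma> q y w) z) p x + fd (\<lambda>q. h q w (\<Gamma> q y z)) p x"
      unfolding E_def by (rule fd_add) (rule smooth_on_differentiable[OF s1 p] smooth_on_differentiable[OF s2 p])+
    also have "fd (\<lambda>q. h q (\<Gamma> q y w) z) p x = fd (\<lambda>q. h q (\<Gamma> p y w) z) p x + h p (fd (\<lambda>q. \<Gamma> q y w) p x) z"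
      by (rule fd_lin_field[where T = "\<lambda>q u. h q u z", OF open_S p metric_linear(2) smooth differentiable_christoffel[OF p]])
    also have "fd (\<lambda>q. h q w (\<Gamma> q y z)) p x = fd (\<lambda>q. h q w (\<Gamma> p y z)) p x + h p w (fd (\<lambda>q. \<Gamma> q y z) p x)"
      by (rule fd_lin_field[where T = "\<lambda>q u. h q w u", OF open_S p metric_linear(1) smooth differentiable_christoffel[OF p]])
    finally show ?thesis by (simp add: christoffel_compat[OF p])
  qed
  have "fd (E y) p x = fd (\<lambda>q. fd (\<lambda>q. h q w z) q y) p x" for x y
    using fd_cong[OF open_S p, of "\<lambda>q. fd (\<lambda>q. h q w z) q y" "E y"] by (simp add: E_def christoffel_compat)
  then have "fd (E y) p x = fd (E x) p y"
    using fd_fd_commute_real[OF smooth open_S p] by simp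
  then show ?thesis
    unfolding Rm_eq[OF p] E cv_def
    by (simp add: inner_form_simps[OF ip] metric_sym[OF p, of _ w])
qed

lemma fd_linear: "smooth_on S u \<Longrightarrow> q \<in> S \<Longrightarrow> linear (fd u q)"
  by (simp add: linear_fd smooth_on_differentiable)

text \<open>Third derivatives of u cancel by symmetry, and the terms with
  \<open>\<Gamma> p x y\<close> in the first slot because there is no torsion. What is left is du
  applied to the derivatives and products of \<open>\<Gamma>\<close> that make up
  \<open>cv\<close>.\<close>

lemma ricci_identity:
  fixes u :: "real^'n \<Rightarrow> real"
  assumes p: "p \<in> S" and u: "smooth_on S u"
  shows "nabla_tensor2 h (hessian h u) p x y z - nabla_tensor2 h (hessian h u) p y x z = fd u p (cv p x y z)"
proof -
  note lin = fd_linear[OF u]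
  have D: "fd (\<lambda>q. hessian h u q y z) p x
     = fd (\<lambda>q. fd (\<lambda>q. fd u q z) q y) p x - (fd (\<lambda>q. fd u q (\<Gamma> p y z)) p x + fd u p (fd (\<lambda>q. \<Gamma> q y z) p x))" for x y z
  proof -
    have s: "smooth_on S (\<lambda>q. fd u q (\<Gamma> q y z))"
      by (rule smooth_on_lin_field[OF open_S lin smooth_on_fd[OF u] smooth_christoffel])
    show ?thesis
      unfolding hessian_eq
      by (subst fd_diff[OF smooth_on_differentiable[OF smooth_on_fd[OF smooth_on_fd[OF u]] p] smooth_on_differentiable[OF s p]])
         (simp add: fd_lin_field[OF open_S p lin smooth_on_fd[OF u] differentiable_christoffel[OF p]])
  qed
  show ?thesis
    using fd_fd_commute_real[OF smooth_on_fd[OF u] open_S p, of z x y]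
    unfolding nabla_tensor2_eq D
    by (simp add: hessian_eq cv_def linear_add[OF lin[OF p]] linear_diff[OF lin[OF p]] christoffel_sym[OF p, of y x])
qed

end

lemma smooth_on_of_derivative:
  assumes S: "open S" and f: "\<And>p. p \<in> S \<Longrightarrow> (f has_derivative K p) (at p)"
    and K: "\<And>x. smooth_on S (\<lambda>p. K p x)"
  shows "smooth_on S f"
proof -
  have "Ck_on (Suc k) S f" for k
    using Ck_on_SucI[OF S f] K by (simp add: smooth_on_def)
  then show ?thesis using Ck_on_Suc_imp unfolding smooth_on_def by blast
qed

context riemannian_chart
begin

section \<open>Algebraic and smoothness properties of Rm, Ric and dRic\<close>

lemma Rm_linear:
  assumes p: "p \<in> S"
  shows "linear (\<lambda>x. Rm h p x y w z)" "linear (\<lambda>y. Rm h p x y w z)"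
    "linear (\<lambda>w. Rm h p x y w z)" "linear (\<lambda>z. Rm h p x y w z)"
  unfolding Rm_eq[OF p]
  using linear_compose[OF cv_linear(1)[OF p] metric_linear(2)[OF p]]
    linear_compose[OF cv_linear(2)[OF p] metric_linear(2)[OF p]]
    linear_compose[OF cv_linear(3)[OF p] metric_linear(2)[OF p]] metric_linear(1)[OF p]
  by (auto simp: o_def)

lemma smooth_Rm: "smooth_on S (\<lambda>p. Rm h p x y w z)"
  by (rule smooth_on_cong[OF open_S _ smooth_on_lin_field[where T = "\<lambda>p u. h p u z",
        OF open_S metric_linear(2) smooth smooth_cv[of x y w]]]) (simp_all add: Rm_eq)

lemma cv_bianchi:
  assumes p: "p \<in> S"
  shows "cv p x y w + cv p y w x + cv p w x y = 0"
proof -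
  have D: "fd (\<lambda>q. \<Gamma> q a b) p c = fd (\<lambda>q. \<Gamma> q b a) p c" for a b c
    by (rule fun_cong[OF fd_cong[OF open_S p christoffel_sym]])
  show ?thesis
    unfolding cv_def D[of w y x] D[of x w y] D[of y x w]
    by (simp add: christoffel_sym[OF p, of w y] christoffel_sym[OF p, of x w] christoffel_sym[OF p, of y x])
qed

text \<open>The classical combination of four first Bianchi identities with skewness in both pairs.
  Its purpose here is the symmetry of Ric.\<close>

lemma Rm_pair_sym:
  assumes p: "p \<in> S"
  shows "Rm h p x y w z = Rm h p w z x y"
proof -
  have 1: "Rm h p a b c d = - Rm h p b a c d" for a b c d
  proof -
    have "cv p a b c = - cv p b a c" by (simp add: cv_def)
    then show ?thesis by (simp add: Rm_eq[OF p] inner_form_simps[OF inner[OF p]])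
  qed
  have 2: "Rm h p a b c d + Rm h p b c a d + Rm h p c a b d = 0" for a b c d
    using cv_bianchi[OF p, of a b c] bilinear_lzero[OF inner_form_bilinear[OF inner[OF p]], of d]
    by (simp add: Rm_eq[OF p] inner_form_simps[OF inner[OF p], symmetric])
  show ?thesis
    using 2[of x y w z] 2[of y w z x] 2[of w z x y] 2[of z x y w]
      Rm_skew[OF p, of y w z x] Rm_skew[OF p, of w z y x] Rm_skew[OF p, of z y w x]
      Rm_skew[OF p, of w z x y] Rm_skew[OF p, of z x w y] Rm_skew[OF p, of x w z y]
      Rm_skew[OF p, of z x y w] Rm_skew[OF p, of x y z w] Rm_skew[OF p, of y z x w]
      1[of y z x w] 1[of z y x w] 1[of x w y z] 1[of z x w y] 1[of z x y w]
    by linarith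
qed

lemma Ric_linear:
  assumes p: "p \<in> S"
  shows "linear (\<lambda>y. Ric h p y z)" "linear (\<lambda>z. Ric h p y z)"
  unfolding Ric_def by (intro linear_trace2 Rm_linear[OF p])+

lemma Ric_sym: "p \<in> S \<Longrightarrow> Ric h p y z = Ric h p z y"
  unfolding Ric_def trace2_def using Rm_pair_sym by (intro sum.cong) auto

lemma smooth_Ric: "smooth_on S (\<lambda>p. Ric h p y z)"
  unfolding Ric_def
  by (rule smooth_on_trace2[OF open_S inner smooth])
     (auto simp: bilinear_def Rm_linear smooth_Rm)

lemma nabla_Ric_linear:
  assumes p: "p \<in> S"
  shows "linear (\<lambda>x. nabla_tensor2 h (Ric h) p x y z)" "linear (\<lambda>y. nabla_tensor2 h (Ric h) p x y z)"
    "linear (\<lambda>z. nabla_tensor2 h (Ric h) p x y z)"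
proof -
  note d = smooth_on_differentiable[OF smooth_Ric p]
  have 1: "linear (\<lambda>x. fd (\<lambda>q. Ric h q y z) p x)" for y z
    using linear_fd[OF d] .
  have 2: "linear (\<lambda>y. fd (\<lambda>q. Ric h q y z) p x)" for x z
    by (rule linear_fd_lin_field[OF open_S p, of "\<lambda>q y. Ric h q y z", OF Ric_linear(1) d])
  have 3: "linear (\<lambda>z. fd (\<lambda>q. Ric h q y z) p x)" for x y
    by (rule linear_fd_lin_field[OF open_S p, of "\<lambda>q z. Ric h q y z", OF Ric_linear(2) d])
  note R = Ric_linear[OF p] and c = christoffel_linear[OF p]
  have 4: "linear (\<lambda>x. Ric h p (\<Gamma> p x y) z)" "linear (\<lambda>y. Ric h p (\<Gamma> p x y) z)"
    "linear (\<lambda>x. Ric h p y (\<Gamma> p x z))" "linear (\<lambda>z. Ric h p y (\<Gamma> p x z))" for x y z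
    using linear_compose[OF c(1) R(1)] linear_compose[OF c(2) R(1)]
      linear_compose[OF c(1) R(2)] linear_compose[OF c(2) R(2)] by (simp_all add: o_def)
  show "linear (\<lambda>x. nabla_tensor2 h (Ric h) p x y z)" "linear (\<lambda>y. nabla_tensor2 h (Ric h) p x y z)"
    "linear (\<lambda>z. nabla_tensor2 h (Ric h) p x y z)"
    unfolding nabla_tensor2_eq by (intro linear_compose_sub 1 2 3 4 R)+
qed

lemma trilinear_dRic: "p \<in> S \<Longrightarrow> trilinear (dRic h p)"
  unfolding trilinear_def dRic_def by (intro allI conjI linear_compose_sub nabla_Ric_linear)

lemma smooth_dRic: "smooth_on S (\<lambda>p. dRic h p x y z)"
proof -
  have 1: "smooth_on S (\<lambda>p. Ric h p (\<Gamma> p x y) z)" for x y z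
    by (rule smooth_on_lin_field[where T = "\<lambda>p u. Ric h p u z",
          OF open_S Ric_linear(1) smooth_Ric smooth_christoffel])
  have 2: "smooth_on S (\<lambda>p. Ric h p z (\<Gamma> p x y))" for x y z
    by (rule smooth_on_lin_field[where T = "\<lambda>p u. Ric h p z u",
          OF open_S Ric_linear(2) smooth_Ric smooth_christoffel])
  show ?thesis
    unfolding dRic_def nabla_tensor2_eq
    by (intro smooth_on_diff[OF open_S] smooth_on_fd smooth_Ric 1 2)
qed

section \<open>The tensors A^W and B\<close>

lemma AW_linear:
  assumes p: "p \<in> S"
  shows "linear (\<lambda>x. AW h p x y w z)" "linear (\<lambda>y. AW h p x y w z)"
    "linear (\<lambda>w. AW h p x y w z)" "linear (\<lambda>z. AW h p x y w z)"
  unfolding AW_def kulkarni_nomizu_def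
  by (intro linear_compose_add linear_compose_sub linear_mult_left linear_mult_right
      Rm_linear[OF p] Ric_linear[OF p] metric_linear[OF p])+

lemma smooth_AW: "smooth_on S (\<lambda>p. AW h p x y w z)"
  unfolding AW_def kulkarni_nomizu_def
  by (intro smooth_on_add smooth_on_diff smooth_on_mult open_S smooth_Rm smooth_Ric smooth)

lemma tr_AW_linear:
  assumes p: "p \<in> S"
  shows "linear (\<lambda>y. tr_AW h p y z)" "linear (\<lambda>z. tr_AW h p y z)"
  unfolding tr_AW_def by (intro linear_trace2 AW_linear[OF p])+

lemma smooth_tr_AW: "smooth_on S (\<lambda>p. tr_AW h p y z)"
  unfolding tr_AW_def
  by (rule smooth_on_trace2[OF open_S inner smooth])
     (auto simp: bilinear_def AW_linear smooth_AW)

text \<open>The product of Ric and g has trace (n - 2) Ric + R g, and Rm contributes one more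
  Ric.\<close>

lemma tr_AW_eq:
  assumes p: "p \<in> S"
  shows "tr_AW h p y z = (real CARD('n) - 1) * Ric h p y z + scal h p * h p y z"
proof -
  note c = trace2_contract[OF inner[OF p]]
  have "tr_AW h p y z = Ric h p y z + (scal h p * h p y z + Ric h p y z * trace2 (h p) (h p)
      - trace2 (h p) (\<lambda>u v. Ric h p u z * h p y v) - trace2 (h p) (\<lambda>u v. h p u z * Ric h p y v))"
    unfolding tr_AW_def AW_def kulkarni_nomizu_def trace2_add trace2_diff trace2_multc trace2_cmult
      Ric_def[symmetric] scal_def by (simp add: mult.commute[of "h p _ z"])
  then show ?thesis
    unfolding c(1)[OF Ric_linear(2)[OF p]] c(2)[OF Ric_linear(1)[OF p]] trace2_self[OF inner[OF p]]
    by (simp add: algebra_simps)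
qed

lemma B_hom_eq:
  "B_hom h p w x y z = AW h p x y w z
     - 1 / (real CARD('n) - 1) * (tr_AW h p w x * h p y z - tr_AW h p w y * h p x z)"
  by (simp add: B_hom_def AW_hom_def wedge_metric_def)

lemma B_hom_linear: "p \<in> S \<Longrightarrow> linear (\<lambda>w. B_hom h p w x y z)"
  unfolding B_hom_eq
  by (intro linear_compose_sub linear_mult_left linear_mult_right AW_linear tr_AW_linear)

lemma trilinear_B_hom: "p \<in> S \<Longrightarrow> trilinear (B_hom h p w)"
  unfolding trilinear_def B_hom_eq
  by (intro allI conjI linear_compose_sub linear_mult_left linear_mult_right AW_linear
      tr_AW_linear metric_linear)

lemma smooth_B_hom: "smooth_on S (\<lambda>p. B_hom h p w x y z)"
  unfolding B_hom_eq
  by (intro smooth_on_diff smooth_on_mult smooth_on_const open_S smooth_AW smooth_tr_AW smooth)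

section \<open>The static equation in a chart\<close>

lemma static_imp_hessian:
  assumes p: "p \<in> S" and n: "CARD('n) \<ge> 2" and scal: "scal h p = (real CARD('n) - 1) * lam"
    and eq: "\<And>x y. 0 = v p * Ric h p x y - hessian h v p x y + laplacian h v p * h p x y"
  shows "hessian h v p x y = v p * (Ric h p x y - lam * h p x y)"
proof -
  have H: "hessian h v p = (\<lambda>x y. v p * Ric h p x y + laplacian h v p * h p x y)"
    using eq by (simp add: fun_eq_iff algebra_simps)
  have "laplacian h v p = v p * scal h p + laplacian h v p * trace2 (h p) (h p)"
    by (subst laplacian_def, subst H) (simp add: trace2_add trace2_cmult scal_def)
  then have "laplacian h v p = v p * ((real CARD('n) - 1) * lam) + laplacian h v p * real CARD('n)"
    by (simp only: trace2_self[OF inner[OF p]] scal)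
  \<comment> \<open>Cancelling the factor n - 1 in the next line is where n \<ge> 2 enters.\<close>
  then have "(real CARD('n) - 1) * (laplacian h v p + lam * v p) = 0" by algebra
  then have "laplacian h v p = - lam * v p" using n by simp
  then show ?thesis by (simp add: H algebra_simps)
qed

lemma hessian_imp_static:
  assumes p: "p \<in> S" and scal: "scal h p = (real CARD('n) - 1) * lam"
    and H: "\<And>x y. hessian h v p x y = v p * (Ric h p x y - lam * h p x y)"
  shows "0 = v p * Ric h p x y - hessian h v p x y + laplacian h v p * h p x y"
proof -
  have "hessian h v p = (\<lambda>x y. v p * (Ric h p x y - lam * h p x y))"
    using H by blast
  then have "laplacian h v p = v p * (scal h p - lam * real CARD('n))"
    by (simp add: laplacian_def trace2_cmult trace2_diff scal_def trace2_self[OF inner[OF p]])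
  then have "laplacian h v p = - lam * v p" by (simp add: scal algebra_simps)
  then show ?thesis by (simp add: H algebra_simps)
qed

text \<open>Taking the skew derivative of \<open>\<nabla>\<^sup>2v = v (Ric - \<lambda>g)\<close> and applying the Ricci identity.\<close>

lemma static_dRic:
  assumes p: "p \<in> S" and n: "CARD('n) \<ge> 2" and scal: "scal h p = (real CARD('n) - 1) * lam"
    and v: "smooth_on S v" "v p > 0"
    and H: "\<And>q x y. q \<in> S \<Longrightarrow> hessian h v q x y = v q * (Ric h q x y - lam * h q x y)"
  shows "v p * dRic h p x y z = - B_hom h p (sharp (h p) (fd v p)) x y z"
proof -
  define w where "w = sharp (h p) (fd v p)"
  note lin = fd_linear[OF v(1) p]
  have w: "fd v p x = h p w x" for x unfolding w_def by (simp add: sharp[OF inner[OF p] lin])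
  have nab: "nabla_tensor2 h (hessian h v) p x y z
      = v p * nabla_tensor2 h (Ric h) p x y z + h p w x * (Ric h p y z - lam * h p y z)" for x y z
  proof -
    note dR = smooth_on_differentiable[OF smooth_Ric p]
    note dh = smooth_on_differentiable[OF smooth p]
    have "fd (\<lambda>q. hessian h v q y z) p x = fd (\<lambda>q. v q * (Ric h q y z - lam * h q y z)) p x"
      by (rule fun_cong[OF fd_cong[OF open_S p H]])
    also have "\<dots> = v p * (fd (\<lambda>q. Ric h q y z) p x - lam * fd (\<lambda>q. h q y z) p x)
        + fd v p x * (Ric h p y z - lam * h p y z)"
      using dR dh smooth_on_differentiable[OF v(1) p]
      by (simp add: fd_mult fd_diff differentiable_mult differentiable_diff fd_const)
    finally show ?thesis
      unfolding nabla_tensor2_eq H[OF p] christoffel_compat[OF p] by (simp add: w algebra_simps)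
  qed
  have tr0: "tr_AW h p w x = (real CARD('n) - 1) * (Ric h p x w + lam * h p w x)" for x
    by (simp add: tr_AW_eq[OF p] scal Ric_sym[OF p, of w] algebra_simps)
  have cancel: "1 / m * (m * X * a - m * Y * b) = X * a - Y * b" if "m \<noteq> 0" for m X Y a b :: real
    using that by (simp add: field_simps)
  have tr: "1 / (real CARD('n) - 1) * (tr_AW h p w x * a - tr_AW h p w y * b)
      = (Ric h p x w + lam * h p w x) * a - (Ric h p y w + lam * h p w y) * b" for x y a b
    unfolding tr0 using n by (intro cancel) simp
  \<comment> \<open>Since dv is the pairing with w, the Ricci identity produces Rm(x,y,z,w);
    skewness in the last pair puts w where \<open>B_hom\<close> has it and accounts for the
    sign.\<close>
  have "fd v p (cv p x y z) = - Rm h p x y w z"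
    unfolding w Rm_skew[OF p, of x y w z] by (simp add: Rm_eq[OF p] metric_sym[OF p, of w])
  with ricci_identity[OF p v(1), of x y z]
  have "v p * dRic h p x y z = - Rm h p x y w z - h p w x * (Ric h p y z - lam * h p y z)
      + h p w y * (Ric h p x z - lam * h p x z)"
    unfolding dRic_def nab by (simp add: algebra_simps)
  then show ?thesis
    unfolding w_def[symmetric] B_hom_eq tr AW_def kulkarni_nomizu_def
    by (simp add: metric_sym[OF p, of _ w] algebra_simps)
qed

end

section \<open>The field K and the tensor G\<close>

locale static_chart = riemannian_chart S h for S :: "(real^'n::finite) set" and h :: "'n metric" +
  assumes inj_B: "p \<in> S \<Longrightarrow> inj (B_hom h p)"
begin

text \<open>The bilinear form belonging to the endomorphism \<open>B_check\<close>. Injectivity of B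
  makes it nondegenerate, and its smoothness is that of B and of the metric on F.\<close>

definition \<beta> where "\<beta> p x y = inner_F (h p) (B_hom h p x) (B_hom h p y)"

lemma \<beta>_linear:
  assumes "p \<in> S"
  shows "linear (\<lambda>x. \<beta> p x y)" "linear (\<beta> p x)"
  unfolding \<beta>_def
  by (rule linear_inner_F_left[OF B_hom_linear[OF assms]], rule linear_inner_F_right[OF B_hom_linear[OF assms]])

lemma \<beta>_nondeg:
  assumes p: "p \<in> S" and 0: "\<And>y. \<beta> p x y = 0"
  shows "x = 0"
proof -
  have "B_hom h p x = B_hom h p 0"
  proof (intro ext)
    show "B_hom h p x a b c = B_hom h p 0 a b c" for a b c
      using inner_F_self_eq_0[OF inner[OF p] trilinear_B_hom[OF p] 0[of x, unfolded \<beta>_def]]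
        linear_0[OF B_hom_linear[OF p]] by simp
  qed
  then show ?thesis using inj_B[OF p] by (simp add: inj_def)
qed

lemma metric_B_check: "p \<in> S \<Longrightarrow> h p (B_check h p x) y = \<beta> p x y"
  unfolding B_check_def vee_def \<beta>_def[symmetric] by (rule sharp[OF inner \<beta>_linear(2)])

text \<open>\<open>inv\<close> chooses preimages and is a right inverse only for a surjective map;
  in finite dimension surjectivity follows from the injectivity given by nondegeneracy of
  \<open>\<beta>\<close>.\<close>

lemma B_check_inv: assumes p: "p \<in> S" shows "B_check h p (inv (B_check h p) x) = x"
proof -
  have lin: "linear (B_check h p)"
    by (intro linearI inner_form_eqI[OF inner[OF p]])
       (simp_all add: metric_B_check[OF p] inner_form_simps[OF inner[OF p]]
         linear_add[OF \<beta>_linear(1)[OF p]] linear_scale[OF \<beta>_linear(1)[OF p]])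
  have "x = 0" if "B_check h p x = 0" for x
  proof (rule \<beta>_nondeg[OF p])
    show "\<beta> p x y = 0" for y
      using that by (simp add: metric_B_check[OF p, symmetric] inner_form_simps[OF inner[OF p]])
  qed
  then have "inj (B_check h p)" using linear_injective_0[OF lin] by blast
  then have "surj (B_check h p)" by (rule linear_inj_imp_surj[OF lin])
  then show ?thesis by (rule surj_f_inv_f)
qed

definition "Binv p = inv (B_check h p)"

lemma \<beta>_Binv: "p \<in> S \<Longrightarrow> \<beta> p (Binv p x) y = h p x y"
  by (simp add: Binv_def metric_B_check[symmetric] B_check_inv)

text \<open>For fixed x, the vector \<open>Binv p x\<close> is the solution u of the system
  \<open>\<beta> p u y = h p x y\<close>, whose coefficients are smooth in p.\<close>

lemma smooth_Binv: "smooth_on S (\<lambda>p. Binv p x)"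
proof (rule smooth_on_solve[OF open_S, where b = \<beta> and a = "\<lambda>p. h p x"])
  show "smooth_on S (\<lambda>p. \<beta> p x y)" for x y
    unfolding \<beta>_def
    by (rule smooth_on_inner_F[OF open_S inner smooth trilinear_B_hom smooth_B_hom trilinear_B_hom smooth_B_hom])
qed (auto simp: \<beta>_linear \<beta>_nondeg smooth \<beta>_Binv)

lemma linear_Binv:
  assumes p: "p \<in> S"
  shows "linear (Binv p)"
proof -
  have eqI: "x = y" if "\<And>z. \<beta> p x z = \<beta> p y z" for x y
    using \<beta>_nondeg[OF p, of "x - y"] that by (simp add: linear_diff[OF \<beta>_linear(1)[OF p]])
  show ?thesis
    by (intro linearI eqI)
       (simp_all add: \<beta>_Binv[OF p] inner_form_simps[OF inner[OF p]]
         linear_add[OF \<beta>_linear(1)[OF p]] linear_scale[OF \<beta>_linear(1)[OF p]])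
qed

lemma K_form_eq:
  assumes p: "p \<in> S"
  shows "K_form h p x = - inner_F (h p) (dRic h p) (B_hom h p (Binv p x))"
proof -
  have "linear (\<lambda>x. inner_F (h p) (dRic h p) (B_hom h p (Binv p x)))"
    using linear_compose[OF linear_Binv[OF p] linear_inner_F_right[OF B_hom_linear[OF p]]]
    by (simp add: o_def)
  then show ?thesis
    using sharp[OF inner[OF p]]
    by (simp add: K_form_def flat_def K_field_def D_hom_def Binv_def[symmetric] inner_form_simps[OF inner[OF p]])
qed

lemma smooth_K_form: "smooth_on S (\<lambda>p. K_form h p x)"
proof (rule smooth_on_cong[OF open_S])
  have 1: "smooth_on S (\<lambda>p. inner_F (h p) (dRic h p) (B_hom h p y))" for y
    by (rule smooth_on_inner_F[OF open_S inner smooth trilinear_dRic smooth_dRic trilinear_B_hom smooth_B_hom])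
  show "smooth_on S (\<lambda>p. - inner_F (h p) (dRic h p) (B_hom h p (Binv p x)))"
    by (rule smooth_on_minus[OF open_S smooth_on_lin_field[where T = "\<lambda>p y. inner_F (h p) (dRic h p) (B_hom h p y)",
         OF open_S linear_inner_F_right[OF B_hom_linear] 1 smooth_Binv]])
qed (simp add: K_form_eq)

lemma linear_K_form: "p \<in> S \<Longrightarrow> linear (K_form h p)"
  using metric_linear(1) by (simp add: K_form_def flat_def)

text \<open>A positive solution has \<open>K = \<nabla> log v\<close>: by \<open>static_dRic\<close>, \<open>dRic = - B(\<nabla>v) / v\<close>, and
  pairing \<open>B\<close> with \<open>D\<close> gives the metric.\<close>

lemma static_K_form:
  assumes p: "p \<in> S" and n: "CARD('n) \<ge> 2" and scal: "scal h p = (real CARD('n) - 1) * lam"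
    and v: "smooth_on S v" "v p > 0"
    and H: "\<And>q x y. q \<in> S \<Longrightarrow> hessian h v q x y = v q * (Ric h q x y - lam * h q x y)"
  shows "K_form h p x = fd v p x / v p"
proof -
  define w where "w = sharp (h p) (fd v p)"
  have d: "v p * dRic h p x y z = - B_hom h p w x y z" for x y z
    unfolding w_def by (rule static_dRic[OF p n scal v H])
  have "v p * inner_F (h p) (dRic h p) T = - inner_F (h p) (B_hom h p w) T" for T
  proof -
    have "v p * inner_F (h p) (dRic h p) T = inner_F (h p) (\<lambda>x y z. v p * dRic h p x y z) T"
      by (simp add: inner_F_def sum_distrib_left mult.assoc)
    then show ?thesis
      unfolding d by (simp add: inner_F_def sum_negf)
  qed
  then have "v p * K_form h p x = \<beta> p (Binv p x) w"
    by (simp add: K_form_eq[OF p] \<beta>_def inner_F_commute[of "h p" "B_hom h p w"])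
  also have "\<dots> = fd v p x"
    using sharp[OF inner[OF p] fd_linear[OF v(1) p]]
    by (simp add: \<beta>_Binv[OF p] w_def metric_sym[OF p, of x])
  finally show ?thesis using v(2) by (simp add: field_simps)
qed

text \<open>Covariant differentiation of \<open>v K = dv\<close> expresses the Hessian of v as v
  (\<nabla>K + K \<otimes> K); comparison with the given Hessian leaves v G = 0. Starting from the
  product instead of K = dv / v avoids the quotient rule.\<close>

lemma static_G_tensor:
  assumes p: "p \<in> S" and n: "CARD('n) \<ge> 2" and scal: "\<And>q. q \<in> S \<Longrightarrow> scal h q = (real CARD('n) - 1) * lam"
    and v: "smooth_on S v" "\<And>q. q \<in> S \<Longrightarrow> v q > 0"
    and H: "\<And>q x y. q \<in> S \<Longrightarrow> hessian h v q x y = v q * (Ric h q x y - lam * h q x y)"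
  shows "G_tensor h lam p x y = 0"
proof -
  have K: "K_form h q y = fd v q y / v q" if "q \<in> S" for q y
    by (rule static_K_form[OF that n scal[OF that] v(1) v(2)[OF that] H])
  have eq: "v q * K_form h q y = fd v q y" if "q \<in> S" for q y
    using v(2)[OF that] by (simp add: K[OF that])
  have "fd (\<lambda>q. fd v q y) p x = fd (\<lambda>q. v q * K_form h q y) p x"
    by (rule fun_cong[OF fd_cong[OF open_S p eq[symmetric]]])
  also have "\<dots> = v p * fd (\<lambda>q. K_form h q y) p x + fd v p x * K_form h p y"
    using smooth_on_differentiable[OF v(1) p] smooth_on_differentiable[OF smooth_K_form p]
    by (simp add: fd_mult)
  finally have "v p * G_tensor h lam p x y = 0"
    using H[OF p, of x y]
    unfolding G_tensor_def nabla_form_eq hessian_eq eq[OF p, symmetric] by algebra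
  then show ?thesis using v(2)[OF p] by simp
qed

lemma G_tensor_imp_closed:
  assumes p: "p \<in> S" and G: "\<And>x y. G_tensor h lam p x y = 0"
  shows "fd (\<lambda>q. K_form h q y) p x = fd (\<lambda>q. K_form h q x) p y"
  using G[of x y] G[of y x] unfolding G_tensor_def nabla_form_eq
  by (simp add: Ric_sym[OF p, of y] christoffel_sym[OF p, of y] metric_sym[OF p, of y] mult.commute)

lemma G_tensor_imp_hessian:
  assumes p: "p \<in> S" and f: "\<And>q. q \<in> S \<Longrightarrow> (f has_derivative K_form h q) (at q)"
    and G: "G_tensor h lam p x y = 0"
  shows "hessian h (\<lambda>q. exp (f q)) p x y = exp (f p) * (Ric h p x y - lam * h p x y)"
proof -
  have D: "fd (\<lambda>q. exp (f q)) q y = exp (f q) * K_form h q y" if "q \<in> S" for q y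
    using fd_eq[OF has_derivative_exp[OF f[OF that]]] by (simp add: mult.commute)
  have de: "(\<lambda>q. exp (f q)) differentiable (at p)"
    using has_derivative_exp[OF f[OF p]] unfolding differentiable_def by blast
  have "fd (\<lambda>q. fd (\<lambda>q. exp (f q)) q y) p x = fd (\<lambda>q. exp (f q) * K_form h q y) p x"
    by (rule fun_cong[OF fd_cong[OF open_S p D]])
  also have "\<dots> = exp (f p) * fd (\<lambda>q. K_form h q y) p x + exp (f p) * K_form h p x * K_form h p y"
    using smooth_on_differentiable[OF smooth_K_form p] by (simp add: fd_mult de D[OF p])
  finally show ?thesis
    using G unfolding hessian_eq G_tensor_def nabla_form_eq D[OF p] by algebra
qed

lemma smooth_exp_primitive:
  assumes "\<And>q. q \<in> S \<Longrightarrow> (f has_derivative K_form h q) (at q)"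
  shows "smooth_on S (\<lambda>q. exp (f q))"
  by (rule smooth_on_exp[OF open_S smooth_on_of_derivative[OF open_S assms smooth_K_form]])

end

context riemannian_chart
begin

lemma hessian_linear:
  assumes p: "p \<in> S" and u: "smooth_on S u"
  shows "linear (\<lambda>x. hessian h u p x y)" "linear (\<lambda>y. hessian h u p x y)"
proof -
  note d = smooth_on_differentiable[OF smooth_on_fd[OF u] p]
  have 1: "linear (\<lambda>x. fd (\<lambda>q. fd u q y) p x)" for y
    using linear_fd[OF d] .
  have 2: "linear (\<lambda>y. fd (\<lambda>q. fd u q y) p x)" for x
    by (rule linear_fd_lin_field[OF open_S p fd_linear[OF u] d])
  have 3: "linear (\<lambda>x. fd u p (\<Gamma> p x y))" "linear (\<lambda>y. fd u p (\<Gamma> p x y))" for x y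
    using linear_compose[OF christoffel_linear(1)[OF p] fd_linear[OF u p]]
      linear_compose[OF christoffel_linear(2)[OF p] fd_linear[OF u p]] by (simp_all add: o_def)
  show "linear (\<lambda>x. hessian h u p x y)" "linear (\<lambda>y. hessian h u p x y)"
    unfolding hessian_eq by (intro linear_compose_sub 1 2 3)+
qed

lemma smooth_hessian:
  assumes u: "smooth_on S u"
  shows "smooth_on S (\<lambda>p. hessian h u p x y)"
  unfolding hessian_eq
  by (rule smooth_on_diff[OF open_S smooth_on_fd[OF smooth_on_fd[OF u]]
        smooth_on_lin_field[OF open_S fd_linear[OF u] smooth_on_fd[OF u] smooth_christoffel]])

end

section \<open>Change of charts\<close>

text \<open>Only the coordinate change in one direction is carried along: invertibility of its
  Jacobian follows from the isometry condition and definiteness of the metric.\<close>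

locale chart_change = C: riemannian_chart W h + D: riemannian_chart S' h'
  for W :: "(real^'n::finite) set" and h :: "'n metric"
    and S' :: "(real^'n) set" and h' :: "'n metric" +
  fixes \<tau> :: "real^'n \<Rightarrow> real^'n"
  assumes smooth_\<tau>: "smooth_on W \<tau>" and \<tau>_maps: "p \<in> W \<Longrightarrow> \<tau> p \<in> S'"
    and isometry: "p \<in> W \<Longrightarrow> h p x y = h' (\<tau> p) (fd \<tau> p x) (fd \<tau> p y)"
begin

abbreviation "J p \<equiv> fd \<tau> p"
text \<open>The second derivative of the coordinate change, which is the inhomogeneous term in the
  transformation of Christoffel symbols.\<close>

definition "H p x y = fd (\<lambda>q. fd \<tau> q y) p x"

section \<open>Derivatives of pulled back functions and forms\<close>

lemma smooth_J: "smooth_on W (\<lambda>q. J q x)"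
  by (rule smooth_on_fd[OF smooth_\<tau>])

lemma linear_J: "p \<in> W \<Longrightarrow> linear (J p)"
  by (rule linear_fd[OF smooth_on_differentiable[OF smooth_\<tau>]])

lemma inj_J:
  assumes p: "p \<in> W"
  shows "inj (J p)"
proof -
  have "x = 0" if "J p x = 0" for x
    using inner_form_nondeg[OF C.inner[OF p], of x] that
    by (simp add: isometry[OF p] linear_0[OF D.metric_linear(2)[OF \<tau>_maps[OF p]]])
  then show ?thesis using linear_injective_0[OF linear_J[OF p]] by blast
qed

lemma surj_J: "p \<in> W \<Longrightarrow> surj (J p)"
  by (rule linear_inj_imp_surj[OF linear_J inj_J])

lemma smooth_pullback: "smooth_on S' f \<Longrightarrow> smooth_on W (\<lambda>q. f (\<tau> q))"
  using \<tau>_maps by (intro smooth_on_compose[OF C.open_S smooth_\<tau>]) auto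

lemma fd_pullback:
  assumes p: "p \<in> W" and f: "f differentiable (at (\<tau> p))"
  shows "fd (\<lambda>q. f (\<tau> q)) p x = fd f (\<tau> p) (J p x)"
  using fd_eq[OF has_derivative_compose[OF fd_works[OF smooth_on_differentiable[OF smooth_\<tau> p]] fd_works[OF f]]]
  by simp

lemma fd_pullback1:
  assumes p: "p \<in> W" and lin: "\<And>q. q \<in> S' \<Longrightarrow> linear (T q)" and T: "\<And>u. smooth_on S' (\<lambda>q. T q u)"
  shows "fd (\<lambda>q. T (\<tau> q) (J q y)) p x = fd (\<lambda>q. T q (J p y)) (\<tau> p) (J p x) + T (\<tau> p) (H p x y)"
  using fd_lin_field[where T = "\<lambda>q. T (\<tau> q)", OF C.open_S p lin[OF \<tau>_maps] smooth_pullback[OF T]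
      smooth_on_differentiable[OF smooth_J p]]
    fd_pullback[OF p smooth_on_differentiable[OF T \<tau>_maps[OF p]]]
  unfolding H_def by simp

lemma fd_pullback2:
  assumes p: "p \<in> W" and lin: "\<And>q y. q \<in> S' \<Longrightarrow> linear (\<lambda>x. T q x y)" "\<And>q x. q \<in> S' \<Longrightarrow> linear (T q x)"
    and T: "\<And>u v. smooth_on S' (\<lambda>q. T q u v)"
  shows "fd (\<lambda>q. T (\<tau> q) (J q y) (J q z)) p x = fd (\<lambda>q. T q (J p y) (J p z)) (\<tau> p) (J p x)
    + T (\<tau> p) (H p x y) (J p z) + T (\<tau> p) (J p y) (H p x z)"
proof -
  have "smooth_on W (\<lambda>q. T (\<tau> q) u (J q z))" for u
    by (rule smooth_on_lin_field[where T = "\<lambda>q. T (\<tau> q) u", OF C.open_S lin(2)[OF \<tau>_maps] smooth_pullback[OF T] smooth_J])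
  from fd_lin_field[where T = "\<lambda>q u. T (\<tau> q) u (J q z)", OF C.open_S p lin(1)[OF \<tau>_maps] this
      smooth_on_differentiable[OF smooth_J p]]
  show ?thesis
    using fd_pullback1[where T = "\<lambda>q. T q (J p y)", OF p lin(2) T] by (simp add: H_def)
qed

lemma H_linear:
  assumes p: "p \<in> W"
  shows "linear (\<lambda>x. H p x y)" "linear (\<lambda>y. H p x y)"
  unfolding H_def
  using linear_fd[OF smooth_on_differentiable[OF smooth_J p]]
    linear_fd_lin_field[OF C.open_S p linear_J smooth_on_differentiable[OF smooth_J p]] by auto

lemma H_sym: "p \<in> W \<Longrightarrow> H p x y = H p y x"
  unfolding H_def by (rule fd_fd_commute[OF smooth_\<tau> C.open_S])

text \<open>The classical transformation law, taken as the definition of a candidate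
  \<open>G\<close>: invertibility of the Jacobian makes \<open>G\<close> well defined, the law shows
  that it is symmetric and compatible with h, and uniqueness identifies it with the
  connection.\<close>

lemma christoffel_pullback:
  assumes p: "p \<in> W"
  shows "J p (C.\<Gamma> p x y) = D.\<Gamma> (\<tau> p) (J p x) (J p y) + H p x y"
proof -
  note q = \<tau>_maps[OF p]
  define G where "G x y = inv (J p) (D.\<Gamma> (\<tau> p) (J p x) (J p y) + H p x y)" for x y
  have JG: "J p (G x y) = D.\<Gamma> (\<tau> p) (J p x) (J p y) + H p x y" for x y
    unfolding G_def by (rule surj_f_inv_f[OF surj_J[OF p]])
  have eqI: "a = b" if "J p a = J p b" for a b
    using inj_J[OF p] that by (simp add: inj_eq)
  note lin = linear_add[OF linear_J[OF p]] linear_scale[OF linear_J[OF p]]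
    linear_add[OF H_linear(1)[OF p]] linear_scale[OF H_linear(1)[OF p]]
    linear_add[OF H_linear(2)[OF p]] linear_scale[OF H_linear(2)[OF p]]
    bilinear_ladd[OF D.bilinear_christoffel[OF q]] bilinear_radd[OF D.bilinear_christoffel[OF q]]
    bilinear_lmul[OF D.bilinear_christoffel[OF q]] bilinear_rmul[OF D.bilinear_christoffel[OF q]]
  have "C.\<Gamma> p = G"
  proof (rule C.christoffel_unique[OF p])
    show "bilinear G"
      unfolding bilinear_def
      by (intro allI conjI linearI; rule eqI) (simp_all add: JG lin scaleR_add_right)
    show "G x y = G y x" for x y
      by (rule eqI) (simp add: JG D.christoffel_sym[OF q, of "J p x"] H_sym[OF p, of x])
    show "fd (\<lambda>q. h q y z) p x = h p (G x y) z + h p y (G x z)" for x y z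
    proof -
      have "fd (\<lambda>q. h q y z) p x = fd (\<lambda>q. h' (\<tau> q) (J q y) (J q z)) p x"
        by (rule fun_cong[OF fd_cong[OF C.open_S p isometry]])
      also have "\<dots> = fd (\<lambda>q. h' q (J p y) (J p z)) (\<tau> p) (J p x)
          + h' (\<tau> p) (H p x y) (J p z) + h' (\<tau> p) (J p y) (H p x z)"
        by (rule fd_pullback2[OF p D.metric_linear(2) D.metric_linear(1) D.smooth])
      finally show ?thesis
        unfolding isometry[OF p] JG D.christoffel_compat[OF q]
        by (simp add: inner_form_simps[OF D.inner[OF q]])
    qed
  qed
  then show ?thesis by (simp add: JG)
qed

text \<open>The second derivative of \<open>\<tau>\<close> enters once through the chain rule and
  once through the Christoffel symbols, and the two contributions cancel.\<close>

lemma hessian_pullback: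
  assumes p: "p \<in> W" and u: "smooth_on S' u"
  shows "hessian h (\<lambda>q. u (\<tau> q)) p x y = hessian h' u (\<tau> p) (J p x) (J p y)"
proof -
  note q = \<tau>_maps[OF p]
  have 1: "fd (\<lambda>q. u (\<tau> q)) q y = fd u (\<tau> q) (J q y)" if "q \<in> W" for q y
    by (rule fd_pullback[OF that smooth_on_differentiable[OF u \<tau>_maps[OF that]]])
  have "fd (\<lambda>q. fd (\<lambda>q. u (\<tau> q)) q y) p x = fd (\<lambda>q. fd u (\<tau> q) (J q y)) p x"
    by (rule fun_cong[OF fd_cong[OF C.open_S p 1]])
  also have "\<dots> = fd (\<lambda>q. fd u q (J p y)) (\<tau> p) (J p x) + fd u (\<tau> p) (H p x y)"
    by (rule fd_pullback1[OF p D.fd_linear[OF u] smooth_on_fd[OF u]])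
  finally show ?thesis
    unfolding D.hessian_eq C.hessian_eq
    by (simp add: 1[OF p] christoffel_pullback[OF p] linear_add[OF D.fd_linear[OF u q]])
qed

lemma nabla_tensor2_pullback:
  assumes p: "p \<in> W" and lin: "\<And>q y. q \<in> S' \<Longrightarrow> linear (\<lambda>x. T' q x y)" "\<And>q x. q \<in> S' \<Longrightarrow> linear (T' q x)"
    and T': "\<And>u v. smooth_on S' (\<lambda>q. T' q u v)"
    and T: "\<And>q x y. q \<in> W \<Longrightarrow> T q x y = T' (\<tau> q) (J q x) (J q y)"
  shows "nabla_tensor2 h T p x y z = nabla_tensor2 h' T' (\<tau> p) (J p x) (J p y) (J p z)"
proof -
  note q = \<tau>_maps[OF p]
  have "fd (\<lambda>q. T q y z) p x = fd (\<lambda>q. T' (\<tau> q) (J q y) (J q z)) p x"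
    by (rule fun_cong[OF fd_cong[OF C.open_S p T]])
  also have "\<dots> = fd (\<lambda>q. T' q (J p y) (J p z)) (\<tau> p) (J p x)
    + T' (\<tau> p) (H p x y) (J p z) + T' (\<tau> p) (J p y) (H p x z)"
    by (rule fd_pullback2[OF p lin T'])
  finally show ?thesis
    unfolding C.nabla_tensor2_eq D.nabla_tensor2_eq T[OF p]
    by (simp add: christoffel_pullback[OF p] linear_add[OF lin(1)[OF q]] linear_add[OF lin(2)[OF q]])
qed

text \<open>The Ricci identity for a function whose gradient at the point is \<open>w\<close> reduces the
  curvature tensor to Hessians.\<close>

lemma Rm_pullback:
  assumes p: "p \<in> W"
  shows "Rm h p x y z w = Rm h' (\<tau> p) (J p x) (J p y) (J p z) (J p w)"
proof -
  note q = \<tau>_maps[OF p]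
  \<comment> \<open>A linear function of the target coordinates: it is smooth, equals its own
    derivative everywhere, and its gradient at \<open>\<tau> p\<close> is
    \<open>J p w\<close>.\<close>
  define u where "u = h' (\<tau> p) (J p w)"
  have lin: "linear u" unfolding u_def by (rule D.metric_linear(1)[OF q])
  have u: "smooth_on S' u"
    using Ck_on_linear[OF D.open_S lin] by (simp add: smooth_on_def)
  have fdu: "fd u (\<tau> p) = u"
    using lin by (intro fd_eq bounded_linear_imp_has_derivative) (simp add: linear_conv_bounded_linear)
  have u\<tau>: "smooth_on W (\<lambda>q. u (\<tau> q))" by (rule smooth_pullback[OF u])
  have fdu\<tau>: "fd (\<lambda>q. u (\<tau> q)) p a = h p w a" for a
    using fd_pullback[OF p smooth_on_differentiable[OF u q]] unfolding fdu by (simp add: u_def isometry[OF p])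
  have "Rm h p x y z w = fd (\<lambda>q. u (\<tau> q)) p (C.cv p x y z)"
    by (simp add: fdu\<tau> C.Rm_eq[OF p] C.metric_sym[OF p, of w])
  also have "\<dots> = nabla_tensor2 h (hessian h (\<lambda>q. u (\<tau> q))) p x y z
      - nabla_tensor2 h (hessian h (\<lambda>q. u (\<tau> q))) p y x z"
    by (rule C.ricci_identity[OF p u\<tau>, symmetric])
  also have "\<dots> = nabla_tensor2 h' (hessian h' u) (\<tau> p) (J p x) (J p y) (J p z)
      - nabla_tensor2 h' (hessian h' u) (\<tau> p) (J p y) (J p x) (J p z)"
    using nabla_tensor2_pullback[OF p D.hessian_linear[OF _ u] D.smooth_hessian[OF u] hessian_pullback[OF _ u]]
    by simp
  also have "\<dots> = fd u (\<tau> p) (D.cv (\<tau> p) (J p x) (J p y) (J p z))"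
    by (rule D.ricci_identity[OF q u])
  also have "\<dots> = Rm h' (\<tau> p) (J p x) (J p y) (J p z) (J p w)"
    unfolding fdu by (simp add: u_def D.Rm_eq[OF q] D.metric_sym[OF q, of "J p w"])
  finally show ?thesis .
qed

text \<open>The Jacobian carries an orthonormal basis to an orthonormal basis, but not necessarily
  to the one that \<open>onb\<close> chooses in the target; independence of traces from the basis is
  used here.\<close>

lemma Ric_pullback:
  assumes p: "p \<in> W"
  shows "Ric h p y z = Ric h' (\<tau> p) (J p y) (J p z)"
proof -
  note q = \<tau>_maps[OF p]
  let ?e = "\<lambda>i. J p (onb (h p) i)"
  have "orthonormal_basis (h' (\<tau> p)) ?e"
    using onb[OF C.inner[OF p]] by (simp add: orthonormal_basis_def isometry[OF p])
  then have "Ric h' (\<tau> p) (J p y) (J p z) = (\<Sum>i\<in>UNIV. Rm h' (\<tau> p) (?e i) (J p y) (?e i) (J p z))"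
    unfolding Ric_def
    by (rule trace2_onb[OF D.inner[OF q]]) (simp add: bilinear_def D.Rm_linear[OF q])
  then show ?thesis
    by (simp add: Ric_def trace2_def Rm_pullback[OF p])
qed

end

lemma K_form_pullback:
  fixes x :: "real^'n::finite"
  assumes W: "static_chart W h" and S': "static_chart S' h'" and c: "chart_change W h S' h' \<tau>"
    and p: "p \<in> W" and n: "CARD('n) \<ge> 2" and scal: "scal h p = (real CARD('n) - 1) * lam"
    and f: "\<And>q. q \<in> S' \<Longrightarrow> (f has_derivative K_form h' q) (at q)"
    and G: "\<And>q x y. q \<in> S' \<Longrightarrow> G_tensor h' lam q x y = 0"
  shows "K_form h p x = fd (\<lambda>q. f (\<tau> q)) p x"
proof -
  interpret W: static_chart W h by fact
  interpret S': static_chart S' h' by fact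
  interpret chart_change W h S' h' \<tau> by fact
  note exp_f = S'.smooth_exp_primitive[OF f]
  have "hessian h (\<lambda>q. exp (f (\<tau> q))) q x y = exp (f (\<tau> q)) * (Ric h q x y - lam * h q x y)"
    if "q \<in> W" for q x y
    using hessian_pullback[OF that exp_f] S'.G_tensor_imp_hessian[OF \<tau>_maps[OF that] f G[OF \<tau>_maps[OF that]]]
    by (simp add: Ric_pullback[OF that] isometry[OF that])
  then have "K_form h p x = fd (\<lambda>q. exp (f (\<tau> q))) p x / exp (f (\<tau> p))"
    by (intro W.static_K_form[OF p n scal]) (simp_all add: smooth_pullback[OF exp_f])
  moreover have "f differentiable (at (\<tau> p))"
    using f[OF \<tau>_maps[OF p]] unfolding differentiable_def by blast
  then have d: "(\<lambda>q. f (\<tau> q)) differentiable (at p)"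
    using has_derivative_compose[OF fd_works[OF smooth_on_differentiable[OF smooth_\<tau> p]] fd_works]
    unfolding differentiable_def by blast
  have "fd (\<lambda>q. exp (f (\<tau> q))) p x = fd (\<lambda>q. f (\<tau> q)) p x * exp (f (\<tau> p))"
    using fd_eq[OF has_derivative_exp[OF fd_works[OF d]]] by simp
  ultimately show ?thesis by simp
qed

section \<open>Linear differential equations and closed forms\<close>

text \<open>An energy estimate: the sum of squares \<open>E\<close> satisfies E' \<le> C E, so
  \<open>E t * exp (- C * t)\<close> is nonincreasing, starts at 0 and is nonnegative.\<close>

lemma linear_ode_unique_zero:
  fixes y :: "'i::finite \<Rightarrow> real \<Rightarrow> real" and M :: "'i \<Rightarrow> 'i \<Rightarrow> real \<Rightarrow> real"
  assumes y: "\<And>i t. t \<in> {0..1} \<Longrightarrow> (y i has_real_derivative (\<Sum>j\<in>UNIV. M i j t * y j t)) (at t)"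
    and M: "\<And>i j. continuous_on {0..1} (M i j)" and y0: "\<And>i. y i 0 = 0" and t: "t \<in> {0..1}"
  shows "y i t = 0"
proof -
  have "\<exists>B. \<forall>t\<in>{0..1}. \<bar>M i j t\<bar> \<le> B" for i j
    using compact_imp_bounded[OF compact_continuous_image[OF M[of i j] compact_Icc]]
    by (auto simp: bounded_iff)
  then obtain B where B: "\<And>i j t. t \<in> {0..1} \<Longrightarrow> \<bar>M i j t\<bar> \<le> B i j"
    by metis
  \<comment> \<open>The factor 2 comes from differentiating squares. Every product of two components
    is at most \<open>E\<close> in absolute value, so the bounds of the coefficients may simply be
    added up.\<close>
  define C where "C = 2 * (\<Sum>i\<in>UNIV. \<Sum>j\<in>UNIV. B i j)"
  define E where "E t = (\<Sum>i\<in>UNIV. (y i t)\<^sup>2)" for t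
  define E' where "E' t = (\<Sum>i\<in>UNIV. 2 * y i t * (\<Sum>j\<in>UNIV. M i j t * y j t))" for t
  have E0: "E t \<ge> 0" for t by (simp add: E_def sum_nonneg)
  have yE: "\<bar>y i t\<bar> * \<bar>y j t\<bar> \<le> E t" for i j t
  proof -
    have "(y i t)\<^sup>2 \<le> E t" "(y j t)\<^sup>2 \<le> E t"
      unfolding E_def by (intro member_le_sum; simp)+
    moreover have "2 * (\<bar>y i t\<bar> * \<bar>y j t\<bar>) \<le> (y i t)\<^sup>2 + (y j t)\<^sup>2"
      using sum_squares_bound[of "\<bar>y i t\<bar>" "\<bar>y j t\<bar>"] by (simp add: mult.assoc)
    ultimately show ?thesis by simp
  qed
  have dE: "(E has_real_derivative E' t) (at t)" if "t \<in> {0..1}" for t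
    unfolding E_def E'_def
    using DERIV_power[OF y[OF that], where n = 2]
    by (intro DERIV_sum) (simp add: mult_ac)
  have E'C: "E' t \<le> C * E t" if t: "t \<in> {0..1}" for t
  proof -
    have "E' t = (\<Sum>i\<in>UNIV. \<Sum>j\<in>UNIV. 2 * (M i j t * (y i t * y j t)))"
      by (simp add: E'_def sum_distrib_left mult_ac)
    also have "\<dots> \<le> (\<Sum>i\<in>UNIV. \<Sum>j\<in>UNIV. 2 * (B i j * E t))"
    proof (intro sum_mono mult_left_mono)
      fix i j
      have "M i j t * (y i t * y j t) \<le> \<bar>M i j t\<bar> * (\<bar>y i t\<bar> * \<bar>y j t\<bar>)"
        by (metis abs_ge_self abs_mult)
      also have "\<dots> \<le> B i j * E t"
        using B[OF t, of i j] yE[of i t j] by (intro mult_mono) (auto intro: order_trans[OF abs_ge_zero])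
      finally show "M i j t * (y i t * y j t) \<le> B i j * E t" .
    qed simp
    also have "\<dots> = C * E t"
      by (simp add: C_def sum_distrib_left sum_distrib_right mult.assoc)
    finally show ?thesis .
  qed
  define g where "g t = E t * exp (- C * t)" for t
  have dg: "(g has_real_derivative (E' s - C * E s) * exp (- C * s)) (at s)" if "s \<in> {0..1}" for s
    unfolding g_def using dE[OF that]
    by (auto intro!: derivative_eq_intros simp: algebra_simps)
  have "g t \<le> g 0"
  proof (rule DERIV_nonpos_imp_nonincreasing[where f = g])
    show "\<exists>D. (g has_real_derivative D) (at s) \<and> D \<le> 0" if "0 \<le> s" "s \<le> t" for s
      using dg[of s] E'C[of s] that t by (intro exI conjI) (auto intro!: mult_nonpos_nonneg)
  qed (use t in simp)
  also have "g 0 = 0" by (simp add: g_def E_def y0)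
  finally have "E t \<le> 0" by (simp add: g_def mult_le_0_iff)
  then have "(\<Sum>i\<in>UNIV. (y i t)\<^sup>2) = 0" using E0[of t] by (simp add: E_def)
  then show ?thesis by (simp add: sum_nonneg_eq_0_iff)
qed

text \<open>On a segment from the zero, \<open>v\<close> and the components of \<open>dv\<close> (indexed by \<open>'n option\<close>) solve a linear system.\<close>

lemma (in riemannian_chart) static_zero:
  assumes p: "p \<in> S" and v: "smooth_on S v" "v p = 0" "\<And>x. fd v p x = 0"
    and H: "\<And>q x y. q \<in> S \<Longrightarrow> hessian h v q x y = v q * (Ric h q x y - lam * h q x y)"
    and e: "ball p e \<subseteq> S" and q: "q \<in> ball p e"
  shows "v q = 0"
proof -
  define x where "x = q - p"
  have c: "p + t *\<^sub>R x \<in> S" if "t \<in> {0..1}" for t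
  proof -
    have "norm (t *\<^sub>R x) \<le> norm x" using that by (simp add: mult_left_le_one_le)
    then show ?thesis using q e by (intro subsetD[OF e]) (auto simp: x_def dist_norm norm_minus_commute)
  qed
  define y :: "'n option \<Rightarrow> real \<Rightarrow> real" where
    "y i t = (case i of None \<Rightarrow> v (p + t *\<^sub>R x) | Some j \<Rightarrow> fd v (p + t *\<^sub>R x) (axis j 1))" for i t
  have yN: "y None = (\<lambda>t. v (p + t *\<^sub>R x))"
    and yS: "y (Some l) = (\<lambda>t. fd v (p + t *\<^sub>R x) (axis l 1))" for l
    by (simp_all add: y_def fun_eq_iff)
  \<comment> \<open>The first row says that v has derivative dv(x) along the segment. The row
    \<open>Some l\<close> is the Hessian equation in the directions x and \<open>axis l 1\<close>,
    solved for the second derivative of v; this brings in the Christoffel term.\<close>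
  define M :: "'n option \<Rightarrow> 'n option \<Rightarrow> real^'n \<Rightarrow> real" where
    "M i j a = (case i of
        None \<Rightarrow> (case j of None \<Rightarrow> 0 | Some k \<Rightarrow> x $ k)
      | Some l \<Rightarrow> (case j of None \<Rightarrow> Ric h a x (axis l 1) - lam * h a x (axis l 1)
                     | Some k \<Rightarrow> \<Gamma> a x (axis l 1) $ k))" for i j a
  have sum_option: "(\<Sum>i\<in>UNIV. f i) = f None + (\<Sum>k\<in>UNIV. f (Some k))" for f :: "'n option \<Rightarrow> real"
    by (simp add: UNIV_option_conv sum.reindex)
  have sM: "smooth_on S (M i j)" for i j
    unfolding M_def
    by (cases i; cases j)
       (simp_all add: smooth_on_const smooth_on_vec_nth[OF open_S smooth_christoffel]
         smooth_on_diff[OF open_S smooth_Ric smooth_on_mult[OF open_S smooth_on_const smooth]])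
  have line: "continuous_on {0..1} (\<lambda>t. p + t *\<^sub>R x)"
    by (intro continuous_intros)
  have M: "continuous_on {0..1} (\<lambda>t. M i j (p + t *\<^sub>R x))" for i j
    by (rule continuous_on_compose2[OF smooth_on_imp_continuous_on[OF sM] line]) (use c in auto)
  have ex: "fd v a u = (\<Sum>k\<in>UNIV. u $ k * fd v a (axis k 1))" if "a \<in> S" for a u
    using linear_axis_expansion[OF fd_linear[OF v(1) that]] unfolding real_scaleR_def .
  have y: "(y i has_real_derivative (\<Sum>j\<in>UNIV. M i j (p + t *\<^sub>R x) * y j t)) (at t)" if "t \<in> {0..1}" for i t
  proof (cases i)
    case None
    have "((\<lambda>t. v (p + t *\<^sub>R x)) has_real_derivative fd v (p + t *\<^sub>R x) x) (at t)"
      by (rule has_real_derivative_line[OF fd_works[OF smooth_on_differentiable[OF v(1) c[OF that]]]])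
    then show ?thesis
      unfolding sum_option by (simp add: None yN yS M_def ex[OF c[OF that], of x])
  next
    case (Some l)
    let ?a = "p + t *\<^sub>R x"
    have "((\<lambda>t. fd v (p + t *\<^sub>R x) (axis l 1)) has_real_derivative fd (\<lambda>q. fd v q (axis l 1)) ?a x) (at t)"
      by (rule has_real_derivative_line[OF fd_works[OF smooth_on_differentiable[OF smooth_on_fd[OF v(1)] c[OF that]]]])
    moreover have "fd (\<lambda>q. fd v q (axis l 1)) ?a x
        = v ?a * (Ric h ?a x (axis l 1) - lam * h ?a x (axis l 1)) + fd v ?a (\<Gamma> ?a x (axis l 1))"
      using H[OF c[OF that], of x "axis l 1"] by (simp add: hessian_eq)
    ultimately show ?thesis
      unfolding sum_option by (simp add: Some yN yS M_def ex[OF c[OF that], of "\<Gamma> ?a x _"] mult.commute)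
  qed
  have "y None 1 = 0"
    by (rule linear_ode_unique_zero[OF y M]) (auto simp: y_def v split: option.split)
  then show ?thesis by (simp add: y_def x_def)
qed

text \<open>The primitive at q is the integral of K along the radial segment from p to q,
  differentiated under the integral sign; the ball supplies the segments.\<close>

lemma poincare_ball:
  fixes K :: "real^'n::finite \<Rightarrow> real^'n \<Rightarrow> real"
  assumes lin: "\<And>q. q \<in> ball p r \<Longrightarrow> linear (K q)"
    and K: "\<And>x. smooth_on (ball p r) (\<lambda>q. K q x)"
    and closed: "\<And>q x y. q \<in> ball p r \<Longrightarrow> fd (\<lambda>q. K q y) q x = fd (\<lambda>q. K q x) q y"
  shows "\<exists>f. \<forall>q\<in>ball p r. (f has_derivative K q) (at q)"
proof -
  define c where "c q t = p + t *\<^sub>R (q - p)" for q and t :: real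
  have c: "c q t \<in> ball p r" if "q \<in> ball p r" "t \<in> {0..1}" for q t
  proof -
    have "norm (t *\<^sub>R (q - p)) \<le> norm (q - p)" using that by (simp add: mult_left_le_one_le)
    then show ?thesis using that by (simp add: c_def dist_norm norm_minus_commute)
  qed
  have cont_c: "continuous_on X (\<lambda>z. c (fst z) (snd z))" for X
    unfolding c_def by (intro continuous_intros)
  define k where "k j q = K q (axis j 1)" for j q
  have kd: "k j = (\<lambda>q. K q (axis j 1))" for j by (simp add: k_def fun_eq_iff)
  have k: "smooth_on (ball p r) (k j)" for j unfolding k_def by (rule K)
  have Kk: "K q u = (\<Sum>j\<in>UNIV. u $ j * k j q)" if "q \<in> ball p r" for q u
    using linear_axis_expansion[OF lin[OF that]] unfolding real_scaleR_def k_def .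
  define F where "F q t = (\<Sum>j\<in>UNIV. (q - p) $ j * k j (c q t))" for q t
  define F' where "F' q t = (\<lambda>u. \<Sum>j\<in>UNIV. (q - p) $ j * fd (k j) (c q t) (t *\<^sub>R u) + u $ j * k j (c q t))" for q t
  have dF: "((\<lambda>q. F q t) has_derivative F' q t) (at q)" if "q \<in> ball p r" "t \<in> {0..1}" for q t
  proof -
    have dc: "((\<lambda>q. c q t) has_derivative (\<lambda>u. t *\<^sub>R u)) (at q)"
      unfolding c_def by (auto intro!: derivative_eq_intros)
    have dn: "((\<lambda>q. (q - p) $ j) has_derivative (\<lambda>u. u $ j)) (at q)" for j
    proof -
      have "((\<lambda>q. q - p) has_derivative (\<lambda>u. u)) (at q)"
        by (auto intro!: derivative_eq_intros)
      from bounded_linear.has_derivative[OF bounded_linear_vec_nth this] show ?thesis .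
    qed
    show ?thesis
      unfolding F_def F'_def
      by (intro has_derivative_sum has_derivative_mult dn has_derivative_compose[OF dc]
          fd_works[OF smooth_on_differentiable[OF k]] c that)
  qed
  have bl: "bounded_linear (F' q t)" if "q \<in> ball p r" "t \<in> {0..1}" for q t
    using has_derivative_bounded_linear[OF dF[OF that]] .
  have cont_k: "continuous_on (ball p r \<times> {0..1}) (\<lambda>z. k j (c (fst z) (snd z)))" for j
    by (rule continuous_on_compose2[OF smooth_on_imp_continuous_on[OF k] cont_c]) (use c in auto)
  have cont_dk: "continuous_on (ball p r \<times> {0..1}) (\<lambda>z. fd (k j) (c (fst z) (snd z)) u)" for j u
    by (rule continuous_on_compose2[OF smooth_on_imp_continuous_on[OF smooth_on_fd[OF k]] cont_c]) (use c in auto)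
  have scale: "fd (k j) (c q t) (t *\<^sub>R u) = t * fd (k j) (c q t) u" if "q \<in> ball p r" "t \<in> {0..1}" for j q t u
    using linear_scale[OF linear_fd[OF smooth_on_differentiable[OF k c[OF that]]]] by simp
  \<comment> \<open>\<open>leibniz_rule\<close> wants the derivative as a continuous map into the
    space of operators; in finite dimension continuity on each basis vector is enough.\<close>
  have cont_F': "continuous_on (ball p r \<times> cbox 0 1) (\<lambda>(q, t). Blinfun (F' q t))"
  proof (rule continuous_on_blinfun_componentwise)
    fix b :: "real^'n"
    have eq: "(\<Sum>j\<in>UNIV. (q - p) $ j * (t * fd (k j) (c q t) b) + b $ j * k j (c q t))
        = blinfun_apply (Blinfun (F' q t)) b" if "q \<in> ball p r" "t \<in> {0..1}" for q t
      by (subst bounded_linear_Blinfun_apply[OF bl[OF that]]) (simp only: F'_def scale[OF that])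
    have "continuous_on (ball p r \<times> {0..1}) (\<lambda>z. \<Sum>j\<in>UNIV. (fst z - p) $ j * (snd z * fd (k j) (c (fst z) (snd z)) b) + b $ j * k j (c (fst z) (snd z)))"
      by (intro continuous_intros cont_k cont_dk)
    then show "continuous_on (ball p r \<times> cbox 0 1) (\<lambda>x. blinfun_apply (case x of (q, t) \<Rightarrow> Blinfun (F' q t)) b)"
      unfolding box_real by (rule continuous_on_eq) (clarify, simp only: fst_conv snd_conv prod.case eq)
  qed
  have "((\<lambda>q. integral (cbox 0 1) (F q)) has_derivative K q) (at q)" if q: "q \<in> ball p r" for q
  proof -
    have pair: "continuous_on {0..1} (\<lambda>t::real. (q, t))" for q :: "real^'n"
      by (intro continuous_intros)
    have sub: "(\<lambda>t. (q, t)) ` {0..1} \<subseteq> ball p r \<times> {0..1}" if "q \<in> ball p r" for q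
      using that by auto
    have int: "F q integrable_on cbox 0 1" if "q \<in> ball p r" for q
    proof -
      have "continuous_on {0..1} (\<lambda>t. k j (c q t))" for j
        using continuous_on_compose2[OF cont_k pair sub[OF that]] by simp
      then have "continuous_on {0..1} (F q)"
        unfolding F_def by (intro continuous_intros)
      then show ?thesis unfolding box_real by (rule integrable_continuous_real)
    qed
    have "((\<lambda>q. integral (cbox 0 1) (F q)) has_derivative
        blinfun_apply (integral (cbox 0 1) (\<lambda>t. Blinfun (F' q t)))) (at q within ball p r)"
    proof (rule leibniz_rule[OF _ int cont_F' q convex_ball])
      show "((\<lambda>q. F q t) has_derivative blinfun_apply (Blinfun (F' q t))) (at q within ball p r)"
        if "q \<in> ball p r" "t \<in> cbox 0 1" for q t
        using dF[of q t] that by (simp add: bounded_linear_Blinfun_apply bl has_derivative_at_withinI)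
    qed
    then have D: "((\<lambda>q. integral (cbox 0 1) (F q)) has_derivative
        blinfun_apply (integral (cbox 0 1) (\<lambda>t. Blinfun (F' q t)))) (at q)"
      unfolding at_within_open[OF q open_ball] .
    have "blinfun_apply (integral (cbox 0 1) (\<lambda>t. Blinfun (F' q t))) u = K q u" for u
    proof -
      have "continuous_on {0..1} (\<lambda>t. Blinfun (F' q t))"
        using continuous_on_compose2[OF cont_F'[unfolded box_real] pair sub[OF q]] by simp
      then have "(\<lambda>t. Blinfun (F' q t)) integrable_on {0..1}"
        by (rule integrable_continuous_real)
      then have "blinfun_apply (integral (cbox 0 1) (\<lambda>t. Blinfun (F' q t))) u
          = integral {0..1} (\<lambda>t. blinfun_apply (Blinfun (F' q t)) u)"
        using integral_linear[OF _ blinfun.bounded_linear_left[of u], of "\<lambda>t. Blinfun (F' q t)" "{0..1}"]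
        by (simp add: o_def)
      also have "\<dots> = integral {0..1} (\<lambda>t. F' q t u)"
        by (rule integral_cong) (simp add: bounded_linear_Blinfun_apply[OF bl[OF q]])
      also have "\<dots> = K q u"
      proof (rule integral_unique)
        \<comment> \<open>Closedness exchanges u and q - p in the derivative of K. This makes the
          integrand the derivative of \<open>t * K (c q t) u\<close>, which runs from 0 to
          \<open>K q u\<close>.\<close>
        have d: "((\<lambda>t. t * K (c q t) u) has_vector_derivative F' q t u) (at t within {0..1})" if t: "t \<in> {0..1}" for t
        proof -
          have "((\<lambda>t. K (p + t *\<^sub>R (q - p)) u) has_real_derivative fd (\<lambda>q. K q u) (c q t) (q - p)) (at t)"
            by (rule has_real_derivative_line)
               (use fd_works[OF smooth_on_differentiable[OF K c[OF q t]]] in \<open>simp add: c_def\<close>)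
          then have "((\<lambda>t. t * K (c q t) u) has_real_derivative
              K (c q t) u + fd (\<lambda>q. K q u) (c q t) (q - p) * t) (at t)"
            using DERIV_mult[OF DERIV_ident] unfolding c_def by fastforce
          moreover have "fd (\<lambda>q. K q u) (c q t) (q - p) = fd (\<lambda>a. K a (q - p)) (c q t) u"
            by (rule closed[OF c[OF q t]])
          moreover have "fd (\<lambda>a. K a (q - p)) (c q t) u = (\<Sum>j\<in>UNIV. (q - p) $ j * fd (k j) (c q t) u)"
            using linear_axis_expansion[OF linear_fd_lin_field[OF open_ball c[OF q t] lin smooth_on_differentiable[OF K c[OF q t]]], of "q - p" u]
            unfolding kd real_scaleR_def .
          ultimately have "((\<lambda>t. t * K (c q t) u) has_real_derivative F' q t u) (at t)"
            by (simp add: F'_def scale[OF q t] sum.distrib Kk[OF c[OF q t], of u] sum_distrib_left mult_ac add.commute)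
          then show ?thesis
            by (simp add: has_real_derivative_iff_has_vector_derivative has_vector_derivative_at_within)
        qed
        have "((\<lambda>t. F' q t u) has_integral (1 * K (c q 1) u - 0 * K (c q 0) u)) {0..1}"
          by (rule fundamental_theorem_of_calculus[OF _ d]) auto
        then show "((\<lambda>t. F' q t u) has_integral K q u) {0..1}" by (simp add: c_def)
      qed
      finally show ?thesis .
    qed
    then have "blinfun_apply (integral (cbox 0 1) (\<lambda>t. Blinfun (F' q t))) = K q" by (rule ext)
    with D show ?thesis by (rule has_derivative_eq_rhs)
  qed
  then show ?thesis by blast
qed

section \<open>Primitives on simply connected spaces\<close>

text \<open>Forms and derivatives are forgotten: \<open>L U f\<close> says that f is an admissible
  primitive on U, and two such functions differ by a locally constant one. Their translates by
  constants are the local sections of a covering with the discrete reals as fibre, and what follows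
  shows that this covering has a global section over a simply connected space.\<close>

locale local_primitives =
  fixes L :: "'m::topological_space set \<Rightarrow> ('m \<Rightarrow> real) \<Rightarrow> bool"
  assumes L_cover: "\<exists>U f. L U f \<and> m \<in> U"
    and L_open: "L U f \<Longrightarrow> open U"
    and L_path_connected: "L U f \<Longrightarrow> path_connected U"
    and L_overlap: "L U f \<Longrightarrow> L V g \<Longrightarrow> m \<in> U \<Longrightarrow> m \<in> V \<Longrightarrow>
      \<exists>N. open N \<and> m \<in> N \<and> (\<forall>x\<in>N. f x - g x = f m - g m)"
begin

text \<open>\<open>\<phi>\<close> is a primitive along the map \<open>H\<close>, i.e. a section of the pulled back covering.\<close>

definition primitive_along :: "('x::topological_space \<Rightarrow> 'm) \<Rightarrow> 'x set \<Rightarrow> ('x \<Rightarrow> real) \<Rightarrow> bool" where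
  "primitive_along H T \<phi> \<longleftrightarrow> (\<forall>x\<in>T. \<forall>U f. L U f \<longrightarrow> H x \<in> U \<longrightarrow>
     (\<exists>N. open N \<and> x \<in> N \<and> (\<forall>y\<in>N \<inter> T. \<phi> y - f (H y) = \<phi> x - f (H x))))"

lemma primitive_alongD:
  assumes "primitive_along H T \<phi>" "x \<in> T" "L U f" "H x \<in> U"
  shows "\<exists>N. open N \<and> x \<in> N \<and> (\<forall>y\<in>N \<inter> T. \<phi> y - f (H y) = \<phi> x - f (H x))"
  using assms(1)[unfolded primitive_along_def, rule_format, OF assms(2-4)] .

lemma primitive_along_cong:
  assumes "primitive_along H T \<phi>" "\<And>x. x \<in> T \<Longrightarrow> H x = H' x"
  shows "primitive_along H' T \<phi>"
  unfolding primitive_along_def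
proof (intro ballI allI impI)
  fix x U f assume x: "x \<in> T" "L U f" "H' x \<in> U"
  then have "H x \<in> U" using assms(2) by simp
  then obtain N where N: "open N" "x \<in> N" "\<forall>y\<in>N \<inter> T. \<phi> y - f (H y) = \<phi> x - f (H x)"
    using primitive_alongD[OF assms(1) x(1,2)] by blast
  show "\<exists>N. open N \<and> x \<in> N \<and> (\<forall>y\<in>N \<inter> T. \<phi> y - f (H' y) = \<phi> x - f (H' x))"
  proof (intro exI[of _ N] conjI ballI)
    show "\<phi> y - f (H' y) = \<phi> x - f (H' x)" if "y \<in> N \<inter> T" for y
    proof -
      have "y \<in> T" using that by blast
      from assms(2)[OF this] assms(2)[OF x(1)] show ?thesis using bspec[OF N(3) that] by simp
    qed
  qed (fact N)+
qed

lemma primitive_along_pullback: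
  fixes u :: "'y::topological_space \<Rightarrow> 'x::topological_space"
  assumes \<phi>: "primitive_along H T \<phi>" and u: "continuous_on T' u" "u ` T' \<subseteq> T"
  shows "primitive_along (\<lambda>y. H (u y)) T' (\<lambda>y. \<phi> (u y))"
  unfolding primitive_along_def
proof (intro ballI allI impI)
  fix x U f assume x: "x \<in> T'" "L U f" "H (u x) \<in> U"
  have ux: "u x \<in> T" using u(2) x(1) by blast
  obtain N where N: "open N" "u x \<in> N" "\<forall>y\<in>N \<inter> T. \<phi> y - f (H y) = \<phi> (u x) - f (H (u x))"
    using primitive_alongD[OF \<phi> ux x(2,3)] by blast
  obtain N' where N': "open N'" "N' \<inter> T' = u -` N \<inter> T'"
    using u(1) N(1) unfolding continuous_on_open_invariant by blast
  show "\<exists>N. open N \<and> x \<in> N \<and> (\<forall>y\<in>N \<inter> T'. \<phi> (u y) - f (H (u y)) = \<phi> (u x) - f (H (u x)))"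
  proof (intro exI conjI ballI)
    show "x \<in> N'" using N' N(2) x(1) by blast
    show "\<phi> (u y) - f (H (u y)) = \<phi> (u x) - f (H (u x))" if "y \<in> N' \<inter> T'" for y
      using that N'(2) u(2) N(3) by blast
  qed (rule N'(1))
qed

text \<open>Near each point both sections are compared with the same local primitive f, so their
  difference is locally constant.\<close>

lemma primitive_along_unique:
  fixes T :: "'x::topological_space set"
  assumes \<phi>: "primitive_along H T \<phi>" and \<psi>: "primitive_along H T \<psi>" and T: "connected T"
    and xy: "x \<in> T" "y \<in> T"
  shows "\<phi> x - \<psi> x = \<phi> y - \<psi> y"
proof -
  have "(\<lambda>x. \<phi> x - \<psi> x) constant_on T"
  proof (rule locally_constant_imp_constant[OF T])
    fix x assume x: "x \<in> T"
    obtain U f where U: "L U f" "H x \<in> U" using L_cover by blast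
    obtain N1 where N1: "open N1" "x \<in> N1" "\<forall>y\<in>N1 \<inter> T. \<phi> y - f (H y) = \<phi> x - f (H x)"
      using primitive_alongD[OF \<phi> x U] by blast
    obtain N2 where N2: "open N2" "x \<in> N2" "\<forall>y\<in>N2 \<inter> T. \<psi> y - f (H y) = \<psi> x - f (H x)"
      using primitive_alongD[OF \<psi> x U] by blast
    show "\<exists>A. openin (top_of_set T) A \<and> x \<in> A \<and> (\<forall>y\<in>A. \<phi> y - \<psi> y = \<phi> x - \<psi> x)"
    proof (intro exI[of _ "T \<inter> (N1 \<inter> N2)"] conjI ballI)
      show "openin (top_of_set T) (T \<inter> (N1 \<inter> N2))" using N1(1) N2(1) by (simp add: openin_open_Int open_Int)
      show "\<phi> y - \<psi> y = \<phi> x - \<psi> x" if "y \<in> T \<inter> (N1 \<inter> N2)" for y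
      proof -
        have "\<phi> y - f (H y) = \<phi> x - f (H x)" "\<psi> y - f (H y) = \<psi> x - f (H x)"
          using N1(3) N2(3) that by blast+
        then show ?thesis by simp
      qed
    qed (use x N1 N2 in auto)
  qed
  then show ?thesis using xy unfolding constant_on_def by metis
qed

lemma primitive_along_local:
  assumes H: "continuous_on T H" and U: "L U f" "H ` T \<subseteq> U"
  shows "primitive_along H T (\<lambda>x. f (H x))"
  unfolding primitive_along_def
proof (intro ballI allI impI)
  fix x V g assume x: "x \<in> T" and V: "L V g" "H x \<in> V"
  have Hx: "H x \<in> U" using U(2) x by blast
  obtain N where N: "open N" "H x \<in> N" "\<forall>m\<in>N. f m - g m = f (H x) - g (H x)"
    using L_overlap[OF U(1) V(1) Hx V(2)] by blast
  obtain N' where N': "open N'" "N' \<inter> T = H -` N \<inter> T"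
    using H N(1) unfolding continuous_on_open_invariant by blast
  show "\<exists>N. open N \<and> x \<in> N \<and> (\<forall>y\<in>N \<inter> T. f (H y) - g (H y) = f (H x) - g (H x))"
  proof (intro exI[of _ N'] conjI ballI)
    show "x \<in> N'" using N(2) N'(2) x by blast
    show "f (H y) - g (H y) = f (H x) - g (H x)" if "y \<in> N' \<inter> T" for y
      by (rule bspec[OF N(3)]) (use that N'(2) in blast)
  qed (fact N'(1))
qed

text \<open>The pieces are closed, like the rectangles of a subdivision; near a point outside one of
  them only the other matters. Since the intersection is connected, one additive constant, read off
  at \<open>x0\<close>, matches the two primitives on all of it.\<close>

lemma primitive_along_glue:
  assumes \<phi>: "primitive_along H S \<phi>" and \<psi>: "primitive_along H T \<psi>"
    and closed: "closed S" "closed T" and conn: "connected (S \<inter> T)" and x0: "x0 \<in> S \<inter> T"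
  shows "\<exists>\<theta>. primitive_along H (S \<union> T) \<theta>"
proof -
  define \<psi>' where "\<psi>' x = \<psi> x + (\<phi> x0 - \<psi> x0)" for x
  define \<theta> where "\<theta> x = (if x \<in> S then \<phi> x else \<psi>' x)" for x
  have \<psi>': "primitive_along H T \<psi>'"
    using \<psi> unfolding primitive_along_def \<psi>'_def by (simp add: algebra_simps)
  have restrict: "primitive_along H (S \<inter> T) \<phi>" "primitive_along H (S \<inter> T) \<psi>'"
    using primitive_along_pullback[OF \<phi>, of "S \<inter> T" "\<lambda>x. x"]
      primitive_along_pullback[OF \<psi>', of "S \<inter> T" "\<lambda>x. x"] by auto
  have agree: "\<phi> x = \<psi>' x" if "x \<in> S \<inter> T" for x
    using primitive_along_unique[OF restrict conn that x0] by (simp add: \<psi>'_def)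
  then have \<theta>T: "\<theta> x = \<psi>' x" if "x \<in> T" for x using that by (simp add: \<theta>_def)
  have \<theta>S: "\<theta> x = \<phi> x" if "x \<in> S" for x using that by (simp add: \<theta>_def)
  have "primitive_along H (S \<union> T) \<theta>"
    unfolding primitive_along_def
  proof (intro ballI allI impI)
    fix x U f assume x: "x \<in> S \<union> T" and U: "L U f" "H x \<in> U"
    have "\<exists>N. open N \<and> x \<in> N \<and> (\<forall>y\<in>N. y \<in> S \<longrightarrow> \<theta> y - f (H y) = \<theta> x - f (H x))"
    proof (cases "x \<in> S")
      case True
      obtain N where N: "open N" "x \<in> N" "\<forall>y\<in>N \<inter> S. \<phi> y - f (H y) = \<phi> x - f (H x)"
        using primitive_alongD[OF \<phi> True U] by blast
      show ?thesis
      proof (intro exI[of _ N] conjI ballI impI)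
        show "\<theta> y - f (H y) = \<theta> x - f (H x)" if "y \<in> N" "y \<in> S" for y
          unfolding \<theta>S[OF that(2)] \<theta>S[OF True] by (rule bspec[OF N(3)]) (use that in blast)
      qed (fact N)+
    next
      case False
      then show ?thesis using closed(1) by (intro exI[of _ "- S"]) auto
    qed
    moreover have "\<exists>N. open N \<and> x \<in> N \<and> (\<forall>y\<in>N. y \<in> T \<longrightarrow> \<theta> y - f (H y) = \<theta> x - f (H x))"
    proof (cases "x \<in> T")
      case True
      obtain N where N: "open N" "x \<in> N" "\<forall>y\<in>N \<inter> T. \<psi>' y - f (H y) = \<psi>' x - f (H x)"
        using primitive_alongD[OF \<psi>' True U] by blast
      show ?thesis
      proof (intro exI[of _ N] conjI ballI impI)
        show "\<theta> y - f (H y) = \<theta> x - f (H x)" if "y \<in> N" "y \<in> T" for y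
          unfolding \<theta>T[OF that(2)] \<theta>T[OF True] by (rule bspec[OF N(3)]) (use that in blast)
      qed (fact N)+
    next
      case False
      then show ?thesis using closed(2) by (intro exI[of _ "- T"]) auto
    qed
    ultimately obtain N1 N2 where "open N1" "x \<in> N1" "\<forall>y\<in>N1. y \<in> S \<longrightarrow> \<theta> y - f (H y) = \<theta> x - f (H x)"
      "open N2" "x \<in> N2" "\<forall>y\<in>N2. y \<in> T \<longrightarrow> \<theta> y - f (H y) = \<theta> x - f (H x)"
      by blast
    then show "\<exists>N. open N \<and> x \<in> N \<and> (\<forall>y\<in>N \<inter> (S \<union> T). \<theta> y - f (H y) = \<theta> x - f (H x))"
      by (intro exI[of _ "N1 \<inter> N2"]) auto
  qed
  then show ?thesis by blast
qed

text \<open>Bisection takes the place of a Lebesgue number. \<open>Bolzano\<close> in the second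
  coordinate gives primitives on all sufficiently narrow strips around a given first coordinate, and
  \<open>Bolzano\<close> in the first coordinate assembles the strips. Adjacent pieces meet in an
  edge, which is connected, as gluing requires.\<close>

lemma primitive_along_square:
  fixes H :: "real \<times> real \<Rightarrow> 'm"
  assumes H: "continuous_on ({0..1} \<times> {0..1}) H"
  shows "\<exists>\<phi>. primitive_along H ({0..1} \<times> {0..1}) \<phi>"
proof -
  have strip: "\<exists>\<delta>>0. \<forall>a b. a \<le> x \<and> x \<le> b \<and> b - a < \<delta> \<and> {a..b} \<subseteq> {0..1} \<longrightarrow>
      (\<exists>\<phi>. primitive_along H ({a..b} \<times> {0..1}) \<phi>)" if x: "x \<in> {0..1}" for x
  proof -
    \<comment> \<open>The local condition of \<open>Bolzano\<close> concerns all short intervals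
      around a point, including those that leave the unit interval; hence the intersection with
      \<open>{0..1}\<close>, here and in \<open>P\<close> below.\<close>
    define Q where "Q c d \<longleftrightarrow> (\<exists>\<delta>>0. \<forall>a b. a \<le> x \<and> x \<le> b \<and> b - a < \<delta> \<and> {a..b} \<subseteq> {0..1} \<longrightarrow>
      (\<exists>\<phi>. primitive_along H ({a..b} \<times> ({c..d} \<inter> {0..1})) \<phi>))" for c d
    have "Q 0 1"
    proof (rule Bolzano[of 0 1 Q])
      fix c d e :: real assume Q: "Q c d" "Q d e" and le: "c \<le> d" "d \<le> e"
      obtain \<delta>1 where \<delta>1: "\<delta>1 > 0" "\<And>a b. a \<le> x \<Longrightarrow> x \<le> b \<Longrightarrow> b - a < \<delta>1 \<Longrightarrow> {a..b} \<subseteq> {0..1} \<Longrightarrow>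
          \<exists>\<phi>. primitive_along H ({a..b} \<times> ({c..d} \<inter> {0..1})) \<phi>"
        using Q(1) unfolding Q_def by blast
      obtain \<delta>2 where \<delta>2: "\<delta>2 > 0" "\<And>a b. a \<le> x \<Longrightarrow> x \<le> b \<Longrightarrow> b - a < \<delta>2 \<Longrightarrow> {a..b} \<subseteq> {0..1} \<Longrightarrow>
          \<exists>\<phi>. primitive_along H ({a..b} \<times> ({d..e} \<inter> {0..1})) \<phi>"
        using Q(2) unfolding Q_def by blast
      have "\<exists>\<phi>. primitive_along H ({a..b} \<times> ({c..e} \<inter> {0..1})) \<phi>"
        if ab: "a \<le> x" "x \<le> b" "b - a < min \<delta>1 \<delta>2" "{a..b} \<subseteq> {0..1}" for a b
      proof -
        let ?S = "{a..b} \<times> ({c..d} \<inter> {0..1})" and ?T = "{a..b} \<times> ({d..e} \<inter> {0..1})"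
        obtain \<phi> \<psi> where p: "primitive_along H ?S \<phi>" "primitive_along H ?T \<psi>"
          using \<delta>1(2)[of a b] \<delta>2(2)[of a b] ab by auto
        have un: "{a..b} \<times> ({c..e} \<inter> {0..1}) = ?S \<union> ?T" using le by auto
        show ?thesis
        proof (cases "d \<in> {0..1}")
          case True
          have int: "?S \<inter> ?T = {a..b} \<times> {d}" using le True by auto
          have conn: "connected (?S \<inter> ?T)" unfolding int by (intro connected_Times) auto
          show ?thesis unfolding un
            by (rule primitive_along_glue[OF p _ _ conn, of "(x, d)"])
               (use le True ab in \<open>auto intro!: closed_Times closed_Int\<close>)
        next
          case False
          \<comment> \<open>If the common endpoint lies outside the unit interval, one of the two
            pieces is empty.\<close>
          then have "?S \<union> ?T = ?S \<or> ?S \<union> ?T = ?T" using le by auto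
          then show ?thesis using p un by metis
        qed
      qed
      then show "Q c e" unfolding Q_def using \<delta>1(1) \<delta>2(1)
        by (intro exI[of _ "min \<delta>1 \<delta>2"]) auto
    next
      fix y :: real assume "0 \<le> y" "y \<le> 1"
      then have xy: "(x, y) \<in> {0..1} \<times> {0..1}" using x by simp
      obtain U f where U: "L U f" "H (x, y) \<in> U" using L_cover by blast
      obtain N where N: "open N" "N \<inter> ({0..1} \<times> {0..1}) = H -` U \<inter> ({0..1} \<times> {0..1})"
        using H L_open[OF U(1)] unfolding continuous_on_open_invariant by blast
      then have "(x, y) \<in> N" using U(2) xy by blast
      then obtain \<epsilon> where \<epsilon>: "\<epsilon> > 0" "ball (x, y) \<epsilon> \<subseteq> N" using N(1) openE by blast
      \<comment> \<open>Half of \<open>\<epsilon>\<close> for each coordinate keeps the rectangle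
        within distance \<open>\<epsilon>\<close> of (x, y), so H maps it into the domain of a
        single local primitive.\<close>
      have "Q c d" if cd: "c \<le> y" "y \<le> d" "d - c < \<epsilon> / 2" for c d
        unfolding Q_def
      proof (intro exI[of _ "\<epsilon> / 2"] conjI allI impI)
        fix a b assume ab: "a \<le> x \<and> x \<le> b \<and> b - a < \<epsilon> / 2 \<and> {a..b} \<subseteq> {0..1}"
        let ?R = "{a..b} \<times> ({c..d} \<inter> {0..1})"
        have "z \<in> ball (x, y) \<epsilon>" if z: "z \<in> ?R" for z
        proof -
          have "a \<le> fst z" "fst z \<le> b" "c \<le> snd z" "snd z \<le> d" using z by auto
          with ab cd have "\<bar>x - fst z\<bar> < \<epsilon> / 2" "\<bar>y - snd z\<bar> < \<epsilon> / 2" by linarith+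
          moreover have "dist (x, y) z \<le> \<bar>x - fst z\<bar> + \<bar>y - snd z\<bar>"
            using sqrt_sum_squares_le_sum_abs[of "x - fst z" "y - snd z"]
            by (simp add: dist_prod_def dist_real_def)
          ultimately show ?thesis by (simp add: mem_ball)
        qed
        then have R: "?R \<subseteq> N" "?R \<subseteq> {0..1} \<times> {0..1}" using \<epsilon>(2) ab by auto
        then have "H ` ?R \<subseteq> U" using N(2) by blast
        then show "\<exists>\<phi>. primitive_along H ?R \<phi>"
          using primitive_along_local[OF continuous_on_subset[OF H R(2)] U(1)] by blast
      qed (use \<epsilon> in simp)
      then show "\<exists>d>0. \<forall>a b. a \<le> y \<and> y \<le> b \<and> b - a < d \<longrightarrow> Q a b"
        using \<epsilon>(1) by (intro exI[of _ "\<epsilon> / 2"]) auto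
    qed simp
    then show ?thesis unfolding Q_def by simp
  qed
  define P where "P a b \<longleftrightarrow> (\<exists>\<phi>. primitive_along H (({a..b} \<inter> {0..1}) \<times> {0..1}) \<phi>)" for a b
  have "P 0 1"
  proof (rule Bolzano[of 0 1 P])
    fix a b c :: real assume P: "P a b" "P b c" and le: "a \<le> b" "b \<le> c"
    let ?S = "({a..b} \<inter> {0..1}) \<times> {0..1::real}" and ?T = "({b..c} \<inter> {0..1}) \<times> {0..1::real}"
    obtain \<phi> \<psi> where p: "primitive_along H ?S \<phi>" "primitive_along H ?T \<psi>"
      using P unfolding P_def by blast
    have un: "({a..c} \<inter> {0..1}) \<times> {0..1} = ?S \<union> ?T" using le by auto
    show "P a c"
    proof (cases "b \<in> {0..1}")
      case True
      have int: "?S \<inter> ?T = {b} \<times> {0..1}" using le True by auto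
      have conn: "connected (?S \<inter> ?T)" unfolding int by (intro connected_Times) auto
      show ?thesis unfolding P_def un
        by (rule primitive_along_glue[OF p _ _ conn, of "(b, 0)"])
           (use le True in \<open>auto intro!: closed_Times closed_Int\<close>)
    next
      case False
      then have "?S \<union> ?T = ?S \<or> ?S \<union> ?T = ?T" using le by auto
      then show ?thesis using p un unfolding P_def by metis
    qed
  next
    fix x :: real assume x: "0 \<le> x" "x \<le> 1"
    then obtain \<delta> where \<delta>: "\<delta> > 0" "\<And>a b. a \<le> x \<Longrightarrow> x \<le> b \<Longrightarrow> b - a < \<delta> \<Longrightarrow> {a..b} \<subseteq> {0..1} \<Longrightarrow>
        \<exists>\<phi>. primitive_along H ({a..b} \<times> {0..1}) \<phi>"
      using strip[of x] by auto
    have "P a b" if "a \<le> x" "x \<le> b" "b - a < \<delta>" for a b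
    proof -
      have "{a..b} \<inter> {0..1} = {max a 0..min b 1}" by auto
      then show ?thesis
        using \<delta>(2)[of "max a 0" "min b 1"] that x unfolding P_def by auto
    qed
    then show "\<exists>d>0. \<forall>a b. a \<le> x \<and> x \<le> b \<and> b - a < d \<longrightarrow> P a b"
      using \<delta>(1) by blast
  qed simp
  then show ?thesis unfolding P_def by simp
qed

text \<open>A path is a map of the square that ignores the first coordinate; restricting to an edge
  recovers it.\<close>

lemma primitive_along_path:
  assumes "path \<gamma>"
  shows "\<exists>\<phi>. primitive_along \<gamma> {0..1} \<phi>"
proof -
  have "continuous_on ({0..1} \<times> {0..1}) (\<lambda>z::real \<times> real. \<gamma> (snd z))"
    using assms unfolding path_def
    by (rule continuous_on_compose2[OF _ continuous_on_snd[OF continuous_on_id]]) auto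
  then obtain \<phi> where "primitive_along (\<lambda>z::real \<times> real. \<gamma> (snd z)) ({0..1} \<times> {0..1}) \<phi>"
    using primitive_along_square by blast
  then have "primitive_along (\<lambda>t. \<gamma> (snd (0::real, t))) {0..1} (\<lambda>t. \<phi> (0, t))"
    by (rule primitive_along_pullback) (auto intro!: continuous_intros)
  then show ?thesis by auto
qed

text \<open>Take a primitive \<open>\<Phi>\<close> along a homotopy through loops to a constant
  loop. On the constant edge \<open>\<Phi>\<close> is constant. The other two edges trace out the
  same path of base points, so \<open>\<Phi>\<close> has equal increments along them. Hence the
  increment along the original loop is zero.\<close>

lemma primitive_along_loop:
  assumes sc: "simply_connected (UNIV :: 'm set)" and \<gamma>: "path \<gamma>" "pathfinish \<gamma> = pathstart \<gamma>"
    and \<phi>: "primitive_along \<gamma> {0..1} \<phi>"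
  shows "\<phi> 1 = \<phi> 0"
proof -
  have "homotopic_loops UNIV \<gamma> (\<lambda>_. pathstart \<gamma>)"
    using sc \<gamma> unfolding simply_connected_def
    by (simp add: path_def pathstart_def pathfinish_def)
  then obtain h where h: "continuous_on ({0..1::real} \<times> {0..1::real}) h"
    "\<And>t. t \<in> {0..1} \<Longrightarrow> h (0, t) = \<gamma> t" "\<And>t. t \<in> {0..1} \<Longrightarrow> h (1, t) = pathstart \<gamma>"
    "\<And>s. s \<in> {0..1} \<Longrightarrow> h (s, 1) = h (s, 0)"
    unfolding homotopic_loops by (auto simp: pathstart_def pathfinish_def)
  obtain \<Phi> where \<Phi>: "primitive_along h ({0..1} \<times> {0..1}) \<Phi>"
    using primitive_along_square[OF h(1)] by blast
  have edge: "primitive_along (\<lambda>t. h (u t)) {0..1} (\<lambda>t. \<Phi> (u t))"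
    if "continuous_on {0..1} u" "u ` {0..1} \<subseteq> {0..1} \<times> {0..1}" for u :: "real \<Rightarrow> real \<times> real"
    by (rule primitive_along_pullback[OF \<Phi> that])
  have bottom: "primitive_along \<gamma> {0..1} (\<lambda>t. \<Phi> (0, t))"
    by (rule primitive_along_cong[OF edge]) (auto simp: h intro!: continuous_intros)
  have top: "primitive_along (\<lambda>_. pathstart \<gamma>) {0..1} (\<lambda>t. \<Phi> (1, t))"
    by (rule primitive_along_cong[OF edge]) (auto simp: h intro!: continuous_intros)
  have left: "primitive_along (\<lambda>s. h (s, 0)) {0..1} (\<lambda>s. \<Phi> (s, 0))"
    by (rule edge) (auto intro!: continuous_intros)
  have right: "primitive_along (\<lambda>s. h (s, 0)) {0..1} (\<lambda>s. \<Phi> (s, 1))"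
    by (rule primitive_along_cong[OF edge]) (auto simp: h intro!: continuous_intros)
  have const: "primitive_along (\<lambda>_. pathstart \<gamma>) {0..1::real} (\<lambda>_. 0)"
    unfolding primitive_along_def by auto
  have "\<Phi> (1, 0) = \<Phi> (1, 1)"
    using primitive_along_unique[OF top const, of 0 1] by simp
  then have "\<Phi> (0, 0) = \<Phi> (0, 1)"
    using primitive_along_unique[OF left right, of 0 1] by simp
  then show ?thesis
    using primitive_along_unique[OF \<phi> bottom, of 0 1] by simp
qed

text \<open>Restricted to either half and reparametrized, a primitive along the joined path differs
  from the given one by a constant, so increments add.\<close>

lemma primitive_along_join:
  assumes \<theta>: "primitive_along (\<gamma> +++ \<sigma>) {0..1} \<theta>" and join: "pathfinish \<gamma> = pathstart \<sigma>"
    and \<phi>: "primitive_along \<gamma> {0..1} \<phi>" and \<psi>: "primitive_along \<sigma> {0..1} \<psi>"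
  shows "\<theta> 1 - \<theta> 0 = (\<phi> 1 - \<phi> 0) + (\<psi> 1 - \<psi> 0)"
proof -
  have "primitive_along (\<lambda>t. (\<gamma> +++ \<sigma>) (t / 2)) {0..1} (\<lambda>t. \<theta> (t / 2))"
    by (rule primitive_along_pullback[OF \<theta>]) (auto intro!: continuous_intros)
  then have "primitive_along \<gamma> {0..1} (\<lambda>t. \<theta> (t / 2))"
    by (rule primitive_along_cong) (simp add: joinpaths_def)
  from primitive_along_unique[OF this \<phi>, of 0 1] have 1: "\<theta> (1 / 2) - \<theta> 0 = \<phi> 1 - \<phi> 0" by simp
  have "primitive_along (\<lambda>t. (\<gamma> +++ \<sigma>) ((t + 1) / 2)) {0..1} (\<lambda>t. \<theta> ((t + 1) / 2))"
    by (rule primitive_along_pullback[OF \<theta>]) (auto intro!: continuous_intros)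
  then have "primitive_along \<sigma> {0..1} (\<lambda>t. \<theta> ((t + 1) / 2))"
  proof (rule primitive_along_cong)
    fix t :: real assume t: "t \<in> {0..1}"
    have "(2 * t + 2) / 2 - 1 = t" by (simp add: field_simps)
    \<comment> \<open>At t = 0 the parameter is 1/2, which \<open>joinpaths\<close> assigns to the
      first path; the common endpoint of the two paths settles this case.\<close>
    then show "(\<gamma> +++ \<sigma>) ((t + 1) / 2) = \<sigma> t"
      using t join by (cases "t = 0") (simp_all add: joinpaths_def pathstart_def pathfinish_def)
  qed
  from primitive_along_unique[OF this \<psi>, of 0 1] have "\<theta> 1 - \<theta> (1 / 2) = \<psi> 1 - \<psi> 0" by simp
  with 1 show ?thesis by simp
qed

text \<open>The first path followed by the reverse of the second is a loop, whose increment is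
  zero.\<close>

lemma primitive_along_path_independent:
  assumes sc: "simply_connected (UNIV :: 'm set)" and "path \<gamma>" "path \<sigma>"
    and ends: "pathstart \<gamma> = pathstart \<sigma>" "pathfinish \<gamma> = pathfinish \<sigma>"
    and \<phi>: "primitive_along \<gamma> {0..1} \<phi>" and \<psi>: "primitive_along \<sigma> {0..1} \<psi>"
  shows "\<phi> 1 - \<phi> 0 = \<psi> 1 - \<psi> 0"
proof -
  have path: "path (\<gamma> +++ reversepath \<sigma>)"
    using assms by simp
  then obtain \<theta> where \<theta>: "primitive_along (\<gamma> +++ reversepath \<sigma>) {0..1} \<theta>"
    using primitive_along_path by blast
  have "primitive_along (\<lambda>t. \<sigma> (1 - t)) {0..1} (\<lambda>t. \<psi> (1 - t))"
    by (rule primitive_along_pullback[OF \<psi>]) (auto intro!: continuous_intros)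
  then have "primitive_along (reversepath \<sigma>) {0..1} (\<lambda>t. \<psi> (1 - t))"
    by (simp add: reversepath_def)
  from primitive_along_join[OF \<theta> _ \<phi> this] primitive_along_loop[OF sc path _ \<theta>]
  show ?thesis using ends by simp
qed

text \<open>Continuation from a base point: F is the increment along any path to the point.
  Appending a path that stays in U adds the increment of f, because f composed with that path is a
  primitive along it.\<close>

theorem global_primitive:
  assumes sc: "simply_connected (UNIV :: 'm set)"
  shows "\<exists>F. \<forall>U f. L U f \<longrightarrow> (\<forall>x\<in>U. \<forall>y\<in>U. F y - F x = f y - f x)"
proof -
  fix m0 :: 'm
  have path_to: "\<exists>\<gamma>. path \<gamma> \<and> pathstart \<gamma> = m0 \<and> pathfinish \<gamma> = m" for m
  proof -
    \<comment> \<open>\<open>simply_connected\<close> relates any two loops, in particular two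
      constant ones, and thereby contains path connectedness.\<close>
    have "homotopic_loops UNIV (\<lambda>_. m0) (\<lambda>_. m)"
      using sc unfolding simply_connected_def by (simp add: path_def pathstart_def pathfinish_def)
    then have "path_component UNIV m0 m"
      using homotopic_loops_imp_path_component_value[of UNIV "\<lambda>_. m0" "\<lambda>_. m" 0] by simp
    then show ?thesis unfolding path_component_def by blast
  qed
  \<comment> \<open>Path independence leaves exactly one value to choose from.\<close>
  define F where "F m = (SOME r. \<exists>\<gamma> \<phi>. path \<gamma> \<and> pathstart \<gamma> = m0 \<and> pathfinish \<gamma> = m \<and>
     primitive_along \<gamma> {0..1} \<phi> \<and> r = \<phi> 1 - \<phi> 0)" for m
  have F: "F m = \<phi> 1 - \<phi> 0" if "path \<gamma>" "pathstart \<gamma> = m0" "pathfinish \<gamma> = m" "primitive_along \<gamma> {0..1} \<phi>" for m \<gamma> \<phi>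
    unfolding F_def
    by (rule some_equality) (use that primitive_along_path_independent[OF sc] in metis)+
  have "F y - F x = f y - f x" if U: "L U f" "x \<in> U" "y \<in> U" for U f x y
  proof -
    obtain \<gamma> where \<gamma>: "path \<gamma>" "pathstart \<gamma> = m0" "pathfinish \<gamma> = x" using path_to by blast
    obtain \<sigma> where \<sigma>: "path \<sigma>" "path_image \<sigma> \<subseteq> U" "pathstart \<sigma> = x" "pathfinish \<sigma> = y"
      using L_path_connected[OF U(1)] U(2,3) unfolding path_connected_def by metis
    obtain \<phi> where \<phi>: "primitive_along \<gamma> {0..1} \<phi>" using primitive_along_path[OF \<gamma>(1)] by blast
    have \<psi>: "primitive_along \<sigma> {0..1} (\<lambda>t. f (\<sigma> t))"
      using \<sigma>(1,2) U(1) by (intro primitive_along_local) (auto simp: path_def path_image_def)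
    have path: "path (\<gamma> +++ \<sigma>)" using \<gamma> \<sigma> by simp
    obtain \<theta> where \<theta>: "primitive_along (\<gamma> +++ \<sigma>) {0..1} \<theta>" using primitive_along_path[OF path] by blast
    have "F x = \<phi> 1 - \<phi> 0" using F[OF \<gamma> \<phi>] .
    moreover have "F y = \<theta> 1 - \<theta> 0" using F[OF path _ _ \<theta>] \<gamma> \<sigma> by simp
    moreover have "\<theta> 1 - \<theta> 0 = (\<phi> 1 - \<phi> 0) + (f (\<sigma> 1) - f (\<sigma> 0))"
      using primitive_along_join[OF \<theta> _ \<phi> \<psi>] \<gamma> \<sigma> by simp
    ultimately show ?thesis using \<sigma>(3,4) by (simp add: pathstart_def pathfinish_def)
  qed
  then show ?thesis by blast
qed

end

section \<open>Static potentials on a simply connected manifold\<close>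

lemma (in riemannian_chart) riemannian_chart_subset:
  "open T \<Longrightarrow> T \<subseteq> S \<Longrightarrow> riemannian_chart T h"
  using inner smooth_on_subset[OF smooth] by unfold_locales auto

lemma (in static_chart) static_chart_subset:
  "open T \<Longrightarrow> T \<subseteq> S \<Longrightarrow> static_chart T h"
  using riemannian_chart_subset inj_B
  by (auto simp: static_chart_def static_chart_axioms_def)

section \<open>Charts of a smooth atlas\<close>

context
  fixes A :: "('m::{t2_space,second_countable_topology}, 'n::finite) chart set"
  assumes atlas: "smooth_atlas A"
begin

lemma chart_cover: "\<exists>c\<in>A. m \<in> fst c"
  using atlas unfolding smooth_atlas_def by blast

lemma
  assumes c: "c \<in> A"
  shows open_chart_domain: "open (fst c)"
    and open_chart_image: "open (chart_image c)"
    and chart_homeomorphism: "homeomorphism (fst c) (chart_image c) (snd c) (chart_inv c)"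
  using atlas c unfolding smooth_atlas_def by blast+

lemma
  assumes c: "c \<in> A"
  shows chart_inv_chart: "m \<in> fst c \<Longrightarrow> chart_inv c (snd c m) = m"
    and chart_chart_inv: "p \<in> chart_image c \<Longrightarrow> snd c (chart_inv c p) = p"
    and chart_inv_in: "p \<in> chart_image c \<Longrightarrow> chart_inv c p \<in> fst c"
    and chart_in: "m \<in> fst c \<Longrightarrow> snd c m \<in> chart_image c"
    and continuous_on_chart: "continuous_on (fst c) (snd c)"
    and continuous_on_chart_inv: "continuous_on (chart_image c) (chart_inv c)"
  using chart_homeomorphism[OF c] unfolding homeomorphism_def by auto

lemma open_chart_vimage:
  assumes c: "c \<in> A" and Q: "open Q"
  shows "open {m \<in> fst c. snd c m \<in> Q}"
proof -
  have "open (snd c -` Q \<inter> fst c)"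
    using continuous_on_open_vimage[OF open_chart_domain[OF c]] continuous_on_chart[OF c] Q by blast
  also have "snd c -` Q \<inter> fst c = {m \<in> fst c. snd c m \<in> Q}" by auto
  finally show ?thesis .
qed

lemma open_chart_image_of:
  assumes c: "c \<in> A" and U: "open U" "U \<subseteq> fst c"
  shows "open (snd c ` U)"
proof -
  have "openin (top_of_set (fst c)) U" using U open_chart_domain[OF c] by (simp add: openin_open_eq)
  then have "openin (top_of_set (chart_image c)) (snd c ` U)"
    by (rule homeomorphism_imp_open_map[OF chart_homeomorphism[OF c]])
  then show ?thesis using openin_open_eq[OF open_chart_image[OF c]] by blast
qed

end

locale static_manifold =
  fixes A :: "('m::{t2_space,second_countable_topology}, 'n::finite) chart set"
    and g :: "('m, 'n) chart \<Rightarrow> 'n metric"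
    and lam :: real
  assumes dim: "CARD('n) \<ge> 2"
    and manifold: "riemannian_manifold A g"
    and simply_connected: "simply_connected (UNIV :: 'm set)"
    and inj_B: "\<forall>c\<in>A. \<forall>p\<in>chart_image c. inj (B_hom (g c) p)"
begin

lemma atlas: "smooth_atlas A" and metric: "riemannian_metric A g"
  using manifold by (auto simp: riemannian_manifold_def)

lemma static_chart:
  assumes c: "c \<in> A"
  shows "static_chart (chart_image c) (g c)"
proof (unfold_locales)
  show "open (chart_image c)" by (rule open_chart_image[OF atlas c])
  show "inner_form (g c p)" if "p \<in> chart_image c" for p
    using metric c that unfolding riemannian_metric_def inner_form_def by blast
  show "smooth_on (chart_image c) (\<lambda>p. g c p x y)" for x y
    using metric c unfolding riemannian_metric_def by blast
  show "inj (B_hom (g c) p)" if "p \<in> chart_image c" for p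
    using inj_B c that by blast
qed

lemma connected_UNIV: "connected (UNIV :: 'm set)"
proof -
  have "path_component UNIV m0 m" for m0 m :: 'm
  proof -
    have "homotopic_loops UNIV (\<lambda>_. m0) (\<lambda>_. m)"
      using simply_connected unfolding simply_connected_def by (simp add: path_def pathstart_def pathfinish_def)
    then show ?thesis
      using homotopic_loops_imp_path_component_value[of UNIV "\<lambda>_. m0" "\<lambda>_. m" 0] by simp
  qed
  then have "path_connected (UNIV :: 'm set)" by (simp add: path_connected_component)
  then show ?thesis by (rule path_connected_imp_connected)
qed

section \<open>From a static potential to the vanishing of G\<close>

context
  fixes v assumes v: "static_potential A g lam v"
begin

lemma static_chart_function:
  assumes c: "c \<in> A"
  shows "smooth_on (chart_image c) (\<lambda>p. v (chart_inv c p))"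
    and "p \<in> chart_image c \<Longrightarrow> scal (g c) p = (real CARD('n) - 1) * lam"
    and "p \<in> chart_image c \<Longrightarrow> hessian (g c) (\<lambda>p. v (chart_inv c p)) p x y
      = v (chart_inv c p) * (Ric (g c) p x y - lam * g c p x y)"
proof -
  interpret C: static_chart "chart_image c" "g c" by (rule static_chart[OF c])
  show "smooth_on (chart_image c) (\<lambda>p. v (chart_inv c p))"
    using v c unfolding static_potential_def smooth_function_def by (simp add: o_def)
  show scal: "scal (g c) p = (real CARD('n) - 1) * lam" if "p \<in> chart_image c" for p
    using v c that unfolding static_potential_def by blast
  show "hessian (g c) (\<lambda>p. v (chart_inv c p)) p x y
      = v (chart_inv c p) * (Ric (g c) p x y - lam * g c p x y)" if p: "p \<in> chart_image c" for p x y
  proof (rule C.static_imp_hessian[OF p dim scal[OF p]])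
    show "0 = v (chart_inv c p) * Ric (g c) p x y - hessian (g c) (\<lambda>p. v (chart_inv c p)) p x y
        + laplacian (g c) (\<lambda>p. v (chart_inv c p)) p * g c p x y" for x y
      using v c p unfolding static_potential_def o_def by blast
  qed
qed

lemma static_potential_zero_open:
  assumes "v m = 0"
  shows "\<exists>N. open N \<and> m \<in> N \<and> (\<forall>m'\<in>N. v m' = 0)"
proof -
  obtain c where c: "c \<in> A" "m \<in> fst c" using chart_cover[OF atlas] by blast
  interpret C: static_chart "chart_image c" "g c" by (rule static_chart[OF c(1)])
  let ?u = "\<lambda>p. v (chart_inv c p)" and ?p = "snd c m"
  note u = static_chart_function[OF c(1)]
  have p: "?p \<in> chart_image c" by (rule chart_in[OF atlas c])
  have u0: "?u ?p = 0" using assms by (simp add: chart_inv_chart[OF atlas c])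
  have nn: "v m \<ge> 0" for m using v by (simp add: static_potential_def)
  have "fd ?u ?p = (\<lambda>_. 0)"
    by (rule differential_zero_maxmin[OF p C.open_S fd_works[OF smooth_on_differentiable[OF u(1) p]]])
       (use nn u0 in auto)
  then have d0: "fd ?u ?p x = 0" for x by simp
  obtain e where e: "e > 0" "ball ?p e \<subseteq> chart_image c" using C.open_S p openE by blast
  have zero: "?u q = 0" if "q \<in> ball ?p e" for q
    by (rule C.static_zero[OF p u(1) u0 d0 u(3) e(2) that])
  let ?N = "{m' \<in> fst c. snd c m' \<in> ball ?p e}"
  have "v m' = 0" if "m' \<in> ?N" for m'
    using zero[of "snd c m'"] that by (simp add: chart_inv_chart[OF atlas c(1)])
  moreover have "open ?N" by (rule open_chart_vimage[OF atlas c(1) open_ball])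
  moreover have "m \<in> ?N" using c(2) e(1) by simp
  ultimately show ?thesis by blast
qed

lemma static_potential_nonzero_open:
  assumes "v m \<noteq> 0"
  shows "\<exists>N. open N \<and> m \<in> N \<and> (\<forall>m'\<in>N. v m' \<noteq> 0)"
proof -
  obtain c where c: "c \<in> A" "m \<in> fst c" using chart_cover[OF atlas] by blast
  let ?u = "\<lambda>p. v (chart_inv c p)"
  have "continuous_on (chart_image c) ?u"
    by (rule smooth_on_imp_continuous_on[OF static_chart_function(1)[OF c(1)]])
  moreover have "open (- {0::real})" by auto
  ultimately have "open (?u -` (- {0}) \<inter> chart_image c)"
    using continuous_on_open_vimage[OF open_chart_image[OF atlas c(1)]] by blast
  then have "open {m' \<in> fst c. snd c m' \<in> ?u -` (- {0}) \<inter> chart_image c}" (is "open ?N")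
    by (rule open_chart_vimage[OF atlas c(1)])
  moreover have "m \<in> ?N"
    using c assms by (simp add: chart_inv_chart[OF atlas c(1)] chart_in[OF atlas c(1)])
  moreover have "v m' \<noteq> 0" if "m' \<in> ?N" for m'
    using that by (auto simp: chart_inv_chart[OF atlas c(1)])
  ultimately show ?thesis by blast
qed

text \<open>The zero set of v is open by uniqueness for the linear system and closed by continuity.
  The manifold is connected and v is not identically zero, so the zero set is empty.\<close>

lemma static_potential_pos: "v m > 0"
proof -
  have "(\<lambda>m. v m = 0) constant_on UNIV"
  proof (rule locally_constant_imp_constant[OF connected_UNIV])
    fix m
    show "\<exists>T. openin (top_of_set UNIV) T \<and> m \<in> T \<and> (\<forall>x\<in>T. (v x = 0) = (v m = 0))"
      using static_potential_zero_open[of m] static_potential_nonzero_open[of m]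
      by (cases "v m = 0") auto
  qed
  then obtain b where "\<forall>m\<in>UNIV. (v m = 0) = b"
    unfolding constant_on_def by (rule exE)
  then have b: "(v m = 0) = b" for m by simp
  obtain m1 where "v m1 \<noteq> 0" using v unfolding static_potential_def by (elim conjE exE)
  then have "v m \<noteq> 0" using b[of m] b[of m1] by simp
  moreover have "v m \<ge> 0" using v by (simp add: static_potential_def)
  ultimately show ?thesis by simp
qed

lemma static_potential_imp_G_tensor:
  assumes c: "c \<in> A" and p: "p \<in> chart_image c"
  shows "G_tensor (g c) lam p x y = 0"
proof -
  interpret C: static_chart "chart_image c" "g c" by (rule static_chart[OF c])
  note u = static_chart_function[OF c]
  show ?thesis
    by (rule C.static_G_tensor[OF p dim u(2) u(1) static_potential_pos u(3)])
qed

end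

section \<open>From the vanishing of G to a static potential\<close>

context
  assumes scal: "\<And>c p. c \<in> A \<Longrightarrow> p \<in> chart_image c \<Longrightarrow> scal (g c) p = (real CARD('n) - 1) * lam"
    and G: "\<And>c p x y. c \<in> A \<Longrightarrow> p \<in> chart_image c \<Longrightarrow> G_tensor (g c) lam p x y = 0"
begin

text \<open>f is the logarithm of a static potential on U. It lives on the manifold instead of the
  chart image, so that functions coming from different charts can be compared, and U is path
  connected as \<open>local_primitives\<close> demands.\<close>

definition local_log :: "('m, 'n) chart \<Rightarrow> 'm set \<Rightarrow> ('m \<Rightarrow> real) \<Rightarrow> bool" where
  "local_log c U f \<longleftrightarrow> open U \<and> path_connected U \<and> U \<subseteq> fst c \<and>
     (\<forall>m\<in>U. ((\<lambda>q. f (chart_inv c q)) has_derivative K_form (g c) (snd c m)) (at (snd c m)))"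

lemma ex_local_log:
  assumes c: "c \<in> A" and m: "m \<in> fst c"
  shows "\<exists>U f. local_log c U f \<and> m \<in> U"
proof -
  interpret C: static_chart "chart_image c" "g c" by (rule static_chart[OF c])
  obtain e where e: "e > 0" "ball (snd c m) e \<subseteq> chart_image c"
    using C.open_S chart_in[OF atlas c m] openE by blast
  let ?B = "ball (snd c m) e"
  obtain f where f: "\<forall>q\<in>?B. (f has_derivative K_form (g c) q) (at q)"
    using poincare_ball[OF C.linear_K_form[OF subsetD[OF e(2)]] smooth_on_subset[OF C.smooth_K_form e(2)]
        C.G_tensor_imp_closed[OF subsetD[OF e(2)] G[OF c subsetD[OF e(2)]]]] by blast
  let ?U = "{m' \<in> fst c. snd c m' \<in> ?B}"
  have U: "?U = chart_inv c ` ?B"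
  proof
    show "?U \<subseteq> chart_inv c ` ?B"
    proof
      fix m' assume m': "m' \<in> ?U"
      then have "m' = chart_inv c (snd c m')" by (simp add: chart_inv_chart[OF atlas c])
      with m' show "m' \<in> chart_inv c ` ?B" by blast
    qed
    show "chart_inv c ` ?B \<subseteq> ?U"
      using e(2) chart_inv_in[OF atlas c] chart_chart_inv[OF atlas c] by (auto simp del: mem_ball)
  qed
  have "path_connected ?U"
    unfolding U
    by (rule path_connected_continuous_image[OF continuous_on_subset[OF continuous_on_chart_inv[OF atlas c] e(2)]])
       (simp add: convex_imp_path_connected)
  moreover have "((\<lambda>q. f (snd c (chart_inv c q))) has_derivative K_form (g c) (snd c m')) (at (snd c m'))"
    if "m' \<in> ?U" for m'
  proof (rule has_derivative_transform_within_open[of f _ _ _ ?B])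
    show "(f has_derivative K_form (g c) (snd c m')) (at (snd c m'))" using f that by blast
    show "f q = f (snd c (chart_inv c q))" if "q \<in> ?B" for q
      using that e(2) by (simp add: chart_chart_inv[OF atlas c] subset_iff del: mem_ball)
  qed (use that in auto)
  ultimately have "local_log c ?U (\<lambda>m. f (snd c m))"
    unfolding local_log_def using open_chart_vimage[OF atlas c open_ball] by blast
  moreover have "m \<in> ?U" using m e(1) by simp
  ultimately show ?thesis by blast
qed

text \<open>The difference is examined in the chart c, where both functions have the same derivative
  K: f by definition, k by \<open>K_form_pullback\<close>. Hence it is constant on a ball.\<close>

lemma local_log_overlap:
  assumes c: "c \<in> A" "local_log c U f" and d: "d \<in> A" "local_log d V k" and m: "m \<in> U" "m \<in> V"
  shows "\<exists>N. open N \<and> m \<in> N \<and> (\<forall>x\<in>N. f x - k x = f m - k m)"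
proof -
  interpret C: static_chart "chart_image c" "g c" by (rule static_chart[OF c(1)])
  interpret D: static_chart "chart_image d" "g d" by (rule static_chart[OF d(1)])
  have U: "open U" "U \<subseteq> fst c" and V: "open V" "V \<subseteq> fst d"
    using c(2) d(2) by (auto simp: local_log_def)
  let ?\<tau> = "transition c d"
  \<comment> \<open>f and k are primitives on U and V only, so the change of charts is restricted to
    the image of their intersection; its target is the image of all of V, where k is a
    primitive.\<close>
  define W where "W = snd c ` (U \<inter> V)"
  define S' where "S' = snd d ` V"
  have W: "open W" "W \<subseteq> chart_image c" "W \<subseteq> snd c ` (fst c \<inter> fst d)"
    using U V open_chart_image_of[OF atlas c(1), of "U \<inter> V"] by (auto simp: W_def chart_image_def)
  have S': "open S'" "S' \<subseteq> chart_image d"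
    using V open_chart_image_of[OF atlas d(1)] by (auto simp: S'_def chart_image_def)
  have inW: "chart_inv c q \<in> U" "chart_inv c q \<in> V" "?\<tau> q \<in> S'" "chart_inv d (?\<tau> q) = chart_inv c q"
    if q: "q \<in> W" for q
  proof -
    obtain m' where m': "m' \<in> U" "m' \<in> V" "q = snd c m'" using q by (auto simp: W_def)
    then have "chart_inv c q = m'" using U(2) by (auto simp: chart_inv_chart[OF atlas c(1)])
    with m' show "chart_inv c q \<in> U" "chart_inv c q \<in> V" "?\<tau> q \<in> S'" "chart_inv d (?\<tau> q) = chart_inv c q"
      using V(2) by (auto simp: transition_def S'_def chart_inv_chart[OF atlas d(1)])
  qed
  have \<tau>: "smooth_on W ?\<tau>"
    using atlas c(1) d(1) W(3) smooth_on_subset unfolding smooth_atlas_def by blast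
  have iso: "g c p x y = g d (?\<tau> p) (fd ?\<tau> p x) (fd ?\<tau> p y)" if "p \<in> W" for p x y
  proof -
    have "p \<in> snd c ` (fst c \<inter> fst d)" using that W(3) by blast
    then show ?thesis using metric c(1) d(1) unfolding riemannian_metric_def by blast
  qed
  have change: "chart_change W (g c) S' (g d) ?\<tau>"
    using C.riemannian_chart_subset[OF W(1,2)] D.riemannian_chart_subset[OF S'] \<tau> iso inW(3)
    by (simp add: chart_change_def chart_change_axioms_def)
  have k: "((\<lambda>q. k (chart_inv d q)) has_derivative K_form (g d) q) (at q)" if "q \<in> S'" for q
    using d(2) that by (auto simp: local_log_def S'_def)
  have kW: "((\<lambda>q. k (chart_inv c q)) has_derivative K_form (g c) p) (at p)" if p: "p \<in> W" for p
  proof -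
    have "K_form (g c) p = fd (\<lambda>q. k (chart_inv d (?\<tau> q))) p"
      using K_form_pullback[OF C.static_chart_subset[OF W(1,2)] D.static_chart_subset[OF S'] change p dim
          scal[OF c(1) subsetD[OF W(2) p]] k G[OF d(1) subsetD[OF S'(2)]]]
      by (rule ext)
    moreover have "(\<lambda>q. k (chart_inv d (?\<tau> q))) differentiable (at p)"
      using has_derivative_compose[OF smooth_on_has_derivative[OF \<tau> p] k[OF inW(3)[OF p]]]
      unfolding differentiable_def by blast
    ultimately have "((\<lambda>q. k (chart_inv d (?\<tau> q))) has_derivative K_form (g c) p) (at p)"
      using fd_works by metis
    then show ?thesis
      by (rule has_derivative_transform_within_open[OF _ W(1) p]) (simp add: inW(4))
  qed
  have fW: "((\<lambda>q. f (chart_inv c q)) has_derivative K_form (g c) p) (at p)" if p: "p \<in> W" for p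
    using c(2) that by (auto simp: local_log_def W_def)
  have "snd c m \<in> W" using m by (auto simp: W_def)
  then obtain e where e: "e > 0" "ball (snd c m) e \<subseteq> W" using W(1) openE by blast
  let ?B = "ball (snd c m) e"
  have der: "((\<lambda>q. f (chart_inv c q) - k (chart_inv c q)) has_derivative (\<lambda>_. 0)) (at q within ?B)"
    if "q \<in> ?B" for q
  proof -
    have "q \<in> W" using that e(2) by blast
    from has_derivative_diff[OF fW[OF this] kW[OF this]] show ?thesis
      by (simp add: has_derivative_at_withinI)
  qed
  have const: "f (chart_inv c q) - k (chart_inv c q) = f (chart_inv c (snd c m)) - k (chart_inv c (snd c m))"
    if "q \<in> ?B" for q
    by (rule has_derivative_zero_unique[OF convex_ball der that]) (use e(1) in auto)
  have mc: "m \<in> fst c" using m U by blast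
  show ?thesis
  proof (intro exI conjI ballI)
    show "open {m' \<in> fst c. snd c m' \<in> ?B}" by (rule open_chart_vimage[OF atlas c(1) open_ball])
    show "m \<in> {m' \<in> fst c. snd c m' \<in> ?B}" using mc e(1) by simp
    show "f x - k x = f m - k m" if "x \<in> {m' \<in> fst c. snd c m' \<in> ?B}" for x
      using const[of "snd c x"] that by (simp add: chart_inv_chart[OF atlas c(1)] mc)
  qed
qed

text \<open>Near every point F agrees with a local primitive up to a constant, so in each chart its
  derivative is K throughout; taking \<open>exp\<close> makes the potential positive.\<close>

lemma G_tensor_imp_static_potential: "\<exists>v. static_potential A g lam v"
proof -
  interpret local_primitives "\<lambda>U f. \<exists>c\<in>A. local_log c U f"
  proof
    show "\<exists>U f. (\<exists>c\<in>A. local_log c U f) \<and> m \<in> U" for m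
      using chart_cover[OF atlas, of m] ex_local_log by blast
  next
    fix U V f k m
    assume "\<exists>c\<in>A. local_log c U f" "\<exists>c\<in>A. local_log c V k" and m: "m \<in> U" "m \<in> V"
    then obtain c d where "c \<in> A" "local_log c U f" "d \<in> A" "local_log d V k" by (elim bexE)
    from local_log_overlap[OF this m] show "\<exists>N. open N \<and> m \<in> N \<and> (\<forall>x\<in>N. f x - k x = f m - k m)"
      .
  qed (auto simp: local_log_def)
  obtain F where F: "\<And>c U f x y. c \<in> A \<Longrightarrow> local_log c U f \<Longrightarrow> x \<in> U \<Longrightarrow> y \<in> U \<Longrightarrow> F y - F x = f y - f x"
    using global_primitive[OF simply_connected] by blast
  have dF: "((\<lambda>q. F (chart_inv c q)) has_derivative K_form (g c) p) (at p)"
    if c: "c \<in> A" and p: "p \<in> chart_image c" for c p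
  proof -
    let ?m = "chart_inv c p"
    obtain U f where U: "local_log c U f" "?m \<in> U"
      using ex_local_log[OF c chart_inv_in[OF atlas c p]] by blast
    have Uc: "open U" "U \<subseteq> fst c" using U(1) by (auto simp: local_log_def)
    have "((\<lambda>q. f (chart_inv c q)) has_derivative K_form (g c) p) (at p)"
      using U chart_chart_inv[OF atlas c p] unfolding local_log_def by metis
    then have D: "((\<lambda>q. f (chart_inv c q) + (F ?m - f ?m)) has_derivative K_form (g c) p) (at p)"
      using has_derivative_add_const by blast
    show ?thesis
    proof (rule has_derivative_transform_within_open[OF D open_chart_image_of[OF atlas c Uc]])
      show "p \<in> snd c ` U" using U(2) chart_chart_inv[OF atlas c p] by force
      show "f (chart_inv c q) + (F ?m - f ?m) = F (chart_inv c q)" if "q \<in> snd c ` U" for q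
      proof -
        have "chart_inv c q \<in> U" using that Uc(2) by (auto simp: chart_inv_chart[OF atlas c] subset_iff)
        from F[OF c U(1,2) this] show ?thesis by simp
      qed
    qed
  qed
  have "static_potential A g lam (\<lambda>m. exp (F m))"
    unfolding static_potential_def smooth_function_def o_def
  proof (intro conjI ballI allI)
    fix c p x y assume c: "c \<in> A"
    interpret C: static_chart "chart_image c" "g c" by (rule static_chart[OF c])
    show "smooth_on (chart_image c) (\<lambda>p. exp (F (chart_inv c p)))"
      by (rule C.smooth_exp_primitive[OF dF[OF c]])
    assume p: "p \<in> chart_image c"
    show "scal (g c) p = (real CARD('n) - 1) * lam" by (rule scal[OF c p])
    show "0 = exp (F (chart_inv c p)) * Ric (g c) p x y
       - hessian (g c) (\<lambda>p. exp (F (chart_inv c p))) p x y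
       + laplacian (g c) (\<lambda>p. exp (F (chart_inv c p))) p * g c p x y"
      by (rule C.hessian_imp_static[OF p scal[OF c p]
            C.G_tensor_imp_hessian[where f = "\<lambda>p. F (chart_inv c p)", OF p dF[OF c] G[OF c p]]])
  qed auto
  then show ?thesis by blast
qed

end

end

theorem theorem5p3:
  fixes A :: "('m::{t2_space,second_countable_topology}, 'n::finite) chart set"
    and g :: "('m, 'n) chart \<Rightarrow> 'n metric"
    and lam :: real
  assumes "CARD('n) \<ge> 2"
    and "riemannian_manifold A g"
    and "simply_connected (UNIV :: 'm set)"
    and "\<forall>c\<in>A. \<forall>p\<in>chart_image c. inj (B_hom (g c) p)"
  shows "(\<exists>v. static_potential A g lam v) \<longleftrightarrow>
    (\<forall>c\<in>A. \<forall>p\<in>chart_image c. scal (g c) p = (real CARD('n) - 1) * lam) \<and>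
    (\<forall>c\<in>A. \<forall>p\<in>chart_image c. \<forall>x y. G_tensor (g c) lam p x y = 0)"
proof -
  interpret static_manifold A g lam by (unfold_locales) (fact assms)+
  show ?thesis
  proof
    assume "\<exists>v. static_potential A g lam v"
    then obtain v where v: "static_potential A g lam v" by blast
    then have "\<forall>c\<in>A. \<forall>p\<in>chart_image c. scal (g c) p = (real CARD('n) - 1) * lam"
      by (simp add: static_potential_def)
    with static_potential_imp_G_tensor[OF v] show "(\<forall>c\<in>A. \<forall>p\<in>chart_image c. scal (g c) p = (real CARD('n) - 1) * lam) \<and>
        (\<forall>c\<in>A. \<forall>p\<in>chart_image c. \<forall>x y. G_tensor (g c) lam p x y = 0)"
      by blast
  next
    assume "(\<forall>c\<in>A. \<forall>p\<in>chart_image c. scal (g c) p = (real CARD('n) - 1) * lam) \<and>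
        (\<forall>c\<in>A. \<forall>p\<in>chart_image c. \<forall>x y. G_tensor (g c) lam p x y = 0)"
    then show "\<exists>v. static_potential A g lam v"
      by (intro G_tensor_imp_static_potential) auto
  qed
qed

end
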